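(* Let $k\ge 3$ be a fixed integer with $k\equiv 1$ or $3\pmod 6$. Then there exists a constant $c>0$ such that for every constant $\epsilon$ with $0<\epsilon\le c$ there exists a constant $\delta=\delta(\epsilon)>0$ such that \[ g(\mathcal{T}_3,(k-1)/k-\epsilon)\le \frac{k-1}{k^2}-\delta \quad\text{and}\quad g(\mathcal{T}_3,(k-1)/k+\epsilon)\le \frac{k-1}{k^2}-\delta . \] In particular, the point $((k-1)/k,(k-1)/k^2)$ is a local maximum of $g(\mathcal{T}_3)$.
   Context: $\mathcal{T}_3$ is the family of $3$-graphs with at most $5$ vertices and three edges $A,B,C$ with $A\triangle B\subseteq C$; a $3$-graph is $\mathcal{T}_3$-free iff it is cancellative (contains no three distinct edges $A,B,C$ with $A\triangle B\subseteq C$). For a $3$-graph $\mathcal{H}$ on $n$ vertices, $\partial\mathcal{H}=\{A:|A|=2,\ A\subset B\text{ for some }B\in\mathcal{H}\}$, $d(\mathcal{H})=|\mathcal{H}|/\binom{n}{3}$, $d(\partial\mathcal{H})=|\partial\mathcal{H}|/\binom n2$. The feasible region $\Omega(\mathcal{T}_3)$ is the set of points $(x,y)\in[0,1]^2$ for which there is a sequence of $\mathcal{T}_3$-free $3$-graphs $\mathcal{H}_m$ with $|V(\mathcal{H}_m)|\to\infty$, $d(\partial\mathcal{H}_m)\to x$ and $d(\mathcal{H}_m)\to y$. With $\mathrm{proj}\,\Omega(\mathcal{T}_3)=\{x:\exists y,\ (x,y)\in\Omega(\mathcal{T}_3)\}$, the feasible region function is $g(\mathcal{T}_3,x)=\max\{y:(x,y)\in\Omega(\mathcal{T}_3)\}$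 for $x\in\mathrm{proj}\,\Omega(\mathcal{T}_3)$. *)

theory Defs
  imports Complex_Main
begin

text \<open>A hypergraph is a pair of a vertex set and an edge set; isolated vertices are allowed.\<close>

type_synonym 'a hgraph = "'a set \<times> 'a set set"

abbreviation verts :: "'a hgraph \<Rightarrow> 'a set" where "verts H \<equiv> fst H"
abbreviation edges :: "'a hgraph \<Rightarrow> 'a set set" where "edges H \<equiv> snd H"

definition three_graph :: "'a hgraph \<Rightarrow> bool" where
  "three_graph H \<longleftrightarrow> finite (verts H) \<and> (\<forall>e\<in>edges H. e \<subseteq> verts H \<and> card e = 3)"

text \<open>Containment as a not necessarily induced subgraph, up to isomorphism.\<close>

definition contains_copy :: "'a hgraph \<Rightarrow> 'b hgraph \<Rightarrow> bool" where
  "contains_copy H F \<longleftrightarrow>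
     (\<exists>f. inj_on f (verts F) \<and> f ` verts F \<subseteq> verts H \<and> (\<forall>e\<in>edges F. f ` e \<in> edges H))"

definition free_of :: "'b hgraph set \<Rightarrow> 'a hgraph \<Rightarrow> bool" where
  "free_of \<F> H \<longleftrightarrow> (\<forall>F\<in>\<F>. \<not> contains_copy H F)"

text \<open>All labelled representatives of the finitely many isomorphism types are included.\<close>

definition T3 :: "nat hgraph set" where
  "T3 = {F. three_graph F \<and> card (verts F) \<le> 5 \<and>
            (\<exists>A B C. edges F = {A, B, C} \<and> A \<noteq> B \<and> A \<noteq> C \<and> B \<noteq> C \<and>
                     (A - B) \<union> (B - A) \<subseteq> C)}"

definition cancellative :: "'a hgraph \<Rightarrow> bool" where
  "cancellative H \<longleftrightarrow>
     \<not> (\<exists>A\<in>edges H. \<exists>B\<in>edges H. \<exists>C\<in>edges H.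
          A \<noteq> B \<and> A \<noteq> C \<and> B \<noteq> C \<and> (A - B) \<union> (B - A) \<subseteq> C)"

lemma T3_free_iff_cancellative:
  assumes H: "three_graph H"
  shows "free_of T3 H \<longleftrightarrow> cancellative H"
proof
  assume c: "cancellative H"
  show "free_of T3 H"
    unfolding free_of_def
  proof (intro ballI notI)
    fix F :: "nat hgraph" assume F: "F \<in> T3" and "contains_copy H F"
    then obtain f where f: "inj_on f (verts F)" "\<forall>e\<in>edges F. f ` e \<in> edges H"
      unfolding contains_copy_def by blast
    from F have tF: "three_graph F" unfolding T3_def by simp
    from F obtain A B C where ABC: "edges F = {A, B, C}" "A \<noteq> B" "A \<noteq> C" "B \<noteq> C"
        "(A - B) \<union> (B - A) \<subseteq> C"
      unfolding T3_def mem_Collect_eq by (elim conjE exE)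
    have sub: "A \<subseteq> verts F" "B \<subseteq> verts F" "C \<subseteq> verts F"
      using tF ABC(1) unfolding three_graph_def by auto
    have "f ` A - f ` B = f ` (A - B)" "f ` B - f ` A = f ` (B - A)"
      using inj_on_image_set_diff[OF f(1), of A B] inj_on_image_set_diff[OF f(1), of B A] sub
      by blast+
    then have imsd: "(f ` A - f ` B) \<union> (f ` B - f ` A) \<subseteq> f ` C"
      using ABC(5) by auto
    have imne: "f ` A \<noteq> f ` B" "f ` A \<noteq> f ` C" "f ` B \<noteq> f ` C"
      using inj_on_image_eq_iff[OF f(1) sub(1) sub(2)] inj_on_image_eq_iff[OF f(1) sub(1) sub(3)]
        inj_on_image_eq_iff[OF f(1) sub(2) sub(3)] ABC by simp_all
    have imE: "f ` A \<in> edges H" "f ` B \<in> edges H" "f ` C \<in> edges H"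
      using f(2) ABC(1) by auto
    have "\<not> cancellative H"
      unfolding cancellative_def not_not by (intro bexI conjI) (fact imne imE imsd)+
    with c show False by contradiction
  qed
next
  assume fr: "free_of T3 H"
  show "cancellative H"
    unfolding cancellative_def
  proof (rule notI, elim bexE conjE)
    fix A B C
    assume E: "A \<in> edges H" "B \<in> edges H" "C \<in> edges H"
      and ne: "A \<noteq> B" "A \<noteq> C" "B \<noteq> C" and sd: "(A - B) \<union> (B - A) \<subseteq> C"
    let ?V = "A \<union> B \<union> C"
    have card3: "card A = 3" "card B = 3" "card C = 3"
      and sub: "A \<subseteq> verts H" "B \<subseteq> verts H" "C \<subseteq> verts H"
      using H E unfolding three_graph_def by auto
    have fin: "finite A" "finite B" "finite C"
      using card3 by (auto intro: card_ge_0_finite)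
    have "card (A - B) + card (B - A) \<le> card C"
      using card_mono[OF fin(3) sd] fin by (subst (asm) card_Un_disjoint) auto
    moreover have cAB: "card (A - B) = 3 - card (A \<inter> B)" "card (B - A) = 3 - card (A \<inter> B)"
      using card_Diff_subset_Int[of A B] card_Diff_subset_Int[of B A] fin card3
      by (simp_all add: Int_commute)
    ultimately have "card (A \<inter> B) \<ge> 2" using card3 by linarith
    moreover have "card (A \<inter> B) \<noteq> 3"
      using fin card3 ne(1) card_subset_eq[of A "A \<inter> B"] card_subset_eq[of B "A \<inter> B"] by auto
    moreover have "card (A \<inter> B) \<le> 3"
      using card_mono[OF fin(1), of "A \<inter> B"] card3 by simp
    ultimately have c2: "card (A \<inter> B) = 2" by linarith
    have cun: "card (A \<union> B) = 4"
      using card_Un_Int[OF fin(1,2)] card3 c2 by simp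
    have "card ((A - B) \<union> (B - A)) = 2"
      using cAB c2 fin by (subst card_Un_disjoint) auto
    then have "card (C - ((A - B) \<union> (B - A))) = 1"
      using card_Diff_subset[OF _ sd] fin card3 by simp
    moreover have "card (C - (A \<union> B)) \<le> card (C - ((A - B) \<union> (B - A)))"
      using fin by (intro card_mono) auto
    ultimately have "card (C - (A \<union> B)) \<le> 1" by simp
    moreover have "card ?V = card (A \<union> B) + card (C - (A \<union> B))"
      using card_Un_disjoint[of "A \<union> B" "C - (A \<union> B)"] fin by simp
    ultimately have cV: "card ?V \<le> 5" using cun by simp
    have finV: "finite ?V" using fin by simp
    from finite_imp_inj_to_nat_seg[OF finV] obtain h :: "_ \<Rightarrow> nat" where h: "inj_on h ?V"
      by (elim exE conjE)
    let ?F = "(h ` ?V, {h ` A, h ` B, h ` C})"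
    have sV: "A \<subseteq> ?V" "B \<subseteq> ?V" "C \<subseteq> ?V" by auto
    have d: "h ` A - h ` B = h ` (A - B)" "h ` B - h ` A = h ` (B - A)"
      using inj_on_image_set_diff[OF h, of A B] inj_on_image_set_diff[OF h, of B A] sV
      by blast+
    have "?F \<in> T3"
    proof -
      have "card (h ` A) = 3" "card (h ` B) = 3" "card (h ` C) = 3"
        using card3 card_image[OF inj_on_subset[OF h sV(1)]] card_image[OF inj_on_subset[OF h sV(2)]]
          card_image[OF inj_on_subset[OF h sV(3)]] by simp_all
      then have "three_graph ?F"
        unfolding three_graph_def using finV by auto
      moreover have "card (verts ?F) \<le> 5"
        using cV card_image[OF h] by simp
      moreover have "edges ?F = {h ` A, h ` B, h ` C}" by simp
      moreover have "h ` A \<noteq> h ` B" "h ` A \<noteq> h ` C" "h ` B \<noteq> h ` C"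
        using inj_on_image_eq_iff[OF h sV(1) sV(2)] inj_on_image_eq_iff[OF h sV(1) sV(3)]
          inj_on_image_eq_iff[OF h sV(2) sV(3)] ne by simp_all
      moreover have "(h ` A - h ` B) \<union> (h ` B - h ` A) \<subseteq> h ` C"
        using d sd by auto
      ultimately show ?thesis
        unfolding T3_def mem_Collect_eq by (intro conjI exI)
    qed
    moreover have "contains_copy H ?F"
    proof -
      let ?f = "inv_into ?V h"
      have "inj_on ?f (h ` ?V)" by (rule inj_on_inv_into) simp
      moreover have "?f ` (h ` X) = X" if "X \<subseteq> ?V" for X
        using inv_into_image_cancel[OF h that] .
      ultimately show ?thesis
        unfolding contains_copy_def using E sub sV by (intro exI[of _ ?f]) auto
    qed
    ultimately show False
      using fr unfolding free_of_def by blast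
  qed
qed

definition shadow :: "'a hgraph \<Rightarrow> 'a set set" where
  "shadow H = {A. card A = 2 \<and> (\<exists>B\<in>edges H. A \<subseteq> B)}"

definition edge_density :: "'a hgraph \<Rightarrow> real" where
  "edge_density H = real (card (edges H)) / real (card (verts H) choose 3)"

definition shadow_density :: "'a hgraph \<Rightarrow> real" where
  "shadow_density H = real (card (shadow H)) / real (card (verts H) choose 2)"

text \<open>Taking vertices in \<^typ>\<open>nat\<close> is no restriction, as only finite 3-graphs occur.\<close>

definition feasible_region :: "nat hgraph set \<Rightarrow> (real \<times> real) set" where
  "feasible_region \<F> =
     {(x, y). x \<in> {0..1} \<and> y \<in> {0..1} \<and>
        (\<exists>H :: nat \<Rightarrow> nat hgraph.
           (\<forall>m. three_graph (H m) \<and> free_of \<F> (H m)) \<and>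
           filterlim (\<lambda>m. card (verts (H m))) at_top sequentially \<and>
           (\<lambda>m. shadow_density (H m)) \<longlonglongrightarrow> x \<and>
           (\<lambda>m. edge_density (H m)) \<longlonglongrightarrow> y)}"

definition proj_region :: "nat hgraph set \<Rightarrow> real set" where
  "proj_region \<F> = {x. \<exists>y. (x, y) \<in> feasible_region \<F>}"

text \<open>A genuine maximum rather than a supremum; only meaningful for
  \<^term>\<open>x \<in> proj_region \<F>\<close>.\<close>

definition feasible_fun :: "nat hgraph set \<Rightarrow> real \<Rightarrow> real" where
  "feasible_fun \<F> x = (GREATEST y. (x, y) \<in> feasible_region \<F>)"

text \<open>The point \<open>(x, y)\<close> of the graph of \<open>f\<close>, a function with domain \<open>D\<close>, is a local maximum.\<close>

definition local_maximum_on :: "real set \<Rightarrow> (real \<Rightarrow> real) \<Rightarrow> real \<times> real \<Rightarrow> bool" where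
  "local_maximum_on D f = (\<lambda>(x, y). x \<in> D \<and> f x = y \<and>
     (\<exists>r>0. \<forall>x'\<in>D. \<bar>x' - x\<bar> < r \<longrightarrow> f x' \<le> f x))"

end

theory Submission imports Defs begin

text \<open>
  Write \<open>n\<close> for the order of a cancellative 3-graph \<open>H\<close> with shadow graph \<open>G\<close>, \<open>N(xy)\<close> for the
  neighbourhood of a pair, \<open>d(xy) = |N(xy)|\<close>, and \<open>p(z)\<close> for the number of vertices not adjacent to
  \<open>z\<close> in \<open>G\<close> (including \<open>z\<close>). Each \<open>N(xy)\<close> is independent in \<open>G\<close>, so \<open>d(xy) \<le> p(z)\<close> for every edge
  \<open>xyz\<close>. An AM-GM argument in the link of each vertex turns any weight \<open>w\<close> with \<open>d(xy) \<le> w(z)\<close> on edges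
  into \<open>6|H| \<le> \<Sum> w(y) (n - p(y))\<close>; the choice \<open>w = p\<close> yields \<open>y \<le> x (1 - x)\<close> for every feasible
  \<open>(x, y)\<close>, which settles all \<open>x \<ge> (k-1)/k\<close>.

  For \<open>x\<close> slightly below \<open>(k-1)/k\<close> suppose that \<open>H\<close> is nearly extremal. Then \<open>p\<close> is concentrated around
  \<open>n/k\<close>. After deleting the few vertices where \<open>p\<close> is too large, the sets \<open>N(xy)\<close> of size close to
  \<open>n/k\<close> are either disjoint or nearly equal, and largest representatives of the resulting \<open>k\<close> classes
  form disjoint independent sets covering nearly everything. Now let \<open>w\<close> be the size of the part on the
  parts and \<open>min p (max d)\<close> elsewhere: the loss in AM-GM, expanded to second order at equal part sizes,
  bounds \<open>6|H|/n\<^sup>3\<close> by \<open>(k-1)/k\<^sup>2\<close> minus a constant times \<open>(k-1)/k - x\<close>.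

  The value \<open>(k-1)/k\<^sup>2\<close> is attained by blow-ups of Steiner triple systems, which the Bose and Skolem
  constructions provide; deleting edges from blow-ups of larger systems realises all smaller shadow
  densities.
\<close>

section \<open>Cancellative ternary relations\<close>

text \<open>The inequality \<open>y \<le> x (1 - x)\<close> is tight at the extremal point, but its
  right side decreases for \<open>x > 1/2\<close>, so just left of (k-1)/k it still permits values
  above (k-1)/k^2; that side needs structure. Recovering the parts is not enough:
  \<open>q^2 (1 - q)\<close> has second-order coefficient \<open>1 - 3/k \<ge> 0\<close> at
  \<open>q = 1/k\<close>, so the weighted count alone does not penalise unequal parts. The squares
  dropped in AM-GM contribute \<open>-1\<close> in the limit and turn this coefficient into
  \<open>-3/k\<close>. A shadow density below (k-1)/k can come from four sources only: deleted
  vertices, uncovered vertices, unequal parts, and missing adjacencies at the parts. Each of them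
  costs a fixed multiple of its size in edge density. Triples are ordered, so that sums over pairs
  carry no symmetry factors, and deleting vertices yields another instance of the same axioms.
  \<open>R_cancel\<close> says that two vertices completing the same pair lie in no common
  edge.\<close>

locale cancellative_relation =
  fixes V :: "'a set" and R :: "'a \<Rightarrow> 'a \<Rightarrow> 'a \<Rightarrow> bool"
  assumes finite_V: "finite V"
    and R_in: "R x y z \<Longrightarrow> x \<in> V"
    and R_swap: "R x y z \<Longrightarrow> R y x z"
    and R_rot: "R x y z \<Longrightarrow> R y z x"
    and R_neq: "R x y z \<Longrightarrow> x \<noteq> y"
    and R_cancel: "R u p q \<Longrightarrow> R v p q \<Longrightarrow> \<not> R u v w"
begin

definition nb :: "'a \<Rightarrow> 'a \<Rightarrow> 'a set" where "nb x y = {z. R x y z}"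

definition codeg :: "'a \<Rightarrow> 'a \<Rightarrow> real" where "codeg x y = real (card (nb x y))"

definition adj :: "'a \<Rightarrow> 'a \<Rightarrow> bool" where "adj x y \<longleftrightarrow> (\<exists>z. R x y z)"

definition nonadj :: "'a \<Rightarrow> 'a set" where "nonadj x = {y \<in> V. \<not> adj x y}"

definition nondeg :: "'a \<Rightarrow> real" where "nondeg x = real (card (nonadj x))"

definition deg :: "'a \<Rightarrow> real" where "deg x = (\<Sum>y\<in>V. codeg x y)"

definition total :: real where "total = (\<Sum>x\<in>V. deg x)"

abbreviation order :: real where "order \<equiv> real (card V)"

lemma R_perms:
  assumes "R x y z"
  shows "R x z y" "R y x z" "R y z x" "R z x y" "R z y x"
proof -
  show a: "R y x z" by (rule R_swap[OF assms])
  show b: "R y z x" by (rule R_rot[OF assms])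
  show "R x z y" by (rule R_rot[OF a])
  show "R z x y" by (rule R_rot[OF b])
  show "R z y x" by (rule R_swap[OF b])
qed

lemma R_V:
  assumes "R x y z"
  shows "x \<in> V" "y \<in> V" "z \<in> V"
  using R_in[OF assms] R_in[OF R_perms(2)[OF assms]] R_in[OF R_perms(4)[OF assms]] .

lemma nb_sub: "nb x y \<subseteq> V"
  unfolding nb_def using R_V by blast

lemma finite_nb [simp]: "finite (nb x y)"
  using finite_subset[OF nb_sub finite_V] .

lemma finite_nonadj [simp]: "finite (nonadj x)"
  using finite_V by (simp add: nonadj_def)

lemma nonadj_sub: "nonadj x \<subseteq> V"
  by (auto simp: nonadj_def)

lemma nb_commute: "nb x y = nb y x"
  unfolding nb_def using R_swap by blast

lemma codeg_commute: "codeg x y = codeg y x"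
  by (simp add: codeg_def nb_commute)

lemma adj_commute: "adj x y \<longleftrightarrow> adj y x"
  unfolding adj_def using R_swap by blast

text \<open>Edges \<open>x y z\<close> and \<open>x y u\<close> with \<open>u \<noteq> z\<close>
  have symmetric difference \<open>{z, u}\<close>, so no edge contains both; for
  \<open>u = z\<close> the claim is that no vertex is adjacent to itself.\<close>

lemma nb_sub_nonadj: "R x y z \<Longrightarrow> nb x y \<subseteq> nonadj z"
proof
  fix u assume z: "R x y z" and "u \<in> nb x y"
  then have u: "R x y u" by (simp add: nb_def)
  have "\<not> R z u w" for w
    using R_cancel[OF R_perms(4)[OF z] R_perms(4)[OF u]] .
  then show "u \<in> nonadj z" using R_V[OF u] by (simp add: nonadj_def adj_def)
qed

lemma nb_independent: "z \<in> nb x y \<Longrightarrow> nb x y \<subseteq> nonadj z"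
  using nb_sub_nonadj by (simp add: nb_def)

lemma codeg_le_nondeg: "R x y z \<Longrightarrow> codeg x y \<le> nondeg z"
  by (simp add: codeg_def nondeg_def card_mono nb_sub_nonadj)

lemma codeg_pos_iff: "codeg x y > 0 \<longleftrightarrow> adj x y"
proof -
  have "codeg x y > 0 \<longleftrightarrow> nb x y \<noteq> {}" by (simp add: codeg_def card_gt_0_iff)
  then show ?thesis by (auto simp: nb_def adj_def)
qed

lemma codeg_nonneg: "codeg x y \<ge> 0"
  by (simp add: codeg_def)

lemma codeg_not_adj: "\<not> adj x y \<Longrightarrow> codeg x y = 0"
  using codeg_pos_iff codeg_nonneg by (metis less_eq_real_def)

lemma self_nonadj: "x \<in> V \<Longrightarrow> x \<in> nonadj x"
  unfolding nonadj_def adj_def using R_neq by blast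

lemma nondeg_ge_1: "x \<in> V \<Longrightarrow> nondeg x \<ge> 1"
  using self_nonadj[of x] card_gt_0_iff[of "nonadj x"] by (fastforce simp: nondeg_def)

lemma nondeg_nonneg: "nondeg x \<ge> 0"
  by (simp add: nondeg_def)

lemma nondeg_le: "nondeg x \<le> order"
  using card_mono[OF finite_V nonadj_sub] by (simp add: nondeg_def)

lemma card_adj: "real (card {y \<in> V. adj x y}) = order - nondeg x"
proof -
  have "{y \<in> V. adj x y} = V - nonadj x" by (auto simp: nonadj_def)
  then show ?thesis
    using card_Diff_subset[OF finite_nonadj nonadj_sub, of x] card_mono[OF finite_V nonadj_sub, of x]
    by (simp add: nondeg_def of_nat_diff)
qed

lemma deg_le:
  assumes "\<And>x y. codeg x y \<le> K"
  shows "deg x \<le> K * (order - nondeg x)"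
proof -
  have "deg x = (\<Sum>y\<in>{y \<in> V. adj x y}. codeg x y)"
    unfolding deg_def using finite_V codeg_not_adj by (intro sum.mono_neutral_right) auto
  also have "\<dots> \<le> (\<Sum>y\<in>{y \<in> V. adj x y}. K)" by (intro sum_mono assms)
  finally show ?thesis by (simp add: card_adj mult.commute)
qed

lemma sum_adj_swap:
  "(\<Sum>x\<in>V. \<Sum>y\<in>{y \<in> V. adj x y}. f y) = (\<Sum>y\<in>V. f y * (order - nondeg y))" for f :: "'a \<Rightarrow> real"
proof -
  have "(\<Sum>x\<in>V. \<Sum>y\<in>{y \<in> V. adj x y}. f y) = (\<Sum>y\<in>V. \<Sum>x\<in>{x \<in> V. adj x y}. f y)"
    by (rule sum.swap_restrict[OF finite_V finite_V])
  also have "\<dots> = (\<Sum>y\<in>V. \<Sum>x\<in>{x \<in> V. adj y x}. f y)"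
    by (simp add: adj_commute)
  finally show ?thesis by (simp add: card_adj mult.commute)
qed

lemma nb_eq: "nb x y = {z \<in> V. R x y z}"
  using nb_sub by (auto simp: nb_def)

lemma link_sum_swap:
  "(\<Sum>y\<in>V. \<Sum>z\<in>nb x y. f y z) = (\<Sum>y\<in>V. \<Sum>z\<in>nb x y. f z y)" for f :: "'a \<Rightarrow> 'a \<Rightarrow> real"
proof -
  have "(\<Sum>y\<in>V. \<Sum>z\<in>nb x y. f y z) = (\<Sum>z\<in>V. \<Sum>y\<in>{y \<in> V. R x y z}. f y z)"
    unfolding nb_eq by (rule sum.swap_restrict[OF finite_V finite_V])
  also have "\<dots> = (\<Sum>z\<in>V. \<Sum>y\<in>nb x z. f y z)"
  proof (intro sum.cong refl)
    fix z show "{y \<in> V. R x y z} = nb x z"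
      unfolding nb_eq using R_perms(1) by metis
  qed
  finally show ?thesis .
qed

text \<open>Every vertex \<open>y\<close> of the link of \<open>x\<close> distributes its weight evenly over the link edges at
  \<open>y\<close>; since \<open>d(xy) \<le> w(z)\<close> and \<open>d(xz) \<le> w(y)\<close>, AM-GM shows that each link edge receives at
  least \<open>1\<close>.\<close>

lemma deg_le_weight:
  assumes pos: "\<And>y. y \<in> V \<Longrightarrow> 0 < w y"
    and w: "\<And>x y z. R x y z \<Longrightarrow> codeg x y \<le> w z"
  shows "deg x + 1/2 * (\<Sum>y\<in>V. \<Sum>z\<in>nb x y. (w y - w z)\<^sup>2 / (w y * w z))
    \<le> (\<Sum>y\<in>{y \<in> V. adj x y}. w y)"
proof -
  have edge: "1 + 1/2 * ((w y - w z)\<^sup>2 / (w y * w z)) \<le> 1/2 * (w y / codeg x y + w z / codeg x z)"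
    if "z \<in> nb x y" for y z
  proof -
    have R: "R x y z" "R x z y" using that R_perms(1) by (simp_all add: nb_def)
    have wp: "w y > 0" "w z > 0" using R_V[OF R(1)] pos by auto
    have d: "codeg x y > 0" "codeg x z > 0" "codeg x y \<le> w z" "codeg x z \<le> w y"
      using w[OF R_perms(1)[OF R(1)]] w[OF R(1)] R unfolding codeg_pos_iff adj_def by blast+
    have "1 + 1/2 * ((w y - w z)\<^sup>2 / (w y * w z)) = 1/2 * (w y / w z + w z / w y)"
      using wp by (simp add: field_simps power2_eq_square)
    also have "\<dots> \<le> 1/2 * (w y / codeg x y + w z / codeg x z)"
      using d wp by (intro mult_left_mono add_mono divide_left_mono) auto
    finally show ?thesis .
  qed
  have "deg x + 1/2 * (\<Sum>y\<in>V. \<Sum>z\<in>nb x y. (w y - w z)\<^sup>2 / (w y * w z))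
      = (\<Sum>y\<in>V. \<Sum>z\<in>nb x y. 1 + 1/2 * ((w y - w z)\<^sup>2 / (w y * w z)))"
    by (simp add: deg_def codeg_def sum.distrib sum_distrib_left)
  also have "\<dots> \<le> (\<Sum>y\<in>V. \<Sum>z\<in>nb x y. 1/2 * (w y / codeg x y + w z / codeg x z))"
    by (intro sum_mono edge)
  also have "\<dots> = 1/2 * ((\<Sum>y\<in>V. \<Sum>z\<in>nb x y. w y / codeg x y) + (\<Sum>y\<in>V. \<Sum>z\<in>nb x y. w z / codeg x z))"
    by (simp only: sum_distrib_left[symmetric] sum.distrib)
  also have "\<dots> = (\<Sum>y\<in>V. \<Sum>z\<in>nb x y. w y / codeg x y)"
    using link_sum_swap[of "\<lambda>y z. w y / codeg x y" x] by simp
  also have "\<dots> = (\<Sum>y\<in>V. if adj x y then w y else 0)"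
  proof (intro sum.cong refl)
    fix y show "(\<Sum>z\<in>nb x y. w y / codeg x y) = (if adj x y then w y else 0)"
      using codeg_pos_iff[of x y] by (cases "adj x y") (auto simp: codeg_def)
  qed
  also have "\<dots> = (\<Sum>y\<in>{y \<in> V. adj x y}. w y)"
    using finite_V by (simp add: sum.inter_filter)
  finally show ?thesis .
qed

text \<open>Summed over \<open>x\<close>, the weight \<open>w y\<close> is collected once per
  neighbour of \<open>y\<close>. The square terms are retained because the bound left of the
  extremal point depends on them.\<close>

lemma total_le_weight:
  assumes "\<And>y. y \<in> V \<Longrightarrow> 0 < w y"
    and "\<And>x y z. R x y z \<Longrightarrow> codeg x y \<le> w z"
  shows "total + 1/2 * (\<Sum>x\<in>V. \<Sum>y\<in>V. \<Sum>z\<in>nb x y. (w y - w z)\<^sup>2 / (w y * w z))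
    \<le> (\<Sum>y\<in>V. w y * (order - nondeg y))"
proof -
  have "total + 1/2 * (\<Sum>x\<in>V. \<Sum>y\<in>V. \<Sum>z\<in>nb x y. (w y - w z)\<^sup>2 / (w y * w z))
      = (\<Sum>x\<in>V. deg x + 1/2 * (\<Sum>y\<in>V. \<Sum>z\<in>nb x y. (w y - w z)\<^sup>2 / (w y * w z)))"
    by (simp add: total_def sum.distrib sum_distrib_left)
  also have "\<dots> \<le> (\<Sum>x\<in>V. \<Sum>y\<in>{y \<in> V. adj x y}. w y)"
    by (intro sum_mono deg_le_weight assms)
  finally show ?thesis by (simp add: sum_adj_swap)
qed

lemma total_le_nondeg: "total \<le> (\<Sum>y\<in>V. nondeg y * (order - nondeg y))"
proof -
  have pos: "0 < nondeg y" if "y \<in> V" for y using nondeg_ge_1[OF that] by simp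
  have "total + 1/2 * (\<Sum>x\<in>V. \<Sum>y\<in>V. \<Sum>z\<in>nb x y. (nondeg y - nondeg z)\<^sup>2 / (nondeg y * nondeg z))
    \<le> (\<Sum>y\<in>V. nondeg y * (order - nondeg y))"
    by (rule total_le_weight[OF pos codeg_le_nondeg])
  moreover have "0 \<le> (\<Sum>x\<in>V. \<Sum>y\<in>V. \<Sum>z\<in>nb x y. (nondeg y - nondeg z)\<^sup>2 / (nondeg y * nondeg z))"
    by (intro sum_nonneg) (simp add: nondeg_nonneg)
  ultimately show ?thesis by linarith
qed

text \<open>\<open>total_le_nondeg\<close> rewritten as a bound on the spread of
  \<open>nondeg\<close> about an arbitrary centre. The mean as centre gives the product bound, the
  centre \<open>n/K\<close> gives concentration.\<close>

lemma sum_nondeg_variance: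
  "(\<Sum>y\<in>V. (nondeg y - t)\<^sup>2) \<le> order * (\<Sum>y\<in>V. nondeg y) - total - 2 * t * (\<Sum>y\<in>V. nondeg y) + order * t\<^sup>2"
proof -
  have "(\<Sum>y\<in>V. nondeg y * (order - nondeg y)) = order * (\<Sum>y\<in>V. nondeg y) - (\<Sum>y\<in>V. (nondeg y)\<^sup>2)"
    by (simp add: algebra_simps sum_subtractf sum_distrib_left power2_eq_square)
  moreover have "(\<Sum>y\<in>V. (nondeg y - t)\<^sup>2) = (\<Sum>y\<in>V. (nondeg y)\<^sup>2) - 2 * t * (\<Sum>y\<in>V. nondeg y) + order * t\<^sup>2"
    by (simp add: power2_diff sum.distrib sum_subtractf sum_distrib_left algebra_simps)
  ultimately show ?thesis using total_le_nondeg by linarith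
qed

lemma total_le_product: 
  "order * total \<le> (\<Sum>y\<in>V. nondeg y) * (order\<^sup>2 - (\<Sum>y\<in>V. nondeg y))"
proof (cases "V = {}")
  case False
  define S where "S = (\<Sum>y\<in>V. nondeg y)"
  have n: "order > 0" using False finite_V by (simp add: card_gt_0_iff)
  have "0 \<le> (\<Sum>y\<in>V. (nondeg y - S / order)\<^sup>2)" by (intro sum_nonneg) simp
  then have "total \<le> order * S - 2 * (S / order) * S + order * (S / order)\<^sup>2"
    using sum_nondeg_variance[of "S / order"] unfolding S_def by linarith
  also have "\<dots> = order * S - S\<^sup>2 / order" using n by (simp add: field_simps power2_eq_square)
  finally have "order * total \<le> order * (order * S - S\<^sup>2 / order)"
    using n by (simp add: mult_left_mono)
  also have "\<dots> = S * (order\<^sup>2 - S)"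
    using n by (simp add: right_diff_distrib power2_eq_square)
  finally show ?thesis unfolding S_def .
qed (simp add: total_def)

lemma sum_card_nb_Int:
  assumes "C \<subseteq> V"
  shows "(\<Sum>x\<in>V. \<Sum>y\<in>V. real (card (nb x y \<inter> C))) = (\<Sum>z\<in>C. deg z)"
proof -
  have fC: "finite C" using finite_subset[OF assms finite_V] .
  have cd: "(\<Sum>y\<in>V. of_bool (R z x y)) = codeg z x" for z x
    using finite_V by (simp add: codeg_def nb_eq Int_def)
  have "(\<Sum>x\<in>V. \<Sum>y\<in>V. real (card (nb x y \<inter> C))) = (\<Sum>x\<in>V. \<Sum>y\<in>V. \<Sum>z\<in>C. of_bool (R x y z))"
    using fC by (simp add: nb_def Int_def conj_commute)
  also have "\<dots> = (\<Sum>x\<in>V. \<Sum>z\<in>C. \<Sum>y\<in>V. of_bool (R x y z))"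
    by (intro sum.cong refl sum.swap)
  also have "\<dots> = (\<Sum>z\<in>C. \<Sum>x\<in>V. \<Sum>y\<in>V. of_bool (R x y z))"
    by (rule sum.swap)
  also have "\<dots> = (\<Sum>z\<in>C. \<Sum>x\<in>V. \<Sum>y\<in>V. of_bool (R z x y))"
  proof -
    have "R x y z = R z x y" for x y z using R_perms(3,4) by blast
    then show ?thesis by simp
  qed
  finally show ?thesis by (simp only: cd deg_def)
qed

text \<open>Groups triples by the pair on which \<open>f\<close> depends. The AM-GM loss thereby
  becomes a codegree-weighted sum over pairs, which can be restricted to pairs across parts.\<close>

lemma sum_triples_regroup:
  fixes f :: "'a \<Rightarrow> 'a \<Rightarrow> real"
  shows "(\<Sum>x\<in>V. \<Sum>y\<in>V. \<Sum>z\<in>nb x y. f y z) = (\<Sum>y\<in>V. \<Sum>z\<in>V. codeg y z * f y z)"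
proof -
  have "(\<Sum>x\<in>V. \<Sum>z\<in>nb x y. f y z) = (\<Sum>z\<in>V. codeg y z * f y z)" for y
  proof -
    have "(\<Sum>x\<in>V. \<Sum>z\<in>nb x y. f y z) = (\<Sum>z\<in>V. \<Sum>x\<in>{x \<in> V. R x y z}. f y z)"
      unfolding nb_eq by (rule sum.swap_restrict[OF finite_V finite_V])
    also have "\<dots> = (\<Sum>z\<in>V. codeg y z * f y z)"
    proof (intro sum.cong refl)
      fix z have "{x \<in> V. R x y z} = nb y z" unfolding nb_eq using R_perms(3,4) by blast
      then show "(\<Sum>x\<in>{x \<in> V. R x y z}. f y z) = codeg y z * f y z" by (simp add: codeg_def)
    qed
    finally show ?thesis .
  qed
  then show ?thesis by (subst sum.swap) simp
qed

end

section \<open>Optimising the part sizes\<close>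

lemma sum_sum_square_diff:
  fixes s :: "'i \<Rightarrow> real"
  shows "(\<Sum>i\<in>J. \<Sum>j\<in>J. (s i - s j)\<^sup>2) = 2 * real (card J) * (\<Sum>i\<in>J. (s i)\<^sup>2) - 2 * (\<Sum>i\<in>J. s i)\<^sup>2"
proof -
  have "(\<Sum>i\<in>J. \<Sum>j\<in>J. (s i - s j)\<^sup>2)
      = (\<Sum>i\<in>J. \<Sum>j\<in>J. (s i)\<^sup>2) + (\<Sum>i\<in>J. \<Sum>j\<in>J. (s j)\<^sup>2) - 2 * (\<Sum>i\<in>J. \<Sum>j\<in>J. s i * s j)"
    by (simp add: power2_diff sum.distrib sum_subtractf sum_distrib_left mult.assoc)
  also have "(\<Sum>i\<in>J. \<Sum>j\<in>J. s i * s j) = (\<Sum>i\<in>J. s i)\<^sup>2"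
    by (simp add: power2_eq_square sum_product)
  finally show ?thesis by (simp add: sum_distrib_left[symmetric])
qed

text \<open>In the application \<open>q\<close> lists the part sizes, \<open>N\<close> is the order after the deletion, \<open>v\<close> the
  number of uncovered vertices, \<open>Q\<close> the maximal codegree (all divided by \<open>n\<close>), and the \<open>\<rho>\<close>-term is
  the loss in AM-GM.\<close>

lemma near_equal_parts_bound:
  fixes q :: "'i \<Rightarrow> real" and K N Q \<rho> g :: real
  assumes K: "real (card J) = K" "K > 0"
    and v: "v = N - sum q J" "v \<ge> 0"
    and square_coeff: "\<And>j. j \<in> J \<Longrightarrow> g \<le> \<rho> * K - (N - 3 * N / K - (q j - N / K))"
    and linear_coeff: "g \<le> N\<^sup>2 * (2 / K - 3 / K\<^sup>2) - Q * (N - Q) - \<rho> * v"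
  shows "(\<Sum>j\<in>J. (q j)\<^sup>2 * (N - q j)) + v * (Q * (N - Q)) - 1/2 * \<rho> * (\<Sum>i\<in>J. \<Sum>j\<in>J. (q i - q j)\<^sup>2)
    \<le> (1 / K - 1 / K\<^sup>2) * N ^ 3 - g * (v + (\<Sum>j\<in>J. (q j - N / K)\<^sup>2))"
proof -
  define s where "s j = q j - N / K" for j
  have sum_s: "sum s J = - v"
    using K by (simp add: s_def sum_subtractf v)
  \<comment> \<open>The exact Taylor expansion of the cubic at \<open>N/K\<close>, with the cubic
    term absorbed into the quadratic coefficient. The linear terms survive only through
    \<open>sum s J = - v\<close>.\<close>
  have expand: "(q j)\<^sup>2 * (N - q j) = (N\<^sup>2 / K\<^sup>2) * (N - N / K) + s j * (N\<^sup>2 * (2 / K - 3 / K\<^sup>2))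
      + (s j)\<^sup>2 * (N - 3 * N / K - s j)" for j
  proof -
    have "(t + N * c)\<^sup>2 * (N - (t + N * c)) = N\<^sup>2 * c\<^sup>2 * (N - N * c) + t * (N\<^sup>2 * (2 * c - 3 * c\<^sup>2))
        + t\<^sup>2 * (N - 3 * N * c - t)" for t c :: real by algebra
    from this[of "s j" "1 / K"] show ?thesis by (simp add: s_def power_one_over)
  qed
  have "(\<Sum>j\<in>J. (q j)\<^sup>2 * (N - q j)) = K * ((N\<^sup>2 / K\<^sup>2) * (N - N / K)) + sum s J * (N\<^sup>2 * (2 / K - 3 / K\<^sup>2))
      + (\<Sum>j\<in>J. (s j)\<^sup>2 * (N - 3 * N / K - s j))"
    unfolding expand sum.distrib sum_distrib_right by (simp add: K)
  also have "K * ((N\<^sup>2 / K\<^sup>2) * (N - N / K)) = (1 / K - 1 / K\<^sup>2) * N ^ 3"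
    using K(2) by (simp add: field_simps power2_eq_square power3_eq_cube)
  finally have 1: "(\<Sum>j\<in>J. (q j)\<^sup>2 * (N - q j)) = (1 / K - 1 / K\<^sup>2) * N ^ 3 - v * (N\<^sup>2 * (2 / K - 3 / K\<^sup>2))
      + (\<Sum>j\<in>J. (s j)\<^sup>2 * (N - 3 * N / K - s j))"
    by (simp add: sum_s)
  have "(\<Sum>i\<in>J. \<Sum>j\<in>J. (q i - q j)\<^sup>2) = (\<Sum>i\<in>J. \<Sum>j\<in>J. (s i - s j)\<^sup>2)"
    by (simp add: s_def)
  \<comment> \<open>The loss is thus \<open>\<rho> (K \<Sum> s^2 - v^2)\<close>: it must beat the
    quadratic coefficient \<open>N - 3 N / K - s\<close>, and its \<open>v^2\<close> part is charged
    to the linear term in \<open>v\<close>.\<close>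
  then have 2: "(\<Sum>i\<in>J. \<Sum>j\<in>J. (q i - q j)\<^sup>2) = 2 * K * (\<Sum>j\<in>J. (s j)\<^sup>2) - 2 * v\<^sup>2"
    unfolding sum_sum_square_diff by (simp add: sum_s K)
  have "(\<Sum>j\<in>J. (s j)\<^sup>2 * (N - 3 * N / K - s j)) \<le> (\<Sum>j\<in>J. (s j)\<^sup>2 * (\<rho> * K - g))"
  proof (intro sum_mono mult_left_mono)
    show "N - 3 * N / K - s j \<le> \<rho> * K - g" if "j \<in> J" for j
      using square_coeff[OF that] unfolding s_def by linarith
  qed simp
  then have 3: "(\<Sum>j\<in>J. (s j)\<^sup>2 * (N - 3 * N / K - s j)) \<le> (\<rho> * K - g) * (\<Sum>j\<in>J. (s j)\<^sup>2)"
    by (simp add: sum_distrib_left mult.commute)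
  have 4: "v * g \<le> v * (N\<^sup>2 * (2 / K - 3 / K\<^sup>2) - Q * (N - Q) - \<rho> * v)"
    using linear_coeff v(2) by (rule mult_left_mono)
  have "(\<Sum>j\<in>J. (q j - N / K)\<^sup>2) = (\<Sum>j\<in>J. (s j)\<^sup>2)" by (simp add: s_def)
  moreover have "A + v * P - 1/2 * \<rho> * D \<le> C - g * (v + S)"
    if "A = C - v * E + F" "D = 2 * K * S - 2 * v\<^sup>2" "F \<le> (\<rho> * K - g) * S"
      "v * g \<le> v * (E - P - \<rho> * v)" for A P D C S E F :: real
    using that(1,3,4) by (simp add: that(2) algebra_simps power2_eq_square)
  ultimately show ?thesis using 1 2 3 4 by presburger
qed

text \<open>All error terms are expressed through one small number \<open>b\<close>: the density is within \<open>b^8\<close> of the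
  extremal one, codegrees are at most \<open>(1/K + b\<^sup>2) n\<close>, vertices with \<open>p > (1/K + K b\<^sup>2) n\<close> are deleted
  (at most \<open>b^4 n\<close> of them), and sets \<open>N(xy)\<close> of size at least \<open>(1/K - b) n\<close> are large. The next two
  functions bound the proportion of uncovered vertices (tending to \<open>0\<close> as \<open>b \<rightarrow> 0\<close>) and the
  normalised number of edges across two parts (tending to \<open>1/K\<close>).\<close>

definition cover_defect :: "real \<Rightarrow> real \<Rightarrow> real" where
  "cover_defect K b = ((1/K + b\<^sup>2) * (1 - 1/K + b) - (1/K - 1/K\<^sup>2) + b^8 + 3 * b^4 + (K * b\<^sup>2 + b)
     + (b + b^7) * (1/K + b\<^sup>2)) / (1/K - 1/K\<^sup>2)"

definition cross_density :: "real \<Rightarrow> real \<Rightarrow> real" where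
  "cross_density K b = ((1/K + b\<^sup>2) * (1/K - b) * (1/K - 2 * b - K * b\<^sup>2) - (b\<^sup>2 + b^8) - b^4) / (1/K + b\<^sup>2)\<^sup>2"

text \<open>Half of \<open>1/K - 2/K^2\<close>, which is the margin
  \<open>(2/K - 3/K^2) - (1/K) (1 - 1/K)\<close> in the linear hypothesis of
  \<open>near_equal_parts_bound\<close> at \<open>b = 0\<close>. The margin in the quadratic
  hypothesis is then \<open>3/K\<close>, which is larger.\<close>

definition gain :: "real \<Rightarrow> real" where
  "gain K = (1/K - 2/K\<^sup>2) / 2"

text \<open>Apart from \<open>0 < b\<close>, each inequality holds strictly at \<open>b = 0\<close>
  when \<open>K \<ge> 3\<close>, since \<open>cover_defect\<close> is 0 and
  \<open>cross_density\<close> is \<open>1/K\<close> there; continuity supplies a small positive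
  \<open>b\<close>. From \<open>b < 1/K\<close> on, the conjuncts serve in turn for: positivity of
  \<open>large\<close>, the codegree bound, positivity of \<open>slope\<close>, transitivity of
  meeting for large sets, at most \<open>k\<close> parts, at least \<open>k\<close> parts,
  \<open>cap\<close> at most half the order, a positive loss, and the two margins in
  \<open>near_equal_parts_bound\<close>.\<close>

definition admissible :: "real \<Rightarrow> real \<Rightarrow> bool" where
  "admissible K b \<longleftrightarrow> 0 < b \<and> b < 1 \<and> b < 1/K \<and> 2 * b^4 < 1/K \<and> b^2 < 1/K
     \<and> 1/K + b\<^sup>2 < 2 * (1/K - 2 * b - K * b\<^sup>2)
     \<and> 1 < (K + 1) * (1/K - b)
     \<and> (K - 1) * (1/K + b\<^sup>2) < 1 - b^4 - cover_defect K b
     \<and> 1/K + b\<^sup>2 < (1 - b^4) / 2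
     \<and> 0 < cross_density K b
     \<and> gain K < cross_density K b * K - (1 - 3/K) - b
     \<and> gain K < (1 - b^4)\<^sup>2 * (2/K - 3/K\<^sup>2) - (1/K + b\<^sup>2) * (1 - (1/K + b\<^sup>2)) - cross_density K b * cover_defect K b"

lemma eventually_less_at_right_0:
  fixes f g :: "real \<Rightarrow> real"
  assumes "isCont f 0" "isCont g 0" "f 0 < g 0"
  shows "eventually (\<lambda>b. f b < g b) (at_right 0)"
proof -
  have "((\<lambda>b. g b - f b) \<longlongrightarrow> g 0 - f 0) (at 0)"
    using assms by (intro tendsto_diff) (auto simp: isCont_def)
  then have "eventually (\<lambda>b. 0 < g b - f b) (at 0)"
    by (rule order_tendstoD) (use assms in simp)
  then have "eventually (\<lambda>b. 0 < g b - f b) (at_right 0)"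
    by (rule filter_leD[OF at_le, rotated]) simp
  then show ?thesis by (rule eventually_mono) simp
qed

lemma admissible_exists:
  assumes "K \<ge> (3::real)"
  shows "\<exists>b. admissible K b"
proof -
  have K: "K > 0" "K \<noteq> 0" and y: "1/K - 1/K\<^sup>2 \<noteq> 0" "1/K - 2/K\<^sup>2 > 0"
    using assms by (auto simp: field_simps power2_eq_square)
  have c1: "isCont (cover_defect K) 0"
    unfolding cover_defect_def using y by (intro continuous_intros) auto
  have c2: "isCont (cross_density K) 0"
    unfolding cross_density_def using K by (intro continuous_intros) auto
  have v1: "cover_defect K 0 = 0" using K by (simp add: cover_defect_def field_simps power2_eq_square)
  have v2: "cross_density K 0 = 1/K" using K by (simp add: cross_density_def field_simps power2_eq_square)
  note ev = eventually_less_at_right_0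
  have "eventually (admissible K) (at_right 0)"
    unfolding admissible_def
  proof (intro eventually_conj)
    show "eventually (\<lambda>b. 0 < b) (at_right (0::real))" by (rule eventually_at_right_less)
    show "eventually (\<lambda>b. b < 1) (at_right (0::real))" by (rule ev) auto
    show "eventually (\<lambda>b. b < 1/K) (at_right 0)" by (rule ev) (use K in auto)
    show "eventually (\<lambda>b. 2 * b^4 < 1/K) (at_right 0)" by (rule ev) (use K in \<open>auto intro!: continuous_intros\<close>)
    show "eventually (\<lambda>b. b^2 < 1/K) (at_right 0)" by (rule ev) (use K in \<open>auto intro!: continuous_intros\<close>)
    show "eventually (\<lambda>b. 1/K + b\<^sup>2 < 2 * (1/K - 2 * b - K * b\<^sup>2)) (at_right 0)"
      by (rule ev) (use K in \<open>auto intro!: continuous_intros simp: divide_strict_right_mono\<close>)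
    show "eventually (\<lambda>b. 1 < (K + 1) * (1/K - b)) (at_right 0)"
      by (rule ev) (use K in \<open>auto intro!: continuous_intros simp: field_simps\<close>)
    show "eventually (\<lambda>b. (K - 1) * (1/K + b\<^sup>2) < 1 - b^4 - cover_defect K b) (at_right 0)"
      by (rule ev) (use K v1 in \<open>auto intro!: continuous_intros c1 simp: field_simps\<close>)
    show "eventually (\<lambda>b. 1/K + b\<^sup>2 < (1 - b^4) / 2) (at_right 0)"
      by (rule ev) (use assms in \<open>auto intro!: continuous_intros simp: field_simps\<close>)
    show "eventually (\<lambda>b. 0 < cross_density K b) (at_right 0)"
      by (rule ev) (use K v2 c2 in auto)
    show "eventually (\<lambda>b. gain K < cross_density K b * K - (1 - 3/K) - b) (at_right 0)"
    proof (rule ev)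
      have "gain K < 3/K" using K by (simp add: gain_def field_simps power2_eq_square add_pos_pos)
      then show "gain K < cross_density K 0 * K - (1 - 3/K) - 0"
        using K v2 by simp
    qed (auto intro!: continuous_intros c2)
    show "eventually (\<lambda>b. gain K < (1 - b^4)\<^sup>2 * (2/K - 3/K\<^sup>2) - (1/K + b\<^sup>2) * (1 - (1/K + b\<^sup>2))
        - cross_density K b * cover_defect K b) (at_right 0)"
    proof (rule ev)
      show "gain K < (1 - 0^4)\<^sup>2 * (2/K - 3/K\<^sup>2) - (1/K + 0\<^sup>2) * (1 - (1/K + 0\<^sup>2))
        - cross_density K 0 * cover_defect K 0"
        using y(2) v1 K by (simp add: gain_def field_simps power2_eq_square)
    qed (auto intro!: continuous_intros c1 c2)
  qed
  then show ?thesis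
    using eventually_happens trivial_limit_at_right_real by blast
qed

text \<open>Transitivity makes meeting an equivalence on the nonempty members, and a member of
  maximum size is taken from each class. Maximality is what later lets the size of a part dominate
  the codegrees of large sets that meet it.\<close>

lemma disjoint_representatives:
  fixes \<L> :: "'a set set"
  assumes fin: "finite \<L>" and ne: "{} \<notin> \<L>"
    and trans: "\<And>A B C. A \<in> \<L> \<Longrightarrow> B \<in> \<L> \<Longrightarrow> C \<in> \<L> \<Longrightarrow> A \<inter> B \<noteq> {} \<Longrightarrow> B \<inter> C \<noteq> {} \<Longrightarrow> A \<inter> C \<noteq> {}"
  obtains \<I> where "\<I> \<subseteq> \<L>"
    and "\<And>I J. I \<in> \<I> \<Longrightarrow> J \<in> \<I> \<Longrightarrow> I \<noteq> J \<Longrightarrow> I \<inter> J = {}"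
    and "\<And>A. A \<in> \<L> \<Longrightarrow> \<exists>I\<in>\<I>. A \<inter> I \<noteq> {}"
    and "\<And>A I. A \<in> \<L> \<Longrightarrow> I \<in> \<I> \<Longrightarrow> A \<inter> I \<noteq> {} \<Longrightarrow> card A \<le> card I"
proof -
  define cl where "cl A = {B \<in> \<L>. A \<inter> B \<noteq> {}}" for A
  define rep where "rep A = (SOME I. I \<in> cl A \<and> (\<forall>B\<in>cl A. card B \<le> card I))" for A
  have rep: "rep A \<in> cl A \<and> (\<forall>B\<in>cl A. card B \<le> card (rep A))" if "A \<in> \<L>" for A
  proof -
    have "finite (cl A)" "A \<in> cl A" using fin ne that by (auto simp: cl_def)
    then have "Max (card ` cl A) \<in> card ` cl A" "\<forall>B\<in>cl A. card B \<le> Max (card ` cl A)"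
      by (auto intro!: Max_in)
    then have "\<exists>I. I \<in> cl A \<and> (\<forall>B\<in>cl A. card B \<le> card I)" by (metis imageE)
    then show ?thesis unfolding rep_def by (rule someI_ex)
  qed
  have cl_eq: "cl A = cl B" if "A \<in> \<L>" "B \<in> \<L>" "A \<inter> B \<noteq> {}" for A B
  unfolding cl_def
  proof (rule Collect_cong, rule conj_cong)
    show "(A \<inter> C \<noteq> {}) = (B \<inter> C \<noteq> {})" if "C \<in> \<L>" for C
      using trans[of A B C] trans[of B A C] that \<open>A \<in> \<L>\<close> \<open>B \<in> \<L>\<close> \<open>A \<inter> B \<noteq> {}\<close>
      by (auto simp: Int_commute)
  qed simp
  have rep_eq: "rep A = rep B" if "A \<in> \<L>" "B \<in> \<L>" "A \<inter> B \<noteq> {}" for A B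
    unfolding rep_def cl_eq[OF that] ..
  have repL: "rep A \<in> \<L>" "A \<inter> rep A \<noteq> {}" if "A \<in> \<L>" for A
    using rep[OF that] by (auto simp: cl_def)
  show ?thesis
  proof (rule that[of "rep ` \<L>"])
    show "rep ` \<L> \<subseteq> \<L>" using repL by auto
    show "I \<inter> J = {}" if IJ: "I \<in> rep ` \<L>" "J \<in> rep ` \<L>" "I \<noteq> J" for I J
    proof (rule ccontr)
      assume "I \<inter> J \<noteq> {}"
      moreover obtain A B where AB: "I = rep A" "J = rep B" "A \<in> \<L>" "B \<in> \<L>" using IJ by auto
      ultimately have "A \<inter> J \<noteq> {}"
        using trans[of A I J] repL[OF AB(3)] repL[OF AB(4)] by simp
      then have "A \<inter> B \<noteq> {}"
        using trans[of A J B] repL[OF AB(4)] AB by (simp add: Int_commute)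
      then show False using rep_eq AB IJ(3) by simp
    qed
    show "\<exists>I\<in>rep ` \<L>. A \<inter> I \<noteq> {}" if "A \<in> \<L>" for A using repL[OF that] that by auto
    show "card A \<le> card I" if AI: "A \<in> \<L>" "I \<in> rep ` \<L>" "A \<inter> I \<noteq> {}" for A I
    proof -
      obtain B where B: "B \<in> \<L>" "I = rep B" using AI by auto
      then have "A \<inter> B \<noteq> {}" using trans[of A I B] repL[OF B(1)] AI by (simp add: Int_commute)
      then have "A \<in> cl B" using AI by (auto simp: cl_def)
      then show ?thesis using rep B by blast
    qed
  qed
qed

section \<open>Structure of nearly extremal relations\<close>

text \<open>Since \<open>1 - (\<Sum> nondeg) / n^2\<close> is the normalised shadow size,
  \<open>nondeg_lower\<close> and \<open>nondeg_upper\<close> place it in a window of width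
  \<open>b^8\<close> just left of \<open>1 - 1/K\<close>; \<open>dense\<close> asks for an edge
  density within \<open>b^8\<close> of the extremal one.\<close>

locale near_extremal = cancellative_relation V R
  for V :: "'a set" and R :: "'a \<Rightarrow> 'a \<Rightarrow> 'a \<Rightarrow> bool" +
  fixes K b :: real and k :: nat
  assumes K_def: "K = real k" and k: "k \<ge> 3" and adm: "admissible K b" and ne: "V \<noteq> {}"
    and nondeg_lower: "1/K * order\<^sup>2 \<le> (\<Sum>z\<in>V. nondeg z)"
    and nondeg_upper: "(\<Sum>z\<in>V. nondeg z) \<le> (1/K + b^8) * order\<^sup>2"
    and dense: "(1/K - 1/K\<^sup>2 - b^8) * order ^ 3 \<le> total"
begin

abbreviation "n \<equiv> order"

definition cap :: real where "cap = (1/K + b\<^sup>2) * n"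
definition large :: real where "large = (1/K - b) * n"
text \<open>The factor \<open>K\<close> makes deletion profitable: \<open>cap * (n - spread)\<close>
  equals \<open>(y0 - b^2/K - K b^4) n^2\<close> with \<open>y0 = 1/K - 1/K^2\<close>, so bad
  vertices have degree below \<open>y0 n^2\<close>. A margin of \<open>b^2\<close> alone would not
  offset the excess \<open>b^2\<close> in \<open>cap\<close>.\<close>

definition spread :: real where "spread = (1/K + K * b\<^sup>2) * n"
definition bad :: "'a set" where "bad = {z \<in> V. nondeg z > spread}"

section \<open>Concentration of nonneighbour counts and codegrees\<close>

lemma n_pos: "n > 0"
  using ne finite_V by (simp add: card_gt_0_iff)

lemma K_ge_3: "K \<ge> 3"
  using k K_def by simp

lemma adm_b: "0 < b" "b < 1" "b < 1/K" "2 * b^4 < 1/K" "b\<^sup>2 < 1/K"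
  "1/K + b\<^sup>2 < 2 * (1/K - 2 * b - K * b\<^sup>2)" "1 < (K + 1) * (1/K - b)"
  "(K - 1) * (1/K + b\<^sup>2) < 1 - b^4 - cover_defect K b"
  "1/K + b\<^sup>2 < (1 - b^4) / 2"
  "0 < cross_density K b"
  "gain K < cross_density K b * K - (1 - 3/K) - b"
  "gain K < (1 - b^4)\<^sup>2 * (2/K - 3/K\<^sup>2) - (1/K + b\<^sup>2) * (1 - (1/K + b\<^sup>2)) - cross_density K b * cover_defect K b"
  using adm unfolding admissible_def by blast+

text \<open>With no slack in the density hypotheses every \<open>nondeg z\<close> would equal
  \<open>n/K\<close>. The slack in \<open>nondeg_upper\<close> contributes
  \<open>(1 - 2/K) b^8 n^3\<close> and the slack in \<open>dense\<close> contributes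
  \<open>b^8 n^3\<close>.\<close>

lemma variance: "(\<Sum>z\<in>V. (nondeg z - n/K)\<^sup>2) \<le> 2 * b^8 * n^3"
proof -
  define S where "S = (\<Sum>z\<in>V. nondeg z)"
  have "(\<Sum>z\<in>V. (nondeg z - n/K)\<^sup>2) \<le> n * S - total - 2 * (n/K) * S + n * (n/K)\<^sup>2"
    unfolding S_def by (rule sum_nondeg_variance)
  also have "\<dots> = (1 - 2/K) * (n * S) - total + n^3 / K\<^sup>2"
    using K_ge_3 by (simp add: field_simps power2_eq_square power3_eq_cube)
  also have "\<dots> \<le> (1 - 2/K) * (n * ((1/K + b^8) * n\<^sup>2)) - (1/K - 1/K\<^sup>2 - b^8) * n^3 + n^3 / K\<^sup>2"
    using K_ge_3 n_pos nondeg_upper dense unfolding S_def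
    by (intro add_mono diff_mono mult_left_mono) (auto simp: field_simps)
  also have "\<dots> = (2 - 2/K) * b^8 * n^3"
    using K_ge_3 by (simp add: field_simps power2_eq_square power3_eq_cube)
  also have "\<dots> \<le> 2 * b^8 * n^3"
    using K_ge_3 n_pos adm_b(1) by (intro mult_right_mono) auto
  finally show ?thesis .
qed

text \<open>Chebyshev's inequality. It is used with \<open>t = b^2\<close> to bound codegrees and
  with \<open>t = K b^2\<close> to bound the bad set.\<close>

lemma markov:
  assumes t: "t > 0" and Z: "Z \<subseteq> V" "\<And>z. z \<in> Z \<Longrightarrow> nondeg z \<ge> (1/K + t) * n"
  shows "real (card Z) \<le> 2 * b^8 / t\<^sup>2 * n"
proof -
  have "real (card Z) * (t * n)\<^sup>2 = (\<Sum>z\<in>Z. (t * n)\<^sup>2)" by simp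
  also have "\<dots> \<le> (\<Sum>z\<in>Z. (nondeg z - n/K)\<^sup>2)"
  proof (intro sum_mono power_mono)
    show "t * n \<le> nondeg z - n/K" if "z \<in> Z" for z
      using Z(2)[OF that] by (simp add: algebra_simps)
  qed (use t n_pos in simp)
  also have "\<dots> \<le> (\<Sum>z\<in>V. (nondeg z - n/K)\<^sup>2)"
    by (rule sum_mono2[OF finite_V Z(1)]) simp
  also note variance
  finally have "(real (card Z) * t\<^sup>2) * n\<^sup>2 \<le> (2 * b^8 * n) * n\<^sup>2"
    by (simp add: power_mult_distrib power2_eq_square power3_eq_cube mult_ac)
  then have "real (card Z) * t\<^sup>2 \<le> 2 * b^8 * n"
    using n_pos by simp
  then show ?thesis using t by (simp add: field_simps)
qed

text \<open>Every \<open>z\<close> in \<open>nb x y\<close> has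
  \<open>nondeg z \<ge> codeg x y\<close>. A codegree above \<open>cap\<close> would give more than
  \<open>n/K\<close> vertices with \<open>nondeg\<close> above \<open>cap\<close>, whereas Chebyshev
  allows only \<open>2 b^4 n\<close>.\<close>

lemma codeg_le_cap: "codeg x y \<le> cap"
proof (rule ccontr)
  assume "\<not> codeg x y \<le> cap"
  then have c: "codeg x y > cap" by simp
  have "real (card (nb x y)) \<le> 2 * b^8 / (b\<^sup>2)\<^sup>2 * n"
  proof (rule markov[OF _ nb_sub])
    show "nondeg z \<ge> (1/K + b\<^sup>2) * n" if "z \<in> nb x y" for z
      using that codeg_le_nondeg[of x y z] c by (simp add: nb_def cap_def)
  qed (use adm_b(1) in simp)
  also have "2 * b^8 / (b\<^sup>2)\<^sup>2 * n = 2 * b^4 * n"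
    using adm_b(1) by (simp add: field_simps flip: power_add power_mult)
  also have "\<dots> \<le> 1/K * n" using adm_b(4) n_pos by (intro mult_right_mono) auto
  also have "\<dots> \<le> cap" unfolding cap_def using n_pos by (intro mult_right_mono) auto
  finally show False using c by (simp add: codeg_def)
qed

lemma bad_sub: "bad \<subseteq> V" and finite_bad: "finite bad"
  using finite_V by (auto simp: bad_def)

lemma card_bad: "real (card bad) \<le> b^4 * n"
proof -
  have "real (card bad) \<le> 2 * b^8 / (K * b\<^sup>2)\<^sup>2 * n"
    by (rule markov[OF _ bad_sub]) (use adm_b(1) K_ge_3 in \<open>auto simp: bad_def spread_def\<close>)
  also have "\<dots> = 2 / K\<^sup>2 * (b^4 * n)"
    using adm_b(1) K_ge_3 by (simp add: field_simps flip: power_add power_mult)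
  also have "\<dots> \<le> 1 * (b^4 * n)"
  proof (intro mult_right_mono)
    have "3^2 \<le> K\<^sup>2" using K_ge_3 by (intro power_mono) auto
    then show "2 / K\<^sup>2 \<le> 1" using K_ge_3 by (simp add: field_simps)
  qed (use adm_b(1) n_pos in simp)
  finally show ?thesis by simp
qed

lemma cap_pos: "cap > 0" and large_pos: "large > 0" and cap_le_n: "cap \<le> n"
proof -
  show "cap > 0" unfolding cap_def using K_ge_3 n_pos by (intro mult_pos_pos add_pos_nonneg) auto
  show "large > 0" unfolding large_def using adm_b(3) n_pos by simp
  have "(1 - b^4) / 2 \<le> 1" using adm_b(1) by (simp add: field_simps)
  then have "1/K + b\<^sup>2 \<le> 1" using adm_b(9) by (metis less_imp_le order_trans)
  then show "cap \<le> n" unfolding cap_def using n_pos by (simp add: mult_left_le_one_le)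
qed

text \<open>Nonadjacent pairs get 0: their shortfall is already recorded by
  \<open>nondeg\<close>.\<close>

definition gap :: "'a \<Rightarrow> 'a \<Rightarrow> real" where
  "gap x y = (if adj x y then cap - codeg x y else 0)"

lemma gap_nonneg: "gap x y \<ge> 0"
  using codeg_le_cap by (simp add: gap_def)

text \<open>The sum is \<open>cap\<close> times the number of adjacent ordered pairs, minus
  \<open>total\<close>. It is small because the crude bound with all codegrees equal to
  \<open>cap\<close> is nearly attained.\<close>

lemma sum_gap: "(\<Sum>x\<in>V. \<Sum>y\<in>V. gap x y) \<le> (b\<^sup>2 + b^8) * n^3"
proof -
  define S where "S = (\<Sum>z\<in>V. nondeg z)"
  have row: "(\<Sum>y\<in>V. gap x y) = cap * (n - nondeg x) - deg x" for x
  proof -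
    have "(\<Sum>y\<in>V. gap x y) = (\<Sum>y\<in>V. (if adj x y then cap else 0) - codeg x y)"
      using codeg_not_adj by (intro sum.cong) (auto simp: gap_def)
    also have "\<dots> = (\<Sum>y\<in>{y \<in> V. adj x y}. cap) - deg x"
      by (simp only: sum.inter_filter[OF finite_V] sum_subtractf deg_def)
    finally show ?thesis by (simp add: card_adj mult.commute)
  qed
  have "(\<Sum>x\<in>V. \<Sum>y\<in>V. gap x y) = cap * (n\<^sup>2 - S) - total"
    unfolding row S_def total_def
    by (simp add: sum_subtractf sum_distrib_left[symmetric] power2_eq_square)
  also have "\<dots> \<le> cap * (n\<^sup>2 - 1/K * n\<^sup>2) - (1/K - 1/K\<^sup>2 - b^8) * n^3"
    using nondeg_lower dense cap_pos unfolding S_def by (intro diff_mono mult_left_mono) auto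
  also have "\<dots> = (b\<^sup>2 * (1 - 1/K) + b^8) * n^3"
    using K_ge_3 unfolding cap_def by (simp add: field_simps power2_eq_square power3_eq_cube)
  also have "\<dots> \<le> (b\<^sup>2 * 1 + b^8) * n^3"
    using K_ge_3 n_pos by (intro mult_right_mono add_right_mono mult_left_mono) auto
  finally show ?thesis by simp
qed

section \<open>Deletion of the bad vertices\<close>

definition R' :: "'a \<Rightarrow> 'a \<Rightarrow> 'a \<Rightarrow> bool" where
  "R' x y z \<longleftrightarrow> R x y z \<and> x \<notin> bad \<and> y \<notin> bad \<and> z \<notin> bad"

text \<open>The general facts become available after deletion under the prefix \<open>S\<close>.
  Adjacency there is taken in \<open>R'\<close>, so a pair all of whose edges meet
  \<open>bad\<close> becomes nonadjacent.\<close>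

sublocale S: cancellative_relation "V - bad" R'
proof
  show "finite (V - bad)" using finite_V by simp
  show "x \<in> V - bad" if "R' x y z" for x y z using that R_V by (auto simp: R'_def)
  show "R' y x z" if "R' x y z" for x y z using that R_perms(2) by (auto simp: R'_def)
  show "R' y z x" if "R' x y z" for x y z using that R_perms(3) by (auto simp: R'_def)
  show "x \<noteq> y" if "R' x y z" for x y z using that R_neq by (auto simp: R'_def)
  show "\<not> R' u v w" if "R' u p q" "R' v p q" for u v w p q
    using that R_cancel[of u p q v w] by (auto simp: R'_def)
qed

lemma S_nb: "x \<notin> bad \<Longrightarrow> y \<notin> bad \<Longrightarrow> S.nb x y = nb x y - bad"
  by (auto simp: S.nb_def nb_def R'_def)

lemma S_nb_sub: "S.nb x y \<subseteq> nb x y"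
  by (auto simp: S.nb_def nb_def R'_def)

lemma S_codeg_le: "S.codeg x y \<le> codeg x y"
  by (simp add: S.codeg_def codeg_def card_mono S_nb_sub)

lemma S_codeg_le_cap: "S.codeg x y \<le> cap"
  using S_codeg_le codeg_le_cap order_trans by blast

lemma codeg_split: "x \<notin> bad \<Longrightarrow> y \<notin> bad \<Longrightarrow> codeg x y = S.codeg x y + real (card (nb x y \<inter> bad))"
  using card_Int_Diff[of "nb x y" bad] by (simp add: codeg_def S.codeg_def S_nb)

lemma codeg_le_S: "x \<notin> bad \<Longrightarrow> y \<notin> bad \<Longrightarrow> codeg x y \<le> S.codeg x y + b^4 * n"
  using codeg_split[of x y] card_mono[OF finite_bad, of "nb x y \<inter> bad"] card_bad by simp

lemma order_S: "S.order = n - real (card bad)"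
  using card_Diff_subset[OF finite_bad bad_sub] card_mono[OF finite_V bad_sub] by (simp add: of_nat_diff)

text \<open>A triple meeting \<open>bad\<close> does so in one of three positions, and the triples
  with a given position in \<open>bad\<close> number the degree sum over \<open>bad\<close>.\<close>

lemma total_le_S: "total \<le> S.total + 3 * (\<Sum>z\<in>bad. deg z)"
proof -
  have split: "(\<Sum>x\<in>V. f x) = (\<Sum>x\<in>bad. f x) + (\<Sum>x\<in>V - bad. f x)" for f :: "'a \<Rightarrow> real"
    using sum.subset_diff[OF bad_sub finite_V, of f] by simp
  have "total = (\<Sum>z\<in>bad. deg z) + (\<Sum>x\<in>V - bad. (\<Sum>y\<in>bad. codeg x y) + (\<Sum>y\<in>V - bad. codeg x y))"
  proof -
    have "total = (\<Sum>z\<in>bad. deg z) + (\<Sum>x\<in>V - bad. deg x)" unfolding total_def by (rule split)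
    also have "(\<Sum>x\<in>V - bad. deg x) = (\<Sum>x\<in>V - bad. (\<Sum>y\<in>bad. codeg x y) + (\<Sum>y\<in>V - bad. codeg x y))"
      unfolding deg_def by (intro sum.cong refl split)
    finally show ?thesis .
  qed
  also have "\<dots> = (\<Sum>z\<in>bad. deg z) + (\<Sum>x\<in>V - bad. \<Sum>y\<in>bad. codeg x y)
      + (\<Sum>x\<in>V - bad. \<Sum>y\<in>V - bad. codeg x y)"
    by (simp add: sum.distrib)
  also have "(\<Sum>x\<in>V - bad. \<Sum>y\<in>bad. codeg x y) \<le> (\<Sum>x\<in>V. \<Sum>y\<in>bad. codeg x y)"
    by (intro sum_mono2 finite_V sum_nonneg codeg_nonneg) auto
  also have "\<dots> = (\<Sum>z\<in>bad. deg z)"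
    unfolding deg_def by (subst sum.swap) (simp add: codeg_commute)
  also have "(\<Sum>x\<in>V - bad. \<Sum>y\<in>V - bad. codeg x y)
      = S.total + (\<Sum>x\<in>V - bad. \<Sum>y\<in>V - bad. real (card (nb x y \<inter> bad)))"
    unfolding S.total_def S.deg_def by (simp add: codeg_split sum.distrib)
  also have "(\<Sum>x\<in>V - bad. \<Sum>y\<in>V - bad. real (card (nb x y \<inter> bad)))
      \<le> (\<Sum>x\<in>V. \<Sum>y\<in>V. real (card (nb x y \<inter> bad)))"
  proof (rule order_trans)
    show "(\<Sum>x\<in>V - bad. \<Sum>y\<in>V - bad. real (card (nb x y \<inter> bad)))
        \<le> (\<Sum>x\<in>V - bad. \<Sum>y\<in>V. real (card (nb x y \<inter> bad)))"
      by (intro sum_mono sum_mono2 finite_V) auto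
    show "\<dots> \<le> (\<Sum>x\<in>V. \<Sum>y\<in>V. real (card (nb x y \<inter> bad)))"
      by (intro sum_mono2 finite_V sum_nonneg) auto
  qed
  also have "\<dots> = (\<Sum>z\<in>bad. deg z)" by (rule sum_card_nb_Int[OF bad_sub])
  finally show ?thesis by simp
qed

lemma deg_bad: "z \<in> bad \<Longrightarrow> deg z \<le> cap * (n - spread)"
proof -
  assume "z \<in> bad"
  then have "cap * (n - nondeg z) \<le> cap * (n - spread)"
    using cap_pos by (intro mult_left_mono) (auto simp: bad_def)
  then show ?thesis using deg_le[of cap z] codeg_le_cap by simp
qed

lemma total_le_S_cap: "total \<le> S.total + 3 * (real (card bad) * (cap * (n - spread)))"
  using total_le_S sum_bounded_above[of bad deg "cap * (n - spread)"] deg_bad by simp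

section \<open>Classes of large neighbourhoods\<close>

definition larges :: "'a set set" where
  "larges = {S.nb x y | x y. large \<le> S.codeg x y}"

lemma larges_sub: "A \<in> larges \<Longrightarrow> A \<subseteq> V - bad"
  using S.nb_sub by (auto simp: larges_def)

lemma finite_in_larges: "A \<in> larges \<Longrightarrow> finite A"
  by (auto simp: larges_def)

lemma card_larges: "A \<in> larges \<Longrightarrow> large \<le> real (card A)" "A \<in> larges \<Longrightarrow> real (card A) \<le> cap"
  using S_codeg_le_cap by (auto simp: larges_def S.codeg_def)

lemma finite_larges: "finite larges"
proof (rule finite_subset)
  show "larges \<subseteq> Pow (V - bad)" using larges_sub by blast
qed (use finite_V in simp)

lemma larges_nonempty: "{} \<notin> larges"
  using card_larges(1)[of "{}"] large_pos by auto

lemma larges_nonadj: "A \<in> larges \<Longrightarrow> z \<in> A \<Longrightarrow> A \<subseteq> nonadj z"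
  unfolding larges_def using nb_independent S_nb_sub by blast

lemma larges_S_nonadj: "A \<in> larges \<Longrightarrow> z \<in> A \<Longrightarrow> A \<subseteq> S.nonadj z"
  unfolding larges_def using S.nb_independent by blast

text \<open>A common vertex \<open>z\<close> is nonadjacent to everything in both sets. As
  \<open>z\<close> survived the deletion, \<open>nondeg z\<close> is at most \<open>spread\<close>;
  this is the purpose of removing \<open>bad\<close>.\<close>

lemma card_Un_larges:
  assumes "A \<in> larges" "B \<in> larges" "A \<inter> B \<noteq> {}"
  shows "real (card (A \<union> B)) \<le> spread"
proof -
  obtain z where z: "z \<in> A" "z \<in> B" using assms(3) by blast
  have "A \<union> B \<subseteq> nonadj z" using larges_nonadj assms z by blast
  then have "real (card (A \<union> B)) \<le> nondeg z" by (simp add: nondeg_def card_mono)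
  moreover have "z \<in> V" "z \<notin> bad" using larges_sub[OF assms(1)] z by auto
  ultimately show ?thesis by (auto simp: bad_def)
qed

text \<open>If \<open>B\<close> met two disjoint large sets, it would overlap each in at least
  \<open>2 * large - spread\<close>, nearly \<open>n/K\<close>, and hence would have almost twice
  the permitted size.\<close>

lemma larges_transitive:
  assumes "A \<in> larges" "B \<in> larges" "C \<in> larges" "A \<inter> B \<noteq> {}" "B \<inter> C \<noteq> {}"
  shows "A \<inter> C \<noteq> {}"
proof
  assume AC: "A \<inter> C = {}"
  have overlap: "2 * large - spread \<le> real (card (B \<inter> D))" if "D \<in> larges" "B \<inter> D \<noteq> {}" for D
    using card_Un_Int[of B D] card_Un_larges[OF assms(2) that] card_larges(1)[OF assms(2)]
      card_larges(1)[OF that(1)] finite_in_larges that assms(2) by fastforce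
  have "card (B \<inter> A) + card (B \<inter> C) = card ((B \<inter> A) \<union> (B \<inter> C))"
    using AC finite_in_larges assms by (intro card_Un_disjoint[symmetric]) auto
  also have "\<dots> \<le> card B" using finite_in_larges assms by (intro card_mono) auto
  finally have "2 * (2 * large - spread) \<le> cap"
    using overlap[OF assms(1)] overlap[OF assms(3)] assms(4,5) card_larges(2)[OF assms(2)] by (auto simp: Int_commute)
  then have "2 * (1/K - 2 * b - K * b\<^sup>2) * n \<le> (1/K + b\<^sup>2) * n"
    by (simp add: large_def spread_def cap_def algebra_simps)
  then show False using adm_b(6) n_pos by simp
qed

end

section \<open>The parts and the vertices they leave uncovered\<close>

locale near_extremal_parts = near_extremal +
  fixes \<I> :: "'a set set"
  assumes parts_sub: "\<I> \<subseteq> larges"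
    and parts_disjoint: "\<And>I J. I \<in> \<I> \<Longrightarrow> J \<in> \<I> \<Longrightarrow> I \<noteq> J \<Longrightarrow> I \<inter> J = {}"
    and parts_meet: "\<And>A. A \<in> larges \<Longrightarrow> \<exists>I\<in>\<I>. A \<inter> I \<noteq> {}"
    and parts_max: "\<And>A I. A \<in> larges \<Longrightarrow> I \<in> \<I> \<Longrightarrow> A \<inter> I \<noteq> {} \<Longrightarrow> card A \<le> card I"
begin

definition sz :: "'a set \<Rightarrow> real" where "sz I = real (card I)"

definition uncovered :: real where "uncovered = S.order - (\<Sum>I\<in>\<I>. sz I)"

lemma parts_larges: "I \<in> \<I> \<Longrightarrow> I \<in> larges"
  using parts_sub by auto

lemma finite_part: "I \<in> \<I> \<Longrightarrow> finite I"
  using parts_larges finite_in_larges by blast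

lemma part_sub: "I \<in> \<I> \<Longrightarrow> I \<subseteq> V - bad"
  using parts_larges larges_sub by blast

lemma sz_bounds: "I \<in> \<I> \<Longrightarrow> large \<le> sz I" "I \<in> \<I> \<Longrightarrow> sz I \<le> cap"
  using parts_larges card_larges by (auto simp: sz_def)

lemma cover_sub: "\<Union>\<I> \<subseteq> V - bad"
  using part_sub by blast

lemma finite_cover: "finite (\<Union>\<I>)"
  using finite_subset[OF cover_sub] finite_V by simp

lemma card_cover: "real (card (\<Union>\<I>)) = (\<Sum>I\<in>\<I>. sz I)"
proof -
  have "card (\<Union>\<I>) = (\<Sum>I\<in>\<I>. card I)"
    using parts_disjoint finite_part by (intro card_Union_disjoint) (auto simp: pairwise_def disjnt_def)
  then show ?thesis by (simp add: sz_def)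
qed

lemma card_rest: "real (card (V - bad - \<Union>\<I>)) = uncovered"
  using card_Diff_subset[OF finite_cover cover_sub] card_mono[OF _ cover_sub] finite_V
  by (simp add: uncovered_def flip: card_cover)

lemma uncovered_nonneg: "uncovered \<ge> 0"
  using card_rest[symmetric] by simp

lemma sum_cover: "(\<Sum>z\<in>\<Union>\<I>. f z) = (\<Sum>I\<in>\<I>. \<Sum>z\<in>I. f z)" for f :: "'a \<Rightarrow> real"
  using parts_disjoint finite_part by (subst sum.Union_disjoint) auto

lemma sum_split: "(\<Sum>z\<in>V - bad. f z) = (\<Sum>I\<in>\<I>. \<Sum>z\<in>I. f z) + (\<Sum>z\<in>V - bad - \<Union>\<I>. f z)" for f :: "'a \<Rightarrow> real"
  using sum.subset_diff[OF cover_sub, of f] finite_V by (simp add: sum_cover)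

lemma part_le_S_nondeg: "I \<in> \<I> \<Longrightarrow> z \<in> I \<Longrightarrow> sz I \<le> S.nondeg z"
  using larges_S_nonadj[OF parts_larges] by (simp add: sz_def S.nondeg_def card_mono)

lemma S_deg_cover:
  assumes "z \<in> \<Union>\<I>"
  shows "S.deg z \<le> cap * (n - large)"
proof -
  obtain I where I: "I \<in> \<I>" "z \<in> I" using assms by auto
  have "S.deg z \<le> cap * (S.order - S.nondeg z)"
    by (rule S.deg_le[OF S_codeg_le_cap])
  also have "\<dots> \<le> cap * (n - large)"
    using part_le_S_nondeg[OF I] sz_bounds(1)[OF I(1)] cap_pos order_S by (intro mult_left_mono) auto
  finally show ?thesis .
qed

text \<open>A large neighbourhood meets a part, and their union has at most \<open>spread\<close>
  vertices, so at most \<open>spread - large\<close> of them lie outside that part. A small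
  neighbourhood of an adjacent pair has gap at least \<open>b n\<close>, and the factor
  \<open>(1/K + b^2) / b\<close> converts this gap into the full bound \<open>cap\<close>.\<close>

lemma nb_outside_cover:
  assumes "x \<in> V - bad" "y \<in> V - bad"
  shows "real (card (S.nb x y - \<Union>\<I>)) \<le> (K * b\<^sup>2 + b) * n + gap x y * ((1/K + b\<^sup>2) / b)"
proof (cases "S.nb x y \<in> larges")
  case True
  then obtain I where I: "I \<in> \<I>" "S.nb x y \<inter> I \<noteq> {}" using parts_meet by blast
  have "real (card (S.nb x y - \<Union>\<I>)) \<le> real (card ((S.nb x y \<union> I) - I))"
    using I(1) finite_part by (intro of_nat_mono card_mono) auto
  also have "\<dots> = real (card (S.nb x y \<union> I)) - sz I"
    using card_Diff_subset[of I "S.nb x y \<union> I"] card_mono[of "S.nb x y \<union> I" I] finite_part[OF I(1)]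
    by (simp add: sz_def of_nat_diff)
  also have "\<dots> \<le> spread - large"
    using card_Un_larges[OF True parts_larges[OF I(1)] I(2)] sz_bounds(1)[OF I(1)] by linarith
  also have "\<dots> = (K * b\<^sup>2 + b) * n"
    by (simp add: spread_def large_def algebra_simps)
  moreover have "0 \<le> gap x y * ((1/K + b\<^sup>2) / b)"
    using gap_nonneg K_ge_3 adm_b(1) by simp
  ultimately show ?thesis by linarith
next
  case False
  then have small: "S.codeg x y < large" by (force simp: larges_def)
  have nn: "0 \<le> (K * b\<^sup>2 + b) * n" using K_ge_3 adm_b(1) by simp
  have "real (card (S.nb x y - \<Union>\<I>)) \<le> S.codeg x y"
    by (simp add: S.codeg_def card_mono)
  also have "S.codeg x y \<le> gap x y * ((1/K + b\<^sup>2) / b)"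
  proof (cases "adj x y")
    case True
    \<comment> \<open>The margin \<open>b^2\<close> between \<open>cap\<close> and
      \<open>n/K\<close> absorbs the at most \<open>b^4 n\<close> neighbours lost to
      \<open>bad\<close>.\<close>
    have "b^4 * n \<le> b\<^sup>2 * n"
      using adm_b(1,2) by (intro mult_right_mono power_decreasing) auto
    then have "codeg x y \<le> cap - b * n"
      using codeg_le_S[of x y] assms small by (simp add: large_def cap_def algebra_simps)
    then have "b * n \<le> gap x y" using True by (simp add: gap_def)
    then have "b * n * ((1/K + b\<^sup>2) / b) \<le> gap x y * ((1/K + b\<^sup>2) / b)"
      using K_ge_3 adm_b(1) by (intro mult_right_mono) auto
    moreover have "b * n * ((1/K + b\<^sup>2) / b) = cap" using adm_b(1) by (simp add: cap_def)
    ultimately show ?thesis using S_codeg_le_cap[of x y] by linarith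
  next
    case False
    then have "S.codeg x y = 0"
      using codeg_not_adj[of x y] S_codeg_le[of x y] S.codeg_nonneg[of x y] by simp
    then show ?thesis using False by (simp add: gap_def)
  qed
  finally show ?thesis using nn by linarith
qed

text \<open>By double counting this is the sum over all pairs of the portion of their neighbourhood
  outside the cover; the gap terms are controlled by \<open>sum_gap\<close>.\<close>

lemma S_deg_rest: "(\<Sum>z\<in>V - bad - \<Union>\<I>. S.deg z)
  \<le> (K * b\<^sup>2 + b) * n^3 + (b + b^7) * (1/K + b\<^sup>2) * n^3"
proof -
  define V' where "V' = V - bad"
  define \<alpha> \<beta> where "\<alpha> = (K * b\<^sup>2 + b) * n" and "\<beta> = (1/K + b\<^sup>2) / b"
  have nn: "\<alpha> \<ge> 0" "\<beta> \<ge> 0" using K_ge_3 adm_b(1) by (simp_all add: \<alpha>_def \<beta>_def)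
  have "(\<Sum>z\<in>V' - \<Union>\<I>. S.deg z) = (\<Sum>x\<in>V'. \<Sum>y\<in>V'. real (card (S.nb x y \<inter> (V' - \<Union>\<I>))))"
    unfolding V'_def by (rule S.sum_card_nb_Int[symmetric]) auto
  also have "\<dots> = (\<Sum>x\<in>V'. \<Sum>y\<in>V'. real (card (S.nb x y - \<Union>\<I>)))"
  proof -
    have "S.nb x y \<inter> (V' - \<Union>\<I>) = S.nb x y - \<Union>\<I>" for x y
      using S.nb_sub[of x y] unfolding V'_def by blast
    then show ?thesis by simp
  qed
  also have "\<dots> \<le> (\<Sum>x\<in>V'. \<Sum>y\<in>V'. \<alpha> + gap x y * \<beta>)"
    unfolding V'_def \<alpha>_def \<beta>_def by (intro sum_mono nb_outside_cover)
  also have "\<dots> \<le> (\<Sum>x\<in>V'. \<Sum>y\<in>V. \<alpha> + gap x y * \<beta>)"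
    using finite_V nn gap_nonneg by (intro sum_mono sum_mono2) (auto simp: V'_def)
  also have "\<dots> \<le> (\<Sum>x\<in>V. \<Sum>y\<in>V. \<alpha> + gap x y * \<beta>)"
    using finite_V nn gap_nonneg by (intro sum_mono2 sum_nonneg add_nonneg_nonneg) (auto simp: V'_def)
  also have "\<dots> = \<alpha> * n\<^sup>2 + (\<Sum>x\<in>V. \<Sum>y\<in>V. gap x y) * \<beta>"
    by (simp add: sum.distrib sum_distrib_right power2_eq_square)
  also have "\<dots> \<le> \<alpha> * n\<^sup>2 + ((b\<^sup>2 + b^8) * n^3) * \<beta>"
    using sum_gap nn by (intro add_left_mono mult_right_mono)
  also have "\<dots> = (K * b\<^sup>2 + b) * n^3 + ((b\<^sup>2 + b^8) / b) * (1/K + b\<^sup>2) * n^3"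
    by (simp add: \<alpha>_def \<beta>_def power2_eq_square power3_eq_cube)
  also have "(b\<^sup>2 + b^8) / b = b + b^7"
    using adm_b(1) by (simp add: field_simps power2_eq_square flip: power_Suc)
  finally show ?thesis unfolding V'_def .
qed

lemma y0_pos: "1/K - 1/K\<^sup>2 > 0"
  using K_ge_3 by (simp add: field_simps power2_eq_square)

text \<open>Covered vertices have degree at most \<open>cap * (n - large)\<close>, about
  \<open>(1/K - 1/K^2) n^2\<close>, and the uncovered ones together contribute almost nothing. A
  nearly extremal \<open>total\<close> therefore requires almost all vertices to be covered.\<close>

lemma uncovered_le: "uncovered \<le> cover_defect K b * n"
proof -
  define Q y0 where "Q = 1/K + b\<^sup>2" and "y0 = 1/K - 1/K\<^sup>2"
  define M where "M = Q * (1 - 1/K + b)"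
  define X where "X = (K * b\<^sup>2 + b) + (b + b^7) * Q"
  have Q: "Q > 0" using K_ge_3 by (simp add: Q_def add_pos_nonneg)
  have "M - y0 = 1/K * b + b\<^sup>2 * (1 - 1/K + b)"
    using K_ge_3 by (simp add: M_def Q_def y0_def field_simps power2_eq_square)
  also have "\<dots> \<ge> 0" using K_ge_3 adm_b(1) by (intro add_nonneg_nonneg mult_nonneg_nonneg) auto
  finally have My: "M \<ge> y0" by simp
  have capM: "cap * (n - large) = M * n\<^sup>2"
    by (simp add: cap_def large_def M_def Q_def algebra_simps add_divide_distrib power2_eq_square)
  have "S.total = (\<Sum>z\<in>\<Union>\<I>. S.deg z) + (\<Sum>z\<in>V - bad - \<Union>\<I>. S.deg z)"
    unfolding S.total_def using sum_split[of S.deg] sum_cover[of S.deg] by simp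
  also have "(\<Sum>z\<in>\<Union>\<I>. S.deg z) \<le> real (card (\<Union>\<I>)) * (M * n\<^sup>2)"
    using S_deg_cover by (intro sum_bounded_above) (simp add: capM)
  also have "real (card (\<Union>\<I>)) * (M * n\<^sup>2) \<le> (n - uncovered) * (M * n\<^sup>2)"
    using My y0_pos order_S unfolding card_cover uncovered_def y0_def
    by (intro mult_right_mono) auto
  finally have 1: "S.total \<le> (n - uncovered) * (M * n\<^sup>2) + X * n^3"
    using S_deg_rest by (simp add: X_def Q_def algebra_simps)
  have "1/K + K * b\<^sup>2 \<le> 1"
  proof -
    have "2 * (1/K - 2 * b - K * b\<^sup>2) > 0" using adm_b(6) Q by (simp add: Q_def)
    moreover have "1/K \<le> 1/3" using K_ge_3 by (simp add: field_simps)
    ultimately show ?thesis using adm_b(1) by simp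
  qed
  then have "spread \<le> 1 * n" unfolding spread_def using n_pos by (intro mult_right_mono) auto
  then have "real (card bad) * (cap * (n - spread)) \<le> (b^4 * n) * (n * n)"
    using adm_b(1) n_pos cap_pos K_ge_3 card_bad cap_le_n by (intro mult_mono) (auto simp: spread_def)
  then have 2: "real (card bad) * (cap * (n - spread)) \<le> b^4 * n^3"
    by (simp add: power3_eq_cube)
  have "uncovered * M * n\<^sup>2 \<le> (M - y0 + b^8 + 3 * b^4 + X) * n^3"
    using 1 2 total_le_S_cap dense by (simp add: y0_def algebra_simps power2_eq_square power3_eq_cube)
  moreover have "uncovered * y0 * n\<^sup>2 \<le> uncovered * M * n\<^sup>2"
    using My uncovered_nonneg by (intro mult_right_mono mult_left_mono) auto
  ultimately have "(uncovered * y0) * n\<^sup>2 \<le> ((M - y0 + b^8 + 3 * b^4 + X) * n) * n\<^sup>2"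
    by (simp add: power2_eq_square power3_eq_cube mult_ac)
  then have "uncovered * y0 \<le> (M - y0 + b^8 + 3 * b^4 + X) * n"
    using n_pos by simp
  then have "uncovered \<le> (M - y0 + b^8 + 3 * b^4 + X) * n / y0"
    using y0_pos by (simp add: pos_le_divide_eq y0_def)
  also have "\<dots> = cover_defect K b * n"
    by (simp add: cover_defect_def y0_def M_def X_def Q_def add.assoc)
  finally show ?thesis .
qed

text \<open>All parts have size between \<open>large\<close> and \<open>cap\<close>, both close to
  \<open>n/K\<close>, and they are disjoint and cover nearly everything, so \<open>k + 1\<close>
  parts are too many and \<open>k - 1\<close> too few.\<close>

lemma card_parts: "card \<I> = k"
proof (rule antisym)
  have "real (card \<I>) * large \<le> (\<Sum>I\<in>\<I>. sz I)"
    using sum_bounded_below[of \<I> large sz] sz_bounds(1) by simp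
  also have "\<dots> \<le> n" using uncovered_nonneg order_S by (simp add: uncovered_def)
  finally have "real (card \<I>) * (1/K - b) * n \<le> 1 * n" by (simp add: large_def)
  then have le: "real (card \<I>) * (1/K - b) \<le> 1" using n_pos by simp
  show "card \<I> \<le> k"
  proof (rule ccontr)
    assume "\<not> card \<I> \<le> k"
    then have "K + 1 \<le> real (card \<I>)" using K_def by simp
    then have "(K + 1) * (1/K - b) \<le> real (card \<I>) * (1/K - b)"
      using adm_b(3) by (intro mult_right_mono) auto
    then show False using le adm_b(7) by linarith
  qed
  have "S.order - uncovered \<le> real (card \<I>) * cap"
    using sum_bounded_above[of \<I> sz cap] sz_bounds(2) by (simp add: uncovered_def)
  then have "(1 - b^4 - cover_defect K b) * n \<le> real (card \<I>) * (1/K + b\<^sup>2) * n"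
    using uncovered_le card_bad order_S by (simp add: cap_def algebra_simps)
  then have ge: "1 - b^4 - cover_defect K b \<le> real (card \<I>) * (1/K + b\<^sup>2)" using n_pos by simp
  show "k \<le> card \<I>"
  proof (rule ccontr)
    assume "\<not> k \<le> card \<I>"
    then have "real (card \<I>) \<le> K - 1" using K_def by simp
    then have "real (card \<I>) * (1/K + b\<^sup>2) \<le> (K - 1) * (1/K + b\<^sup>2)"
      using K_ge_3 by (intro mult_right_mono) auto
    then show False using ge adm_b(8) by linarith
  qed
qed

text \<open>A vertex \<open>y\<close> of \<open>I\<close> has at most \<open>spread\<close>
  nonneighbours, of which \<open>I\<close> itself accounts for at least \<open>large\<close>, so it
  is adjacent to almost all of \<open>J\<close>. Adjacent pairs have codegree \<open>cap\<close> up
  to their gap and the loss to \<open>bad\<close>. In the balanced blow-up the sum is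
  \<open>(n/K)^3\<close>, which corresponds to the limit \<open>1/K\<close> of
  \<open>cross_density\<close>.\<close>

lemma cross_codeg:
  assumes IJ: "I \<in> \<I>" "J \<in> \<I>" "I \<noteq> J"
  shows "cross_density K b * cap\<^sup>2 * n \<le> (\<Sum>y\<in>I. \<Sum>z\<in>J. S.codeg y z)"
proof -
  define V' where "V' = V - bad"
  have sub: "I \<subseteq> V" "J \<subseteq> V" "I \<subseteq> V'" "J \<subseteq> V'"
    using part_sub IJ by (auto simp: V'_def)
  have fin: "finite I" "finite J" using finite_part IJ by auto
  have pw: "cap - cap * of_bool (z \<in> nonadj y) - gap y z - b^4 * n \<le> S.codeg y z"
    if "y \<in> I" "z \<in> J" for y z
  proof (cases "adj y z")
    case True
    have "y \<notin> bad" "z \<notin> bad" using that part_sub IJ by blast+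
    then show ?thesis using codeg_le_S[of y z] True by (simp add: gap_def nonadj_def)
  next
    case False
    have "z \<in> V" using that sub by auto
    then have "cap - cap * of_bool (z \<in> nonadj y) - gap y z - b^4 * n = - (b^4 * n)"
      using False by (simp add: gap_def nonadj_def)
    moreover have "0 \<le> b^4 * n" using adm_b(1) n_pos by simp
    ultimately show ?thesis using S.codeg_nonneg[of y z] by linarith
  qed
  have nonadj_J: "(\<Sum>z\<in>J. of_bool (z \<in> nonadj y)) \<le> spread - large" if "y \<in> I" for y
  proof -
    have "I \<subseteq> nonadj y" using larges_nonadj[OF parts_larges[OF IJ(1)] that] .
    then have "real (card (I \<union> (J \<inter> nonadj y))) \<le> nondeg y"
      unfolding nondeg_def by (intro of_nat_mono card_mono) auto
    also have "\<dots> \<le> spread" using that part_sub[OF IJ(1)] by (auto simp: bad_def)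
    finally have "real (card I) + real (card (J \<inter> nonadj y)) \<le> spread"
      using fin parts_disjoint[OF IJ] by (subst (asm) card_Un_disjoint) auto
    then show ?thesis using sz_bounds(1)[OF IJ(1)] fin by (simp add: sz_def Int_def)
  qed
  define e where "e = (b\<^sup>2 + b^8) * n^3"
  have gapIJ: "(\<Sum>y\<in>I. \<Sum>z\<in>J. gap y z) \<le> e"
  proof -
    have "(\<Sum>y\<in>I. \<Sum>z\<in>J. gap y z) \<le> (\<Sum>y\<in>I. \<Sum>z\<in>V. gap y z)"
      using sub by (intro sum_mono sum_mono2 finite_V gap_nonneg) auto
    also have "\<dots> \<le> (\<Sum>y\<in>V. \<Sum>z\<in>V. gap y z)"
      using sub by (intro sum_mono2 finite_V sum_nonneg gap_nonneg) auto
    finally show ?thesis using sum_gap unfolding e_def by linarith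
  qed
  have szn: "sz I \<le> n" "sz J \<le> n" "sz I \<ge> 0" "sz J \<ge> 0"
    using sub by (auto simp: sz_def card_mono finite_V)
  have "sz I * (b^4 * n * sz J) \<le> n * (b^4 * n * n)"
    using szn n_pos adm_b(1) by (intro mult_mono mult_nonneg_nonneg) auto
  then have err: "sz I * (b^4 * n * sz J) \<le> b^4 * n^3" by (simp add: power3_eq_cube mult_ac)
  have nn: "2 * large - spread \<ge> 0"
  proof -
    have "2 * (1/K - 2 * b - K * b\<^sup>2) > 0" using adm_b(6) K_ge_3 zero_le_power2[of b] by (smt (verit) divide_nonneg_pos)
    then have "0 \<le> (1/K - 2 * b - K * b\<^sup>2) * n" using n_pos by simp
    then show ?thesis by (simp add: large_def spread_def algebra_simps)
  qed
  have "large * (2 * large - spread) \<le> sz I * (sz J - (spread - large))"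
    using sz_bounds(1)[OF IJ(1)] sz_bounds(1)[OF IJ(2)] nn large_pos by (intro mult_mono) auto
  then have "cap * (large * (2 * large - spread)) \<le> cap * (sz I * (sz J - (spread - large)))"
    using cap_pos by (intro mult_left_mono) auto
  then have main: "cap * large * (2 * large - spread) - e - b^4 * n^3
      \<le> cap * sz I * sz J - cap * sz I * (spread - large) - e - sz I * (b^4 * n * sz J)"
    using err by (simp add: algebra_simps)
  also have "\<dots> \<le> cap * sz I * sz J - cap * (\<Sum>y\<in>I. \<Sum>z\<in>J. of_bool (z \<in> nonadj y))
      - (\<Sum>y\<in>I. \<Sum>z\<in>J. gap y z) - sz I * (b^4 * n * sz J)"
  proof -
    have "(\<Sum>y\<in>I. \<Sum>z\<in>J. of_bool (z \<in> nonadj y)) \<le> sz I * (spread - large)"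
      using nonadj_J sum_bounded_above[of I _ "spread - large"] by (simp add: sz_def)
    then have "cap * (\<Sum>y\<in>I. \<Sum>z\<in>J. of_bool (z \<in> nonadj y)) \<le> cap * (sz I * (spread - large))"
      using cap_pos by (intro mult_left_mono) auto
    then show ?thesis using gapIJ by (simp only: mult.assoc)
  qed
  also have "\<dots> = (\<Sum>y\<in>I. \<Sum>z\<in>J. cap - cap * of_bool (z \<in> nonadj y) - gap y z - b^4 * n)"
    by (simp add: sum_subtractf sum_distrib_left[symmetric] sz_def del: of_bool_eq_iff)
  also have "\<dots> \<le> (\<Sum>y\<in>I. \<Sum>z\<in>J. S.codeg y z)"
    by (intro sum_mono pw)
  finally have "cap * large * (2 * large - spread) - e - b^4 * n^3 \<le> (\<Sum>y\<in>I. \<Sum>z\<in>J. S.codeg y z)" .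
  moreover have "cross_density K b * cap\<^sup>2 * n = cap * large * (2 * large - spread) - e - b^4 * n^3"
  proof -
    define Q l m where "Q = 1/K + b\<^sup>2" and "l = 1/K - b" and "m = 1/K - 2 * b - K * b\<^sup>2"
    have Q: "Q > 0" using K_ge_3 by (simp add: Q_def add_pos_nonneg)
    have "cross_density K b * Q\<^sup>2 = Q * l * m - (b\<^sup>2 + b^8) - b^4"
      using Q by (simp add: cross_density_def flip: Q_def l_def m_def)
    moreover have "cap = Q * n" by (simp add: cap_def Q_def)
    moreover have "large = l * n" by (simp add: large_def l_def)
    moreover have "2 * large - spread = m * n"
      by (simp add: large_def spread_def m_def algebra_simps)
    moreover have "X * (Q * n)\<^sup>2 * n = Q * n * (l * n) * (m * n) - (b\<^sup>2 + b^8) * n^3 - b^4 * n^3"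
      if "X * Q\<^sup>2 = Q * l * m - (b\<^sup>2 + b^8) - b^4" for X
    proof -
      have "X * (Q * n)\<^sup>2 * n = (X * Q\<^sup>2) * n^3"
        by (simp add: power2_eq_square power3_eq_cube)
      then show ?thesis unfolding that by (simp add: algebra_simps power3_eq_cube)
    qed
    ultimately show ?thesis unfolding e_def by simp
  qed
  ultimately show ?thesis by simp
qed

text \<open>Parts are independent, so this counts ordered pairs nonadjacent in \<open>R'\<close>
  whose first vertex lies in a part and whose second vertex lies outside that part. It vanishes for
  a complete multipartite shadow with these parts.\<close>

definition defect :: real where "defect = (\<Sum>I\<in>\<I>. \<Sum>y\<in>I. S.nondeg y - sz I)"

lemma defect_nonneg: "defect \<ge> 0"
  unfolding defect_def using part_le_S_nondeg by (intro sum_nonneg) auto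

text \<open>The weight is \<open>sz I\<close> on each part \<open>I\<close> and \<open>min p cap\<close> off the parts. It dominates codegrees
  because a large \<open>N(xy)\<close> meeting a part \<open>I\<close> is no larger than \<open>I\<close>, by the choice of representatives.\<close>

lemma S_total_le:
  "S.total \<le> (\<Sum>I\<in>\<I>. (sz I)\<^sup>2 * (S.order - sz I)) - large * defect
    + uncovered * (cap * (S.order - cap))
    - 1/2 * (cross_density K b * n) * (\<Sum>I\<in>\<I>. \<Sum>J\<in>\<I>. (sz I - sz J)\<^sup>2)"
proof -
  define V' where "V' = V - bad"
  define part where "part z = (SOME I. I \<in> \<I> \<and> z \<in> I)" for z
  have part: "part z = I" if "I \<in> \<I>" "z \<in> I" for z I
    unfolding part_def
  proof (rule some_equality)
    show "I \<in> \<I> \<and> z \<in> I" using that by simp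
    show "J = I" if "J \<in> \<I> \<and> z \<in> J" for J
      using parts_disjoint[of I J] that \<open>I \<in> \<I>\<close> \<open>z \<in> I\<close> by blast
  qed
  define w where "w z = (if z \<in> \<Union>\<I> then sz (part z) else min (S.nondeg z) cap)" for z
  have w_part: "w z = sz I" if "I \<in> \<I>" "z \<in> I" for z I
  proof -
    have "z \<in> \<Union>\<I>" using that by blast
    then show ?thesis using part[OF that] by (simp add: w_def)
  qed
  have w_rest: "w z = min (S.nondeg z) cap" if "z \<notin> \<Union>\<I>" for z
    using that by (simp add: w_def)
  have w_pos: "w z > 0" if "z \<in> V'" for z
  proof (cases "z \<in> \<Union>\<I>")
    case True
    then obtain I where I: "I \<in> \<I>" "z \<in> I" by blast
    show ?thesis using w_part[OF I] sz_bounds(1)[OF I(1)] large_pos by simp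
  next
    case False
    then show ?thesis using w_rest[OF False] S.nondeg_ge_1[of z] that cap_pos by (simp add: V'_def)
  qed
  have w_codeg: "S.codeg x y \<le> w z" if R': "R' x y z" for x y z
  proof (cases "z \<in> \<Union>\<I>")
    case True
    then obtain I where I: "I \<in> \<I>" "z \<in> I" by blast
    have "S.codeg x y \<le> sz I"
    proof (cases "S.nb x y \<in> larges")
      case True
      have "z \<in> S.nb x y" using R' by (simp add: S.nb_def)
      then have "card (S.nb x y) \<le> card I" using parts_max[OF True I(1)] I(2) by blast
      then show ?thesis by (simp add: S.codeg_def sz_def)
    next
      case False
      then have "S.codeg x y < large" by (force simp: larges_def)
      then show ?thesis using sz_bounds(1)[OF I(1)] by simp
    qed
    then show ?thesis using w_part[OF I] by simp
  next
    case False
    then show ?thesis using w_rest[OF False] S.codeg_le_nondeg[OF R'] S_codeg_le_cap[of x y] by simp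
  qed
  define f where "f y z = (w y - w z)\<^sup>2 / (w y * w z)" for y z
  have f_nonneg: "f y z \<ge> 0" if "y \<in> V'" "z \<in> V'" for y z
    using w_pos[OF that(1)] w_pos[OF that(2)] by (simp add: f_def)
  have "S.total + 1/2 * (\<Sum>x\<in>V'. \<Sum>y\<in>V'. \<Sum>z\<in>S.nb x y. f y z) \<le> (\<Sum>y\<in>V'. w y * (S.order - S.nondeg y))"
    unfolding f_def V'_def by (rule S.total_le_weight[OF w_pos[unfolded V'_def] w_codeg])
  then have T: "S.total + 1/2 * (\<Sum>y\<in>V'. \<Sum>z\<in>V'. S.codeg y z * f y z) \<le> (\<Sum>y\<in>V'. w y * (S.order - S.nondeg y))"
    unfolding V'_def S.sum_triples_regroup .
  \<comment> \<open>Only pairs across two different parts are retained. There \<open>w\<close> takes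
    the two part sizes, so \<open>f\<close> is constant on the pairs from \<open>I\<close> and
    \<open>J\<close>; bounding \<open>sz I * sz J\<close> by \<open>cap^2\<close> cancels the
    normalisation in \<open>cross_codeg\<close>.\<close>
  have loss: "cross_density K b * n * (\<Sum>I\<in>\<I>. \<Sum>J\<in>\<I>. (sz I - sz J)\<^sup>2)
      \<le> (\<Sum>y\<in>V'. \<Sum>z\<in>V'. S.codeg y z * f y z)"
  proof -
    have nn: "0 \<le> S.codeg y z * f y z" if "y \<in> V'" "z \<in> V'" for y z
      using f_nonneg[OF that] S.codeg_nonneg by simp
    have fV': "finite V'" and sub: "\<Union>\<I> \<subseteq> V'" using finite_V cover_sub by (auto simp: V'_def)
    have pair: "cross_density K b * n * (sz I - sz J)\<^sup>2 \<le> (\<Sum>y\<in>I. \<Sum>z\<in>J. S.codeg y z * f y z)"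
      if IJ: "I \<in> \<I>" "J \<in> \<I>" for I J
    proof (cases "I = J")
      case True
      have "f y z = 0" if "y \<in> I" "z \<in> I" for y z using w_part[OF IJ(1)] that by (simp add: f_def)
      then show ?thesis using True by simp
    next
      case False
      have pos: "sz I > 0" "sz J > 0"
        using sz_bounds(1)[OF IJ(1)] sz_bounds(1)[OF IJ(2)] large_pos by simp_all
      have le: "sz I * sz J \<le> cap\<^sup>2" unfolding power2_eq_square
        using sz_bounds(2) IJ pos cap_pos by (intro mult_mono) auto
      have "cross_density K b * n * (sz I - sz J)\<^sup>2
          = (cross_density K b * cap\<^sup>2 * n) * ((sz I - sz J)\<^sup>2 / cap\<^sup>2)"
        using cap_pos by simp
      also have "\<dots> \<le> (cross_density K b * cap\<^sup>2 * n) * ((sz I - sz J)\<^sup>2 / (sz I * sz J))"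
        using le pos cap_pos adm_b(10) by (intro mult_left_mono divide_left_mono) auto
      also have "\<dots> \<le> (\<Sum>y\<in>I. \<Sum>z\<in>J. S.codeg y z) * ((sz I - sz J)\<^sup>2 / (sz I * sz J))"
        using cross_codeg[OF IJ False] pos by (intro mult_right_mono) auto
      also have "\<dots> = (\<Sum>y\<in>I. \<Sum>z\<in>J. S.codeg y z * f y z)"
        unfolding sum_distrib_right
        by (intro sum.cong refl) (simp add: f_def w_part[OF IJ(1)] w_part[OF IJ(2)])
      finally show ?thesis .
    qed
    have "cross_density K b * n * (\<Sum>I\<in>\<I>. \<Sum>J\<in>\<I>. (sz I - sz J)\<^sup>2)
        = (\<Sum>I\<in>\<I>. \<Sum>J\<in>\<I>. cross_density K b * n * (sz I - sz J)\<^sup>2)"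
      by (simp add: sum_distrib_left)
    also have "\<dots> \<le> (\<Sum>I\<in>\<I>. \<Sum>J\<in>\<I>. \<Sum>y\<in>I. \<Sum>z\<in>J. S.codeg y z * f y z)"
      by (intro sum_mono pair)
    also have "\<dots> = (\<Sum>I\<in>\<I>. \<Sum>y\<in>I. \<Sum>J\<in>\<I>. \<Sum>z\<in>J. S.codeg y z * f y z)"
      by (intro sum.cong refl sum.swap)
    also have "\<dots> = (\<Sum>y\<in>\<Union>\<I>. \<Sum>z\<in>\<Union>\<I>. S.codeg y z * f y z)"
      by (simp only: sum_cover)
    also have "\<dots> \<le> (\<Sum>y\<in>\<Union>\<I>. \<Sum>z\<in>V'. S.codeg y z * f y z)"
      using sub nn by (intro sum_mono sum_mono2 fV') auto
    also have "\<dots> \<le> (\<Sum>y\<in>V'. \<Sum>z\<in>V'. S.codeg y z * f y z)"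
      using sub nn by (intro sum_mono2 fV' sum_nonneg) auto
    finally show ?thesis .
  qed
  have parts: "(\<Sum>y\<in>I. w y * (S.order - S.nondeg y)) \<le> (sz I)\<^sup>2 * (S.order - sz I) - large * (\<Sum>y\<in>I. S.nondeg y - sz I)"
    if I: "I \<in> \<I>" for I
  proof -
    have "(\<Sum>y\<in>I. w y * (S.order - S.nondeg y)) = (\<Sum>y\<in>I. sz I * (S.order - sz I) - sz I * (S.nondeg y - sz I))"
      by (intro sum.cong refl) (simp add: w_part[OF I] algebra_simps)
    also have "\<dots> = (sz I)\<^sup>2 * (S.order - sz I) - sz I * (\<Sum>y\<in>I. S.nondeg y - sz I)"
      unfolding sum_subtractf[of "\<lambda>y. sz I * (S.order - sz I)"] sum_distrib_left[symmetric]
      by (simp add: sz_def power2_eq_square)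
    finally have "(\<Sum>y\<in>I. w y * (S.order - S.nondeg y))
      = (sz I)\<^sup>2 * (S.order - sz I) - sz I * (\<Sum>y\<in>I. S.nondeg y - sz I)" .
    moreover have "large * (\<Sum>y\<in>I. S.nondeg y - sz I) \<le> sz I * (\<Sum>y\<in>I. S.nondeg y - sz I)"
      using part_le_S_nondeg[OF I] sz_bounds(1)[OF I] by (intro mult_right_mono sum_nonneg) auto
    ultimately show ?thesis by linarith
  qed
  \<comment> \<open>The function \<open>t (N - t)\<close> increases up to \<open>N/2\<close>, so
    truncating the weight at \<open>cap\<close> bounds the contribution of an uncovered vertex by
    its value at \<open>cap\<close>.\<close>
  have cap_half: "2 * cap \<le> S.order"
  proof -
    have "2 * (1/K + b\<^sup>2) * n \<le> (1 - b^4) * n" using adm_b(9) n_pos by (intro mult_right_mono) auto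
    then show ?thesis using order_S card_bad by (simp add: cap_def algebra_simps)
  qed
  have rest: "w y * (S.order - S.nondeg y) \<le> cap * (S.order - cap)" if y: "y \<in> V' - \<Union>\<I>" for y
  proof -
    have wy: "w y \<le> S.nondeg y" "w y \<le> cap" "w y > 0"
      using y w_rest[of y] w_pos[of y] by simp_all
    have "w y * (S.order - S.nondeg y) \<le> w y * (S.order - w y)"
      using wy by (intro mult_left_mono) auto
    moreover have "0 \<le> (cap - w y) * (S.order - cap - w y)"
      using wy cap_half by (intro mult_nonneg_nonneg) auto
    ultimately show ?thesis by (simp add: algebra_simps)
  qed
  have "(\<Sum>y\<in>V'. w y * (S.order - S.nondeg y))
      = (\<Sum>I\<in>\<I>. \<Sum>y\<in>I. w y * (S.order - S.nondeg y)) + (\<Sum>y\<in>V' - \<Union>\<I>. w y * (S.order - S.nondeg y))"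
    unfolding V'_def by (rule sum_split)
  also have "\<dots> \<le> (\<Sum>I\<in>\<I>. (sz I)\<^sup>2 * (S.order - sz I) - large * (\<Sum>y\<in>I. S.nondeg y - sz I))
      + real (card (V' - \<Union>\<I>)) * (cap * (S.order - cap))"
    by (intro add_mono sum_mono parts sum_bounded_above rest)
  also have "\<dots> = (\<Sum>I\<in>\<I>. (sz I)\<^sup>2 * (S.order - sz I)) - large * defect + uncovered * (cap * (S.order - cap))"
    unfolding sum_subtractf[of "\<lambda>I. (sz I)\<^sup>2 * (S.order - sz I)"] sum_distrib_left[symmetric] defect_def V'_def card_rest ..
  finally have "(\<Sum>y\<in>V'. w y * (S.order - S.nondeg y))
      \<le> (\<Sum>I\<in>\<I>. (sz I)\<^sup>2 * (S.order - sz I)) - large * defect + uncovered * (cap * (S.order - cap))" .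
  moreover have "A \<le> E - 1/2 * r * X" if "A + 1/2 * L \<le> C" "r * X \<le> L" "C \<le> E" for A C E L r X :: real
    using that by simp
  ultimately show ?thesis using T loss by blast
qed

end

text \<open>The guaranteed price per unit of each source of missing shadow: \<open>gain K\<close>
  for uncovered vertices and squared imbalance, \<open>1/K - b\<close> for \<open>defect\<close>,
  and the last entry for bad vertices. The factor \<open>3/2\<close> is 3 for the positions of a
  deleted vertex in a triple, over 2 for the coefficient of \<open>card bad\<close> in
  \<open>sum_nondeg_le\<close>.\<close>

definition slope :: "real \<Rightarrow> real \<Rightarrow> real" where
  "slope K b = min (gain K) (min (1/K - b) (3/2 * (b\<^sup>2 / K - b^4)))"

section \<open>Normalised bounds and the linear decrease\<close>

context near_extremal_parts
begin

lemma S_total_normalized: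
  defines "N \<equiv> S.order / n" and "v \<equiv> uncovered / n"
  shows "S.total / n^3 \<le> (1/K - 1/K\<^sup>2) * N^3 - gain K * (v + (\<Sum>I\<in>\<I>. (sz I / n - N / K)\<^sup>2))
    - (1/K - b) * (defect / n\<^sup>2)"
proof -
  define \<rho> Q where "\<rho> = cross_density K b" and "Q = 1/K + b\<^sup>2"
  define q where "q I = sz I / n" for I
  have N: "1 - b^4 \<le> N" "N \<le> 1"
  proof -
    have "N = 1 - real (card bad) / n" using order_S n_pos by (simp add: N_def diff_divide_distrib)
    moreover have "0 \<le> real (card bad) / n" "real (card bad) / n \<le> b^4"
      using card_bad n_pos by (simp_all add: pos_divide_le_eq)
    ultimately show "1 - b^4 \<le> N" "N \<le> 1" by linarith+
  qed
  have v: "v = N - sum q \<I>" "0 \<le> v" "v \<le> cover_defect K b"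
  proof -
    show "v = N - sum q \<I>"
      by (simp add: v_def N_def q_def uncovered_def diff_divide_distrib sum_divide_distrib)
    show "0 \<le> v" "v \<le> cover_defect K b"
      using uncovered_le uncovered_nonneg n_pos by (simp_all add: v_def pos_divide_le_eq)
  qed
  have "S.total / n^3 \<le> ((\<Sum>I\<in>\<I>. (sz I)\<^sup>2 * (S.order - sz I)) - large * defect
    + uncovered * (cap * (S.order - cap))
    - 1/2 * (cross_density K b * n) * (\<Sum>I\<in>\<I>. \<Sum>J\<in>\<I>. (sz I - sz J)\<^sup>2)) / n^3"
    using S_total_le n_pos by (intro divide_right_mono) auto
  also have "\<dots> = (\<Sum>I\<in>\<I>. (sz I)\<^sup>2 * (S.order - sz I)) / n^3 - large * defect / n^3
    + uncovered * (cap * (S.order - cap)) / n^3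
    - 1/2 * (cross_density K b * n) * (\<Sum>I\<in>\<I>. \<Sum>J\<in>\<I>. (sz I - sz J)\<^sup>2) / n^3"
    by (simp only: add_divide_distrib diff_divide_distrib)
  finally have 0: "S.total / n^3 \<le> (\<Sum>I\<in>\<I>. (sz I)\<^sup>2 * (S.order - sz I)) / n^3 - large * defect / n^3
    + uncovered * (cap * (S.order - cap)) / n^3
    - 1/2 * (cross_density K b * n) * (\<Sum>I\<in>\<I>. \<Sum>J\<in>\<I>. (sz I - sz J)\<^sup>2) / n^3" .
  have e1: "(\<Sum>I\<in>\<I>. (sz I)\<^sup>2 * (S.order - sz I)) / n^3 = (\<Sum>I\<in>\<I>. (q I)\<^sup>2 * (N - q I))"
    unfolding sum_divide_distrib using n_pos
    by (intro sum.cong refl) (simp add: q_def N_def field_simps power2_eq_square power3_eq_cube)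
  have e2: "large * defect / n^3 = (1/K - b) * (defect / n\<^sup>2)"
    using n_pos by (simp add: large_def power2_eq_square power3_eq_cube)
  have e3: "uncovered * (cap * (S.order - cap)) / n^3 = v * (Q * (N - Q))"
    using n_pos by (simp add: v_def cap_def flip: Q_def) (simp add: N_def power3_eq_cube field_simps)
  have e4: "1/2 * (cross_density K b * n) * (\<Sum>I\<in>\<I>. \<Sum>J\<in>\<I>. (sz I - sz J)\<^sup>2) / n^3
      = 1/2 * \<rho> * (\<Sum>I\<in>\<I>. \<Sum>J\<in>\<I>. (q I - q J)\<^sup>2)"
  proof -
    have "(q I - q J)\<^sup>2 = (sz I - sz J)\<^sup>2 / n\<^sup>2" for I J
      by (simp add: q_def power_divide flip: diff_divide_distrib)
    then have "(\<Sum>I\<in>\<I>. \<Sum>J\<in>\<I>. (q I - q J)\<^sup>2) = (\<Sum>I\<in>\<I>. \<Sum>J\<in>\<I>. (sz I - sz J)\<^sup>2) / n\<^sup>2"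
      by (simp add: sum_divide_distrib)
    then show ?thesis using n_pos by (simp add: \<rho>_def power2_eq_square power3_eq_cube)
  qed
  have 1: "S.total / n^3 \<le> (\<Sum>I\<in>\<I>. (q I)\<^sup>2 * (N - q I)) - (1/K - b) * (defect / n\<^sup>2)
    + v * (Q * (N - Q)) - 1/2 * \<rho> * (\<Sum>I\<in>\<I>. \<Sum>J\<in>\<I>. (q I - q J)\<^sup>2)"
    using 0 unfolding e1 e2 e3 e4 .
  have "(\<Sum>I\<in>\<I>. (q I)\<^sup>2 * (N - q I)) + v * (Q * (N - Q)) - 1/2 * \<rho> * (\<Sum>I\<in>\<I>. \<Sum>J\<in>\<I>. (q I - q J)\<^sup>2)
    \<le> (1 / K - 1 / K\<^sup>2) * N ^ 3 - gain K * (v + (\<Sum>I\<in>\<I>. (q I - N / K)\<^sup>2))"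
  proof (rule near_equal_parts_bound)
    show "real (card \<I>) = K" "K > 0" using card_parts K_def K_ge_3 by auto
    show "v = N - sum q \<I>" "0 \<le> v" by (fact v)+
    show "gain K \<le> \<rho> * K - (N - 3 * N / K - (q I - N / K))" if "I \<in> \<I>" for I
    proof -
      define r where "r = 1/K"
      have r: "3/K = 3 * r" "3 * N / K = 3 * (N * r)" "N / K = N * r" "0 \<le> r" "3 * r \<le> 1"
        using K_ge_3 by (simp_all add: r_def)
      have "N * (1 - 3 * r) \<le> 1 * (1 - 3 * r)" using N r by (intro mult_right_mono) auto
      moreover have "q I \<ge> r - b"
        using sz_bounds(1)[OF that] n_pos by (simp add: r_def q_def large_def field_simps)
      moreover have "N * r \<le> 1 * r" using N r by (intro mult_right_mono) auto
      moreover have "gain K < \<rho> * K - (1 - 3 * r) - b" using adm_b(11) unfolding \<rho>_def r .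
      ultimately show ?thesis unfolding r by (simp add: algebra_simps)
    qed
    have y: "0 \<le> 2/K - 3/K\<^sup>2" using K_ge_3 by (simp add: field_simps power2_eq_square)
    have b4: "b^4 \<le> 1" using adm_b(1,2) by (simp add: power_le_one)
    have "(1 - b^4)\<^sup>2 * (2/K - 3/K\<^sup>2) \<le> N\<^sup>2 * (2/K - 3/K\<^sup>2)"
      using y N b4 by (intro mult_right_mono power_mono) auto
    moreover have "Q * (N - Q) \<le> Q * (1 - Q)"
      using N K_ge_3 by (intro mult_left_mono) (auto simp: Q_def)
    moreover have "\<rho> * v \<le> \<rho> * cover_defect K b"
      using v adm_b(10) by (intro mult_left_mono) (auto simp: \<rho>_def)
    ultimately show "gain K \<le> N\<^sup>2 * (2 / K - 3 / K\<^sup>2) - Q * (N - Q) - \<rho> * v"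
      using adm_b(12) unfolding \<rho>_def Q_def by linarith
  qed
  then show ?thesis using 1 unfolding q_def by linarith
qed

text \<open>A vertex of a part has its part, its defect and possibly all of \<open>bad\<close> as
  nonneighbours; uncovered and bad vertices are bounded trivially by \<open>n\<close>.
  \<open>bad\<close> thus enters twice, which gives the factor 2.\<close>

lemma sum_nondeg_le:
  "(\<Sum>z\<in>V. nondeg z) \<le> (\<Sum>I\<in>\<I>. (sz I)\<^sup>2) + defect + (2 * real (card bad) + uncovered) * n"
proof -
  have le: "nondeg z \<le> S.nondeg z + real (card bad)" if "z \<in> V - bad" for z
  proof -
    have "nonadj z \<subseteq> S.nonadj z \<union> bad"
      unfolding nonadj_def S.nonadj_def adj_def S.adj_def R'_def by blast
    then have "card (nonadj z) \<le> card (S.nonadj z \<union> bad)"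
      using finite_bad by (intro card_mono) auto
    also have "\<dots> \<le> card (S.nonadj z) + card bad" by (rule card_Un_le)
    finally show ?thesis by (simp add: nondeg_def S.nondeg_def)
  qed
  have "(\<Sum>z\<in>V. nondeg z) = (\<Sum>z\<in>V - bad. nondeg z) + (\<Sum>z\<in>bad. nondeg z)"
    by (rule sum.subset_diff[OF bad_sub finite_V])
  also have "\<dots> = (\<Sum>I\<in>\<I>. \<Sum>z\<in>I. nondeg z) + (\<Sum>z\<in>V - bad - \<Union>\<I>. nondeg z) + (\<Sum>z\<in>bad. nondeg z)"
    by (simp add: sum_split)
  also have "\<dots> \<le> (\<Sum>I\<in>\<I>. \<Sum>z\<in>I. (S.nondeg z - sz I) + sz I + real (card bad))
      + uncovered * n + real (card bad) * n"
  proof (intro add_mono sum_mono)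
    show "nondeg z \<le> (S.nondeg z - sz I) + sz I + real (card bad)" if "I \<in> \<I>" "z \<in> I" for I z
      using le[of z] part_sub[OF that(1)] that(2) by auto
    show "(\<Sum>z\<in>V - bad - \<Union>\<I>. nondeg z) \<le> uncovered * n"
      unfolding card_rest[symmetric] by (intro sum_bounded_above nondeg_le)
    show "(\<Sum>z\<in>bad. nondeg z) \<le> real (card bad) * n"
      by (intro sum_bounded_above nondeg_le)
  qed
  also have "(\<Sum>I\<in>\<I>. \<Sum>z\<in>I. (S.nondeg z - sz I) + sz I + real (card bad))
      = defect + (\<Sum>I\<in>\<I>. (sz I)\<^sup>2) + (\<Sum>I\<in>\<I>. sz I) * real (card bad)"
  proof -
    have "(\<Sum>z\<in>I. (S.nondeg z - sz I) + sz I + real (card bad))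
        = (\<Sum>z\<in>I. S.nondeg z - sz I) + (sz I)\<^sup>2 + sz I * real (card bad)" for I
      unfolding sum.distrib by (simp add: sz_def power2_eq_square)
    then show ?thesis by (simp only: sum.distrib defect_def sum_distrib_right)
  qed
  also have "(\<Sum>I\<in>\<I>. sz I) * real (card bad) \<le> n * real (card bad)"
    using uncovered_nonneg order_S by (intro mult_right_mono) (auto simp: uncovered_def)
  finally show ?thesis by (simp add: algebra_simps)
qed

text \<open>The shortfall of the shadow is at most \<open>\<sigma> + D + 2 u + v\<close>, for
  imbalance, defect, bad and uncovered vertices, while the edge count drops by at least
  \<open>slope K b\<close> times each of these terms.\<close>

lemma total_bound:
  assumes b4: "b^4 \<le> b\<^sup>2 / K"
  shows "total / n^3 \<le> (1/K - 1/K\<^sup>2) - slope K b * ((\<Sum>z\<in>V. nondeg z) / n\<^sup>2 - 1/K)"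
proof -
  define y0 N v D u \<sigma> where "y0 = 1/K - 1/K\<^sup>2" and "N = S.order / n" and "v = uncovered / n"
    and "D = defect / n\<^sup>2" and "u = real (card bad) / n" and "\<sigma> = (\<Sum>I\<in>\<I>. (sz I / n - N / K)\<^sup>2)"
  define g where "g = slope K b"
  have nn: "v \<ge> 0" "D \<ge> 0" "u \<ge> 0" "\<sigma> \<ge> 0"
    using uncovered_nonneg defect_nonneg n_pos by (auto simp: v_def D_def u_def \<sigma>_def intro: sum_nonneg)
  have N: "N = 1 - u" using order_S n_pos by (simp add: N_def u_def diff_divide_distrib)
  have u: "u \<le> b^4" using card_bad n_pos by (simp add: u_def field_simps)
  have y0: "0 \<le> y0" "y0 \<le> 1" 
  proof -
    have "1/K \<le> 1" "0 \<le> 1/K\<^sup>2" using K_ge_3 by simp_all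
    then show "0 \<le> y0" "y0 \<le> 1" using y0_pos unfolding y0_def by linarith+
  qed
  \<comment> \<open>The deviations from \<open>N / K\<close> sum to \<open>- v\<close>, so the cross
    term is nonpositive, and \<open>N \<le> 1\<close> leaves \<open>1/K + \<sigma>\<close>.\<close>
  have sq: "(\<Sum>I\<in>\<I>. (sz I)\<^sup>2) / n\<^sup>2 \<le> 1/K + \<sigma>"
  proof -
    define s where "s I = sz I / n - N / K" for I
    have card: "real (card \<I>) = K" using card_parts K_def by simp
    have ss: "sum s \<I> = - v"
      using K_ge_3 by (simp add: s_def sum_subtractf card N_def v_def uncovered_def diff_divide_distrib sum_divide_distrib)
    have "(sz I)\<^sup>2 / n\<^sup>2 = N\<^sup>2 / K\<^sup>2 + 2 * (N / K) * s I + (s I)\<^sup>2" for I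
    proof -
      have "(sz I / n)\<^sup>2 = (N / K + s I)\<^sup>2" by (simp add: s_def)
      then show ?thesis by (simp add: power_divide power2_sum)
    qed
    then have "(\<Sum>I\<in>\<I>. (sz I)\<^sup>2) / n\<^sup>2 = K * (N\<^sup>2 / K\<^sup>2) + 2 * (N / K) * sum s \<I> + (\<Sum>I\<in>\<I>. (s I)\<^sup>2)"
      by (simp add: sum_divide_distrib sum.distrib sum_distrib_left card)
    also have "\<dots> = N\<^sup>2 / K - 2 * (N / K) * v + \<sigma>"
      using K_ge_3 unfolding ss by (simp add: \<sigma>_def s_def power2_eq_square)
    also have "\<dots> \<le> 1 / K + \<sigma>"
    proof -
      have "0 \<le> N" by (simp add: N_def)
      moreover have "N \<le> 1" using N nn(3) by simp
      ultimately have N01: "0 \<le> N" "N \<le> 1" .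
      then have "N\<^sup>2 / K \<le> 1 / K" using K_ge_3 by (intro divide_right_mono power_le_one) auto
      moreover have "0 \<le> 2 * (N / K) * v" using N01 nn K_ge_3 by simp
      ultimately show ?thesis by linarith
    qed
    finally show ?thesis .
  qed
  have "(\<Sum>z\<in>V. nondeg z) / n\<^sup>2
      \<le> ((\<Sum>I\<in>\<I>. (sz I)\<^sup>2) + defect + (2 * real (card bad) + uncovered) * n) / n\<^sup>2"
    using sum_nondeg_le by (intro divide_right_mono) auto
  also have "\<dots> = (\<Sum>I\<in>\<I>. (sz I)\<^sup>2) / n\<^sup>2 + D + 2 * u + v"
    using n_pos by (simp add: D_def u_def v_def add_divide_distrib power2_eq_square)
  finally have eta: "(\<Sum>z\<in>V. nondeg z) / n\<^sup>2 - 1/K \<le> \<sigma> + D + 2 * u + v" using sq by simp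
  have g: "g \<le> gain K" "g \<le> 1/K - b" "2 * g \<le> 3 * (b\<^sup>2 / K - b^4)" "0 \<le> g"
  proof -
    show "g \<le> gain K" "g \<le> 1/K - b" by (simp_all add: g_def slope_def)
    have "g \<le> 3/2 * (b\<^sup>2 / K - b^4)"
      unfolding g_def slope_def by (rule min.coboundedI2[OF min.cobounded2])
    then show "2 * g \<le> 3 * (b\<^sup>2 / K - b^4)" by linarith
    have "0 \<le> gain K" using K_ge_3 by (simp add: gain_def field_simps power2_eq_square)
    then show "0 \<le> g" using adm_b(3) b4 by (simp add: g_def slope_def)
  qed
  have "total / n^3 \<le> (S.total + 3 * (real (card bad) * (cap * (n - spread)))) / n^3"
    using total_le_S_cap n_pos by (intro divide_right_mono) auto
  moreover have "(S.total + 3 * (real (card bad) * (cap * (n - spread)))) / n^3 = S.total / n^3 + 3 * u * (y0 - b\<^sup>2 / K - K * b^4)"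
  proof -
    have kb: "1/K * (K * b\<^sup>2) = b\<^sup>2" "b\<^sup>2 * (K * b\<^sup>2) = K * b^4" using K_ge_3 by (simp_all flip: power_add)
    have "(1/K + b\<^sup>2) * (1 - (1/K + K * b\<^sup>2))
        = 1/K - 1/K * (1/K) - 1/K * (K * b\<^sup>2) + b\<^sup>2 - b\<^sup>2 * (1/K) - b\<^sup>2 * (K * b\<^sup>2)"
      by (simp only: algebra_simps)
    also have "\<dots> = y0 - b\<^sup>2 / K - K * b^4"
      unfolding kb by (simp add: y0_def power2_eq_square)
    finally have e: "(1/K + b\<^sup>2) * (1 - (1/K + K * b\<^sup>2)) = y0 - b\<^sup>2 / K - K * b^4" .
    have "cap * (n - spread) = ((1/K + b\<^sup>2) * (1 - (1/K + K * b\<^sup>2))) * n\<^sup>2"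
      unfolding cap_def spread_def by (simp only: algebra_simps power2_eq_square)
    then have "cap * (n - spread) = (y0 - b\<^sup>2 / K - K * b^4) * n\<^sup>2"
      unfolding e .
    then have "3 * (real (card bad) * (cap * (n - spread))) / n^3
        = 3 * u * (y0 - b\<^sup>2 / K - K * b^4)"
      using n_pos by (simp add: u_def power2_eq_square power3_eq_cube)
    then show ?thesis by (simp only: add_divide_distrib)
  qed
  moreover have "S.total / n^3 \<le> y0 * N^3 - gain K * (v + \<sigma>) - (1/K - b) * D"
    using S_total_normalized by (simp add: N_def v_def \<sigma>_def D_def y0_def)
  ultimately have 1: "total / n^3 \<le> y0 * N^3 - gain K * (v + \<sigma>) - (1/K - b) * D + 3 * u * (y0 - b\<^sup>2 / K - K * b^4)"
    by linarith
  \<comment> \<open>The \<open>-3 u y0\<close> from shrinking the order cancels the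
    \<open>+3 u y0\<close> from the degrees of the deleted vertices. What remains is
    \<open>-3 u (b^2/K - b^4)\<close> and a further nonpositive term.\<close>
  have "N^3 \<le> 1 - 3 * u + 3 * u\<^sup>2"
    unfolding N using nn(3) by (simp add: power3_eq_cube power2_eq_square algebra_simps)
  then have "y0 * N^3 \<le> y0 * (1 - 3 * u + 3 * u\<^sup>2)" using y0 by (intro mult_left_mono)
  also have "\<dots> \<le> y0 - 3 * u * y0 + 3 * u * b^4"
  proof -
    have "u * (u * y0) \<le> u * (b^4 * 1)" using nn u y0 by (intro mult_left_mono mult_mono) auto
    then show ?thesis by (simp add: algebra_simps power2_eq_square)
  qed
  finally have 2: "y0 * N^3 \<le> y0 - 3 * u * y0 + 3 * u * b^4" .
  have 3: "0 \<le> 3 * u * (K * b^4)" using nn K_ge_3 adm_b(1) by simp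
  have 4: "g * (v + \<sigma>) \<le> gain K * (v + \<sigma>)" "g * D \<le> (1/K - b) * D" "2 * g * u \<le> 3 * (b\<^sup>2 / K - b^4) * u"
    using g nn by (auto intro!: mult_right_mono)
  have "g * ((\<Sum>z\<in>V. nondeg z) / n\<^sup>2 - 1/K) \<le> g * (\<sigma> + D + 2 * u + v)"
    using eta g by (intro mult_left_mono)
  then have "total / n^3 \<le> y0 - g * ((\<Sum>z\<in>V. nondeg z) / n\<^sup>2 - 1/K)"
    using 1 2 3 4 by (simp add: algebra_simps)
  then show ?thesis unfolding y0_def g_def .
qed

end

lemma (in near_extremal) parts_exist: "\<exists>\<I>. near_extremal_parts V R K b k \<I>"
proof (rule disjoint_representatives[OF finite_larges larges_nonempty])
  show "A \<inter> C \<noteq> {}"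
    if "A \<in> larges" "B \<in> larges" "C \<in> larges" "A \<inter> B \<noteq> {}" "B \<inter> C \<noteq> {}" for A B C
    using that by (rule larges_transitive)
  fix \<I>
  assume "\<I> \<subseteq> larges"
    and "\<And>I J. I \<in> \<I> \<Longrightarrow> J \<in> \<I> \<Longrightarrow> I \<noteq> J \<Longrightarrow> I \<inter> J = {}"
    and "\<And>A. A \<in> larges \<Longrightarrow> \<exists>I\<in>\<I>. A \<inter> I \<noteq> {}"
    and "\<And>A I. A \<in> larges \<Longrightarrow> I \<in> \<I> \<Longrightarrow> A \<inter> I \<noteq> {} \<Longrightarrow> card A \<le> card I"
  then have "near_extremal_parts V R K b k \<I>" by unfold_locales
  then show ?thesis by blast
qed

lemma admissible_slope_pos:
  assumes "K \<ge> 3" "admissible K b"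
  shows "b^4 < b\<^sup>2 / K" "slope K b > 0"
proof -
  have b: "0 < b" "b < 1/K" "b\<^sup>2 < 1/K" using assms unfolding admissible_def by blast+
  have "b\<^sup>2 * b\<^sup>2 < b\<^sup>2 * (1/K)" using b by (intro mult_strict_left_mono) auto
  then show *: "b^4 < b\<^sup>2 / K" by (simp flip: power_add)
  have "gain K > 0" using assms(1) by (simp add: gain_def field_simps power2_eq_square)
  then show "slope K b > 0" using b * unfolding slope_def by simp
qed

theorem near_extremal_total_bound:
  fixes k :: nat
  assumes k: "k \<ge> 3"
  obtains c \<gamma> :: real where "c > 0" "\<gamma> > 0"
    and "\<And>V (R :: 'a \<Rightarrow> 'a \<Rightarrow> 'a \<Rightarrow> bool). cancellative_relation V R \<Longrightarrow> V \<noteq> {} \<Longrightarrow>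
      1 / real k \<le> (\<Sum>z\<in>V. cancellative_relation.nondeg V R z) / (real (card V))\<^sup>2 \<Longrightarrow>
      (\<Sum>z\<in>V. cancellative_relation.nondeg V R z) / (real (card V))\<^sup>2 \<le> 1 / real k + c \<Longrightarrow>
      cancellative_relation.total V R / real (card V) ^ 3 \<le> (1 / real k - 1 / (real k)\<^sup>2)
        - \<gamma> * ((\<Sum>z\<in>V. cancellative_relation.nondeg V R z) / (real (card V))\<^sup>2 - 1 / real k)"
proof -
  define K where "K = real k"
  have K: "K \<ge> 3" using k by (simp add: K_def)
  obtain b where adm: "admissible K b" using admissible_exists[OF K] by blast
  note sl = admissible_slope_pos[OF K adm]
  have b0: "0 < b" using adm unfolding admissible_def by blast
  show ?thesis
  \<comment> \<open>If \<open>total\<close> misses the extremal value by more than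
    \<open>b^8\<close>, any slope up to 1 works, because the shadow window has width
    \<open>b^8\<close>; hence the minimum with 1.\<close>
  proof (rule that[of "b^8" "min 1 (slope K b)"])
    show "b^8 > 0" "min 1 (slope K b) > 0" using sl b0 by auto
    fix V and R :: "'a \<Rightarrow> 'a \<Rightarrow> 'a \<Rightarrow> bool"
    assume cr: "cancellative_relation V R" and ne: "V \<noteq> {}"
    interpret cancellative_relation V R by (fact cr)
    let ?S = "(\<Sum>z\<in>V. nondeg z)"
    assume lower: "1 / real k \<le> ?S / order\<^sup>2" and upper: "?S / order\<^sup>2 \<le> 1 / real k + b^8"
    have n: "order > 0" using ne finite_V by (simp add: card_gt_0_iff)
    have mono: "min 1 (slope K b) * (?S / order\<^sup>2 - 1/K) \<le> t * (?S / order\<^sup>2 - 1/K)"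
      if "min 1 (slope K b) \<le> t" for t
      using that lower by (intro mult_right_mono) (auto simp: K_def)
    show "total / order ^ 3 \<le> (1 / real k - 1 / (real k)\<^sup>2) - min 1 (slope K b) * (?S / order\<^sup>2 - 1 / real k)"
    proof (cases "(1/K - 1/K\<^sup>2 - b^8) * order ^ 3 \<le> total")
      case True
      interpret near_extremal V R K b k
      proof
        show "K = real k" "k \<ge> 3" "admissible K b" "V \<noteq> {}" by (fact K_def k adm ne)+
        show "1/K * order\<^sup>2 \<le> ?S" "?S \<le> (1/K + b^8) * order\<^sup>2"
          using lower upper n by (simp_all add: K_def pos_le_divide_eq pos_divide_le_eq)
        show "(1/K - 1/K\<^sup>2 - b^8) * order ^ 3 \<le> total" by (fact True)
      qed
      obtain \<I> where "near_extremal_parts V R K b k \<I>" using parts_exist by blast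
      then interpret near_extremal_parts V R K b k \<I> .
      show ?thesis 
        using total_bound[OF less_imp_le[OF sl(1)]] mono[of "slope K b"] unfolding K_def by simp
    next
      case False
      then have "total / order ^ 3 \<le> 1/K - 1/K\<^sup>2 - b^8" using n by (simp add: pos_divide_le_eq)
      then show ?thesis using mono[of 1] upper by (simp add: K_def)
    qed
  qed
qed

section \<open>Steiner triple systems\<close>

text \<open>A Steiner triple system is encoded by the map sending two distinct points to the third point of
  their block; the values \<open>t a a\<close> are irrelevant.\<close>

definition steiner :: "'p set \<Rightarrow> ('p \<Rightarrow> 'p \<Rightarrow> 'p) \<Rightarrow> bool" where
  "steiner P t \<longleftrightarrow> (\<forall>a\<in>P. \<forall>b\<in>P. a \<noteq> b \<longrightarrow>
     t a b \<in> P \<and> t a b \<noteq> a \<and> t b a = t a b \<and> t a (t a b) = b)"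

lemma steiner_transport:
  assumes st: "steiner P t" and f: "bij_betw f P P'"
  shows "steiner P' (\<lambda>a b. f (t (inv_into P f a) (inv_into P f b)))"
  unfolding steiner_def
proof (intro ballI impI)
  define g where "g = inv_into P f"
  have g: "g a \<in> P" "f (g a) = a" if "a \<in> P'" for a
    using that f unfolding g_def by (auto simp: bij_betw_def inv_into_into f_inv_into_f)
  have gf: "g (f p) = p" if "p \<in> P" for p
    using that f unfolding g_def by (auto simp: bij_betw_def)
  fix a b assume ab: "a \<in> P'" "b \<in> P'" "a \<noteq> b"
  have ne: "g a \<noteq> g b" using g(2)[OF ab(1)] g(2)[OF ab(2)] ab(3) by metis
  have s: "t (g a) (g b) \<in> P" "t (g a) (g b) \<noteq> g a" "t (g b) (g a) = t (g a) (g b)"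
    "t (g a) (t (g a) (g b)) = g b"
    using st g(1)[OF ab(1)] g(1)[OF ab(2)] ne unfolding steiner_def by blast+
  have "f (t (g a) (g b)) \<in> P'" using f s(1) by (auto simp: bij_betw_def)
  moreover have "f (t (g a) (g b)) \<noteq> a" using gf[OF s(1)] s(2) by metis
  ultimately show "f (t (inv_into P f a) (inv_into P f b)) \<in> P' \<and>
    f (t (inv_into P f a) (inv_into P f b)) \<noteq> a \<and>
    f (t (inv_into P f b) (inv_into P f a)) = f (t (inv_into P f a) (inv_into P f b)) \<and>
    f (t (inv_into P f a) (inv_into P f (f (t (inv_into P f a) (inv_into P f b))))) = b"
    using gf[OF s(1)] s g(2)[OF ab(2)] by (simp flip: g_def)
qed

text \<open>One set of axioms for both constructions: with \<open>pointed\<close> false the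
  commutative quasigroup is idempotent (Bose); with \<open>pointed\<close> true squares are
  idempotent, and \<open>root x\<close> is the only square root of an idempotent \<open>x\<close>
  other than \<open>x\<close> itself (Skolem).\<close>

locale half_idempotent_quasigroup =
  fixes Q :: "'q set" and op :: "'q \<Rightarrow> 'q \<Rightarrow> 'q" and ldiv :: "'q \<Rightarrow> 'q \<Rightarrow> 'q"
    and root :: "'q \<Rightarrow> 'q" and pointed :: bool
  assumes op_in: "x \<in> Q \<Longrightarrow> y \<in> Q \<Longrightarrow> op x y \<in> Q"
    and op_commute: "x \<in> Q \<Longrightarrow> y \<in> Q \<Longrightarrow> op x y = op y x"
    and ldiv_in: "x \<in> Q \<Longrightarrow> y \<in> Q \<Longrightarrow> ldiv x y \<in> Q"
    and op_ldiv: "x \<in> Q \<Longrightarrow> y \<in> Q \<Longrightarrow> op x (ldiv x y) = y"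
    and ldiv_op: "x \<in> Q \<Longrightarrow> y \<in> Q \<Longrightarrow> ldiv x (op x y) = y"
    and idempotent: "x \<in> Q \<Longrightarrow> \<not> pointed \<Longrightarrow> op x x = x"
    and root: "x \<in> Q \<Longrightarrow> pointed \<Longrightarrow> op x x = x \<Longrightarrow>
      root x \<in> Q \<and> root x \<noteq> x \<and> op (root x) (root x) = x"
    and root_square: "x \<in> Q \<Longrightarrow> pointed \<Longrightarrow> op x x \<noteq> x \<Longrightarrow>
      op (op x x) (op x x) = op x x \<and> root (op x x) = x"
begin

definition points :: "('q \<times> nat) option set" where
  "points = Some ` (Q \<times> {0, 1, 2}) \<union> (if pointed then {None} else {})"

text \<open>The point completing \<open>(x,i)\<close> and \<open>(y,i+1)\<close>. The solution of
  \<open>op x z = y\<close> gives a block with \<open>(z,i)\<close> unless \<open>z = x\<close>;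
  then \<open>y\<close> is the square of \<open>x\<close>, and the block is either the vertical one
  over an idempotent or one through infinity.\<close>

definition up :: "'q \<Rightarrow> nat \<Rightarrow> 'q \<Rightarrow> ('q \<times> nat) option" where
  "up x i y = (if ldiv x y \<noteq> x then Some (ldiv x y, i)
     else if y = x then Some (x, (i + 2) mod 3) else None)"

text \<open>The point completing infinity and \<open>(x,i)\<close>. An idempotent \<open>x\<close>
  can occur in such a block only as the square of its root one level below;
  \<open>(i + 2) mod 3\<close> is that level.\<close>

definition pole :: "'q \<Rightarrow> nat \<Rightarrow> ('q \<times> nat) option" where
  "pole x i = (if op x x = x then Some (root x, (i + 2) mod 3) else Some (op x x, (i + 1) mod 3))"

text \<open>The blocks of the Bose and Skolem constructions: \<open>(x,i), (y,i), (x\<circ>y,i+1)\<close> for \<open>x \<noteq> y\<close>;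
  \<open>(x,0), (x,1), (x,2)\<close> for idempotent \<open>x\<close>; and \<open>\<infinity>, (x,i), (x\<circ>x,i+1)\<close> for the other \<open>x\<close>, with
  \<open>None\<close> in the role of \<open>\<infinity>\<close>.\<close>

fun third :: "('q \<times> nat) option \<Rightarrow> ('q \<times> nat) option \<Rightarrow> ('q \<times> nat) option" where
  "third (Some (x, i)) (Some (y, j)) =
     (if i = j then Some (op x y, (i + 1) mod 3)
      else if j = (i + 1) mod 3 then up x i y else up y j x)"
| "third (Some (x, i)) None = pole x i"
| "third None (Some (x, i)) = pole x i"
| "third None None = None"

lemma Some_in_points: "z \<in> Q \<Longrightarrow> j \<in> {0, 1, 2} \<Longrightarrow> Some (z, j) \<in> points"
  unfolding points_def by blast

lemma op_eqD: "x \<in> Q \<Longrightarrow> z \<in> Q \<Longrightarrow> op x z = y \<Longrightarrow> ldiv x y = z"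
  using ldiv_op by auto

lemma levels: "i \<in> {0, 1, 2::nat} \<Longrightarrow> j \<in> {0, 1, 2} \<Longrightarrow> i = j \<or> j = (i + 1) mod 3 \<or> i = (j + 1) mod 3"
  by auto

lemma third_up:
  assumes "x \<in> Q" "y \<in> Q" "i \<in> {0, 1, 2}"
  shows "third (Some (x, i)) (Some (y, (i + 1) mod 3)) = up x i y"
    "third (Some (y, (i + 1) mod 3)) (Some (x, i)) = up x i y"
  using assms by auto

lemma up_in:
  assumes "x \<in> Q" "y \<in> Q" "i \<in> {0, 1, 2}"
  shows "up x i y \<in> points"
proof -
  have "pointed" if "ldiv x y = x" "y \<noteq> x"
    using op_ldiv[OF assms(1,2)] idempotent[OF assms(1)] that by auto
  then show ?thesis
    using assms ldiv_in[OF assms(1,2)] by (auto simp: up_def points_def)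
qed

lemma third_third_up:
  assumes x: "x \<in> Q" and y: "y \<in> Q" and i: "i \<in> {0, 1, 2}"
  shows "third (Some (x, i)) (up x i y) = Some (y, (i + 1) mod 3)"
    and "third (Some (y, (i + 1) mod 3)) (up x i y) = Some (x, i)"
proof -
  have sq: "op x (ldiv x y) = y" using op_ldiv[OF x y] .
  have z: "ldiv x y \<in> Q" using ldiv_in[OF x y] .
  \<comment> \<open>The cases are the three kinds of blocks: two points on one level, vertical, and
    through infinity.\<close>
  consider (1) "ldiv x y \<noteq> x" | (2) "ldiv x y = x" "y = x" | (3) "ldiv x y = x" "y \<noteq> x" by blast
  then have "third (Some (x, i)) (up x i y) = Some (y, (i + 1) mod 3)
    \<and> third (Some (y, (i + 1) mod 3)) (up x i y) = Some (x, i)"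
  proof cases
    case 1
    have "op (ldiv x y) x = y" using op_commute[OF z x] sq by (rule trans)
    then have "ldiv (ldiv x y) y = x" by (rule op_eqD[OF z x])
    then have A: "up (ldiv x y) i y = Some (x, i)" using not_sym[OF 1] unfolding up_def by simp
    have B: "up x i y = Some (ldiv x y, i)" using 1 by (simp add: up_def)
    have C: "third (Some (x, i)) (Some (ldiv x y, i)) = Some (y, (i + 1) mod 3)"
      using sq by simp
    show ?thesis unfolding B third_up(2)[OF z y i] by (rule conjI[OF C A])
  next
    case 2
    then have up: "up x j x = Some (x, (j + 2) mod 3)" for j unfolding up_def by simp
    have lv: "(i + 2) mod 3 \<in> {0, 1, 2}" "(i + 1) mod 3 \<in> {0, 1, 2}" by auto
    have m: "((i + 2) mod 3 + 1) mod 3 = i" "((i + 1) mod 3 + 1) mod 3 = (i + 2) mod 3"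
      "((i + 2) mod 3 + 2) mod 3 = (i + 1) mod 3" "((i + 1) mod 3 + 2) mod 3 = i" using i by auto
    have "third (Some (x, i)) (Some (x, (i + 2) mod 3)) = Some (x, (i + 1) mod 3)"
      using third_up(2)[OF x x lv(1)] unfolding m up .
    moreover have "third (Some (x, (i + 1) mod 3)) (Some (x, (i + 2) mod 3)) = Some (x, i)"
      using third_up(1)[OF x x lv(2)] unfolding m up .
    ultimately have "third (Some (x, i)) (Some (x, (i + 2) mod 3)) = Some (x, (i + 1) mod 3) \<and>
      third (Some (x, (i + 1) mod 3)) (Some (x, (i + 2) mod 3)) = Some (x, i)" ..
    then show ?thesis unfolding 2(2) up .
  next
    case 3
    then have sqx: "op x x = y" using sq by simp
    have p: pointed using idempotent[OF x] unfolding sqx using 3(2) by blast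
    have r: "op y y = y" "root y = x" using root_square[OF x p] 3(2) unfolding sqx by blast+
    have "up x i y = None" using 3 by (simp add: up_def)
    moreover have "((i + 1) mod 3 + 2) mod 3 = i" using i by auto
    moreover have "pole x i = Some (y, (i + 1) mod 3)" unfolding pole_def sqx using 3(2) by simp
    moreover have "pole y ((i + 1) mod 3) = Some (x, ((i + 1) mod 3 + 2) mod 3)"
      unfolding pole_def r using r(1) by simp
    ultimately show ?thesis by (simp only: third.simps)
  qed
  then show "third (Some (x, i)) (up x i y) = Some (y, (i + 1) mod 3)"
    and "third (Some (y, (i + 1) mod 3)) (up x i y) = Some (x, i)" by auto
qed

lemma third_flat:
  assumes "x \<in> Q" "y \<in> Q" "i \<in> {0, 1, 2}" "x \<noteq> y"
  shows "third (Some (x, i)) (Some (op x y, (i + 1) mod 3)) = Some (y, i)"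
proof -
  have "third (Some (x, i)) (Some (op x y, (i + 1) mod 3)) = up x i (op x y)"
    by (rule third_up(1)[OF assms(1) op_in[OF assms(1,2)] assms(3)])
  then show ?thesis using ldiv_op[OF assms(1,2)] assms(4) by (simp add: up_def)
qed

lemma pole_in:
  assumes "x \<in> Q" "i \<in> {0, 1, 2}" "pointed"
  shows "pole x i \<in> points"
proof -
  have "(i + 2) mod 3 \<in> {0, 1, 2}" "(i + 1) mod 3 \<in> {0, 1, 2}" by auto
  then show ?thesis
    unfolding pole_def using root[OF assms(1,3)] op_in[OF assms(1,1)] Some_in_points by simp
qed

lemma third_pole:
  assumes x: "x \<in> Q" and i: "i \<in> {0, 1, 2}" and p: "pointed"
  shows "third (Some (x, i)) (pole x i) = None" "third None (pole x i) = Some (x, i)"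
proof -
  have "third (Some (x, i)) (pole x i) = None \<and> third None (pole x i) = Some (x, i)"
  proof (cases "op x x = x")
    case True
    note r = root[OF x p True]
    have l: "ldiv (root x) x = root x" using op_eqD r by blast
    have j: "(i + 2) mod 3 \<in> {0, 1, 2}" "i = ((i + 2) mod 3 + 1) mod 3" using i by auto
    have "third (Some (x, i)) (Some (root x, (i + 2) mod 3)) = up (root x) ((i + 2) mod 3) x"
      using third_up(2)[OF _ x j(1), of "root x"] r unfolding j(2)[symmetric] by blast
    moreover have "third None (Some (root x, (i + 2) mod 3)) = Some (x, ((i + 2) mod 3 + 1) mod 3)"
      using r not_sym[of "root x" x] by (simp add: pole_def)
    moreover have "x \<noteq> root x" using r by metis
    ultimately show ?thesis using True r l unfolding j(2)[symmetric] by (simp add: pole_def up_def)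
  next
    case False
    note r = root_square[OF x p False]
    have l: "ldiv x (op x x) = x" using ldiv_op[OF x x] .
    have "((i + 1) mod 3 + 2) mod 3 = i" using i by auto
    moreover have "third (Some (x, i)) (Some (op x x, (i + 1) mod 3)) = up x i (op x x)"
      by (rule third_up(1)[OF x op_in[OF x x] i])
    ultimately show ?thesis using False r l by (simp add: pole_def up_def)
  qed
  then show "third (Some (x, i)) (pole x i) = None" "third None (pole x i) = Some (x, i)" by auto
qed

lemma third_commute:
  assumes "a \<in> points" "b \<in> points" "a \<noteq> b"
  shows "third b a = third a b"
proof -
  have flat: "third (Some (y, j)) (Some (x, i)) = third (Some (x, i)) (Some (y, j))"
    if "x \<in> Q" "y \<in> Q" "i \<in> {0, 1, 2}" "j \<in> {0, 1, 2}" for x y i j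
    using levels[OF that(3,4)]
  proof (elim disjE)
    assume "i = j"
    then show ?thesis using op_commute[OF that(1,2)] by simp
  next
    assume j: "j = (i + 1) mod 3"
    show ?thesis unfolding j third_up[OF that(1,2,3)] ..
  next
    assume i: "i = (j + 1) mod 3"
    show ?thesis unfolding i third_up[OF that(2,1,4)] ..
  qed
  show ?thesis
  proof (cases a)
    case None
    then show ?thesis by (cases b) auto
  next
    case (Some a')
    then obtain x i where a: "a = Some (x, i)" "x \<in> Q" "i \<in> {0, 1, 2}"
      using assms(1) unfolding points_def by (auto split: if_splits)
    show ?thesis
    proof (cases b)
      case None
      then show ?thesis using a by simp
    next
      case (Some b')
      then obtain y j where b: "b = Some (y, j)" "y \<in> Q" "j \<in> {0, 1, 2}"
        using assms(2) unfolding points_def by (auto split: if_splits)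
      show ?thesis unfolding a(1) b(1) by (rule flat[OF a(2) b(2) a(3) b(3)])
    qed
  qed
qed

lemma third_in_third:
  assumes "a \<in> points" "b \<in> points" "a \<noteq> b"
  shows "third a b \<in> points \<and> third a (third a b) = b"
proof (cases a)
  case None
  then obtain y j where b: "b = Some (y, j)" "y \<in> Q" "j \<in> {0, 1, 2}" and p: "pointed"
    using assms by (auto simp: points_def split: if_splits)
  show ?thesis using third_pole[OF b(2,3) p] pole_in[OF b(2,3) p] None b(1) by simp
next
  case (Some a')
  then obtain x i where a: "a = Some (x, i)" "x \<in> Q" "i \<in> {0, 1, 2}"
    using assms by (auto simp: points_def split: if_splits)
  show ?thesis
  proof (cases b)
    case None
    then have p: "pointed" using assms by (auto simp: points_def split: if_splits)
    show ?thesis using third_pole[OF a(2,3) p] pole_in[OF a(2,3) p] None a(1) by simp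
  next
    case (Some b')
    then obtain y j where b: "b = Some (y, j)" "y \<in> Q" "j \<in> {0, 1, 2}"
      using assms by (auto simp: points_def split: if_splits)
    from levels[OF a(3) b(3)] show ?thesis
    proof (elim disjE)
      assume ij: "i = j"
      have "Some (op x y, (i + 1) mod 3) \<in> points"
        using op_in[OF a(2) b(2)] by (intro Some_in_points) auto
      moreover have "x \<noteq> y" using assms(3) a b ij by simp
      ultimately show ?thesis using third_flat[OF a(2) b(2) a(3)] a(1) b(1) ij by simp
    next
      assume j: "j = (i + 1) mod 3"
      show ?thesis
        using third_up(1)[OF a(2) b(2) a(3)] up_in[OF a(2) b(2) a(3)] third_third_up(1)[OF a(2) b(2) a(3)]
          a(1) b(1) j by simp
    next
      assume i: "i = (j + 1) mod 3"
      show ?thesis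
        using third_up(2)[OF b(2) a(2) b(3)] up_in[OF b(2) a(2) b(3)] third_third_up(2)[OF b(2) a(2) b(3)]
          a(1) b(1) i by simp
    qed
  qed
qed

text \<open>If \<open>third a b = a\<close>, then \<open>third_in_third\<close> gives
  \<open>third a a = b\<close>. The diagonal value of \<open>third\<close> identifies
  \<open>b\<close> as the square of \<open>a\<close> one level up, and completing that pair yields a
  lower level or infinity, never \<open>a\<close>.\<close>

lemma third_neq:
  assumes "a \<in> points" "b \<in> points" "a \<noteq> b"
  shows "third a b \<noteq> a"
proof
  assume eq: "third a b = a"
  have "third a a \<noteq> b" if "a = Some (x, i)" "x \<in> Q" "i \<in> {0, 1, 2}" for x i
  proof
    assume "third a a = b"
    then have b: "b = Some (op x x, (i + 1) mod 3)" using that by simp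
    have "third a b = up x i (op x x)"
      unfolding b that(1) by (rule third_up(1)[OF that(2) op_in[OF that(2,2)] that(3)])
    moreover have "(i + 2) mod 3 \<noteq> i" by presburger
    ultimately show False
      using eq ldiv_op[OF that(2,2)] that(1) unfolding up_def by (simp split: if_splits)
  qed
  moreover have "third a a = b" using third_in_third[OF assms] eq by simp
  ultimately show False using assms by (auto simp: points_def split: if_splits)
qed

lemma steiner_third: "steiner points third"
  unfolding steiner_def using third_commute third_in_third third_neq by blast

lemma card_points:
  assumes "finite Q"
  shows "finite points" "card points = 3 * card Q + (if pointed then 1 else 0)"
proof -
  have "card (Some ` (Q \<times> {0, 1, 2::nat})) = 3 * card Q"
    by (subst card_image) (auto simp: card_cartesian_product)
  then show "finite points" "card points = 3 * card Q + (if pointed then 1 else 0)"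
    using assms by (auto simp: points_def card_insert_if)
qed

end

text \<open>Addition modulo \<open>n\<close> relabelled by a permutation \<open>half\<close> with
  inverse \<open>double\<close>. For odd \<open>n\<close>, \<open>half\<close> is division by 2
  modulo \<open>n\<close>, so every element is idempotent. For even \<open>n\<close> it sends even
  residues to the lower half and odd ones to the upper half, so \<open>x\<close> and
  \<open>x + h\<close> both square to \<open>x\<close> for \<open>x < h\<close>.\<close>

lemma bose_skolem_quasigroup:
  fixes n :: nat
  assumes n: "n > 0"
  defines "h \<equiv> (n + 1) div 2"
  defines "half \<equiv> \<lambda>c. if even c then c div 2 else c div 2 + h"
    and "double \<equiv> \<lambda>y. if y < h then 2 * y else 2 * (y - h) + 1"
  shows "half_idempotent_quasigroup {..<n} (\<lambda>x y. half ((x + y) mod n))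
    (\<lambda>x y. (double y + (n - x)) mod n) (\<lambda>x. x + h) (even n)"
proof -
  have half_lt: "half c < n" if "c < n" for c
  proof (cases "even c")
    case False
    then obtain a where "c = 2 * a + 1" by (rule oddE)
    then show ?thesis using that unfolding half_def h_def by simp
  qed (use that in \<open>simp add: half_def\<close>)
  have double_lt: "double y < n" if "y < n" for y
    using that unfolding double_def h_def by auto
  have half_double: "half (double y) = y" for y
    unfolding double_def half_def by auto
  have double_half: "double (half c) = c" if "c < n" for c
  proof (cases "even c")
    case True
    then obtain a where "c = 2 * a" by (rule evenE)
    then show ?thesis using that unfolding double_def half_def h_def by simp
  next
    case False
    then obtain a where "c = 2 * a + 1" by (rule oddE)
    then show ?thesis using that unfolding double_def half_def h_def by simp
  qed
  have sq_small: "half ((x + x) mod n) = x" if "x < h" for x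
    using that n unfolding half_def h_def by auto
  have sq_large: "(x + x) mod n = 2 * x - n" if "h \<le> x" "x < n" for x
  proof -
    have "x + x = n + (2 * x - n)" "2 * x - n < n" using that unfolding h_def by auto
    then show ?thesis by (metis mod_add_self1 mod_less)
  qed
  show ?thesis
  proof
    fix x y assume xy: "x \<in> {..<n}" "y \<in> {..<n}"
    show "half ((x + y) mod n) \<in> {..<n}" using half_lt n by simp
    show "half ((x + y) mod n) = half ((y + x) mod n)" by (simp add: add.commute)
    show "(double y + (n - x)) mod n \<in> {..<n}" using n by simp
    have "(x + (double y + (n - x)) mod n) mod n = (x + (double y + (n - x))) mod n"
      by (rule mod_add_right_eq)
    also have "x + (double y + (n - x)) = double y + n" using xy by simp
    finally show "half ((x + (double y + (n - x)) mod n) mod n) = y"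
      using double_lt xy half_double by simp
    have "((x + y) mod n + (n - x)) mod n = (x + y + (n - x)) mod n"
      by (rule mod_add_left_eq)
    also have "x + y + (n - x) = y + n" using xy by simp
    finally show "(double (half ((x + y) mod n)) + (n - x)) mod n = y"
      using double_half n xy by simp
  next
    fix x assume x: "x \<in> {..<n}" and "odd n"
    then obtain m where m: "n = 2 * m + 1" by (auto elim: oddE)
    show "half ((x + x) mod n) = x"
    proof (cases "x < h")
      case False
      then have "2 * x - n = 2 * (x - h) + 1" "h \<le> x" using m by (auto simp: h_def)
      then show ?thesis using sq_large[of x] x False by (simp add: half_def)
    qed (rule sq_small)
  next
    fix x assume x: "x \<in> {..<n}" and ev: "even n"
    then obtain m where m: "n = 2 * m" by (auto elim: evenE)
    have h: "h = m" using m by (simp add: h_def)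
    have sq: "half ((x + x) mod n) = x - m" if "m \<le> x" "x < n" for x
      using sq_large[of x] that h m by (simp add: half_def)
    show "x + h \<in> {..<n} \<and> x + h \<noteq> x \<and> half ((x + h + (x + h)) mod n) = x"
      if "half ((x + x) mod n) = x"
    proof -
      have "x < m" using sq[of x] that x m n by (cases "x < m") auto
      then show ?thesis using sq[of "x + m"] m n h by simp
    qed
    show "half ((half ((x + x) mod n) + half ((x + x) mod n)) mod n) = half ((x + x) mod n) \<and>
      half ((x + x) mod n) + h = x" if "half ((x + x) mod n) \<noteq> x"
    proof -
      have xm: "m \<le> x" using sq_small[of x] that h by force
      then have e: "half ((x + x) mod n) = x - m" using sq x by simp
      have "x - m < h" using x m h xm by simp
      then show ?thesis using sq_small[of "x - m"] e xm h by simp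
    qed
  qed
qed

theorem steiner_exists:
  fixes k :: nat
  assumes k: "k \<ge> 3" and k6: "k mod 6 = 1 \<or> k mod 6 = 3"
  shows "\<exists>t. steiner {..<k} t"
proof -
  \<comment> \<open>\<open>k mod 6 = 3\<close> gives \<open>k = 3 n\<close> with \<open>n\<close>
    odd, and \<open>k mod 6 = 1\<close> gives \<open>k = 3 n + 1\<close> with \<open>n\<close> even,
    the extra point being infinity.\<close>
  define n where "n = k div 3"
  have n: "n > 0" and kn: "k = 3 * n + (if even n then 1 else 0)"
  proof -
    show "n > 0" using k by (simp add: n_def)
    have "even n \<longleftrightarrow> k mod 6 = 1" unfolding n_def using k6 by presburger
    moreover have "k mod 6 = 1 \<Longrightarrow> k mod 3 = 1" "k mod 6 = 3 \<Longrightarrow> k mod 3 = 0" by presburger+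
    ultimately show "k = 3 * n + (if even n then 1 else 0)"
      using k6 mult_div_mod_eq[of 3 k] unfolding n_def by presburger
  qed
  interpret half_idempotent_quasigroup "{..<n}"
    "\<lambda>x y. if even ((x + y) mod n) then (x + y) mod n div 2 else (x + y) mod n div 2 + (n + 1) div 2"
    "\<lambda>x y. ((if y < (n + 1) div 2 then 2 * y else 2 * (y - (n + 1) div 2) + 1) + (n - x)) mod n"
    "\<lambda>x. x + (n + 1) div 2" "even n"
    by (rule bose_skolem_quasigroup[OF n])
  have "card points = card {..<k}" "finite points" using card_points kn by auto
  then obtain f where "bij_betw f points {..<k}"
    using finite_same_card_bij by blast
  then show ?thesis using steiner_transport[OF steiner_third] by blast
qed

section \<open>Hypergraphs as ternary relations\<close>

definition hrel :: "'a hgraph \<Rightarrow> 'a \<Rightarrow> 'a \<Rightarrow> 'a \<Rightarrow> bool" where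
  "hrel H x y z \<longleftrightarrow> {x, y, z} \<in> edges H \<and> x \<noteq> y \<and> y \<noteq> z \<and> x \<noteq> z"

lemma card_3_triple: "card e = 3 \<Longrightarrow> \<exists>x y z. e = {x, y, z} \<and> x \<noteq> y \<and> y \<noteq> z \<and> x \<noteq> z"
  by (simp add: card_3_iff)

lemma cancellative_relation_hrel:
  assumes H: "three_graph H" and c: "cancellative H"
  shows "cancellative_relation (verts H) (hrel H)"
proof
  show "finite (verts H)" using H by (simp add: three_graph_def)
  show "x \<in> verts H" if "hrel H x y z" for x y z
    using that H unfolding hrel_def three_graph_def by blast
  show "hrel H y x z" "hrel H y z x" if "hrel H x y z" for x y z
  proof -
    have e: "{y, x, z} = {x, y, z}" "{y, z, x} = {x, y, z}" by auto
    have h: "{x, y, z} \<in> edges H" "x \<noteq> y" "y \<noteq> z" "x \<noteq> z"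
      using that unfolding hrel_def by auto
    show "hrel H y x z" "hrel H y z x"
      unfolding hrel_def e by (intro conjI h h(2-4)[symmetric])+
  qed
  show "x \<noteq> y" if "hrel H x y z" for x y z using that by (simp add: hrel_def)
  show "\<not> hrel H u v w" if u: "hrel H u p q" and v: "hrel H v p q" for u v w p q
  proof
    assume w: "hrel H u v w"
    have ne: "v \<notin> {u, p, q}" "u \<notin> {v, p, q}" using u v w unfolding hrel_def by auto
    have d1: "{u, p, q} \<noteq> {v, p, q}"
    proof
      assume "{u, p, q} = {v, p, q}"
      then have "v \<in> {u, p, q}" by simp
      then show False using ne(1) by contradiction
    qed
    have d2: "{u, p, q} \<noteq> {u, v, w}"
    proof
      assume "{u, p, q} = {u, v, w}"
      then have "v \<in> {u, p, q}" by simp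
      then show False using ne(1) by contradiction
    qed
    have d3: "{v, p, q} \<noteq> {u, v, w}"
    proof
      assume "{v, p, q} = {u, v, w}"
      then have "u \<in> {v, p, q}" by simp
      then show False using ne(2) by contradiction
    qed
    have d4: "({u, p, q} - {v, p, q}) \<union> ({v, p, q} - {u, p, q}) \<subseteq> {u, v, w}" by auto
    have E: "{u, p, q} \<in> edges H" "{v, p, q} \<in> edges H" "{u, v, w} \<in> edges H"
      using u v w unfolding hrel_def by simp_all
    have "\<not> (A \<noteq> B \<and> A \<noteq> C \<and> B \<noteq> C \<and> (A - B) \<union> (B - A) \<subseteq> C)"
      if "A \<in> edges H" "B \<in> edges H" "C \<in> edges H" for A B C
      using c that unfolding cancellative_def by blast
    from this[OF E] show False using conjI[OF d1 conjI[OF d2 conjI[OF d3 d4]]] by (rule notE)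
  qed
qed

text \<open>The symmetric difference of two 3-sets has even size, so if it fits into a 3-set it
  consists of two points and the sets share a pair. This is the configuration excluded by
  \<open>R_cancel\<close>.\<close>

lemma cancellative_if_relation:
  assumes H: "three_graph H" and c: "cancellative_relation (verts H) (hrel H)"
  shows "cancellative H"
  unfolding cancellative_def
proof (rule notI, elim bexE conjE)
  fix A B C
  assume E: "A \<in> edges H" "B \<in> edges H" "C \<in> edges H"
    and ne: "A \<noteq> B" "A \<noteq> C" "B \<noteq> C" and sd: "(A - B) \<union> (B - A) \<subseteq> C"
  have card3: "card A = 3" "card B = 3" "card C = 3"
    using H E unfolding three_graph_def by auto
  have fin: "finite A" "finite B" "finite C" using card3 by (auto intro: card_ge_0_finite)
  have eq: "card (A - B) + card (A \<inter> B) = 3" "card (B - A) + card (A \<inter> B) = 3"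
    using card_Int_Diff[OF fin(1), of B] card_Int_Diff[OF fin(2), of A] card3 by (simp_all add: Int_commute)
  have "card (A - B) + card (B - A) = card ((A - B) \<union> (B - A))"
    using fin by (intro card_Un_disjoint[symmetric]) auto
  also have "\<dots> \<le> 3" using card_mono[OF fin(3) sd] card3 by simp
  finally have le: "card (A - B) \<le> 1" using eq by linarith
  have "A - B \<noteq> {}"
  proof
    assume "A - B = {}"
    then have "A \<subseteq> B" by blast
    then show False using card_subset_eq[OF fin(2)] card3 ne(1) by auto
  qed
  then have one: "card (A - B) = 1" using le fin by (metis card_gt_0_iff finite_Diff less_one nle_le not_less)
  then have "card (B - A) = 1" "card (A \<inter> B) = 2" using eq by linarith+
  then obtain u v p q where uv: "A - B = {u}" "B - A = {v}" "A \<inter> B = {p, q}" "p \<noteq> q"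
    using one by (auto simp: card_1_singleton_iff card_2_iff)
  have A: "A = {u, p, q}" "u \<noteq> p" "u \<noteq> q" and B: "B = {v, p, q}" "v \<noteq> p" "v \<noteq> q"
    using uv by blast+
  have uvC: "u \<in> C" "v \<in> C" "u \<noteq> v" using sd uv by blast+
  have "card (C - {u, v}) = 1" using card_Diff_subset[of "{u, v}" C] uvC card3 by simp
  then obtain w where w: "C - {u, v} = {w}" by (auto simp: card_1_singleton_iff)
  then have C: "C = {u, v, w}" "w \<noteq> u" "w \<noteq> v" using uvC by blast+
  have "hrel H u p q" "hrel H v p q" "hrel H u v w"
    using E A B C uv(4) uvC unfolding hrel_def by auto
  then show False using cancellative_relation.R_cancel[OF c] by blast
qed

lemma card_orderings:
  assumes "card e = 3"
  shows "card {(x, y, z). {x, y, z} = e \<and> x \<noteq> y \<and> y \<noteq> z \<and> x \<noteq> z} = 6"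
proof -
  obtain a b c where e: "e = {a, b, c}" "a \<noteq> b" "b \<noteq> c" "a \<noteq> c" using card_3_triple[OF assms] by blast
  have "{(x, y, z). {x, y, z} = e \<and> x \<noteq> y \<and> y \<noteq> z \<and> x \<noteq> z}
      = {(a, b, c), (a, c, b), (b, a, c), (b, c, a), (c, a, b), (c, b, a)}"
    unfolding e(1)
  proof (intro set_eqI iffI)
    fix p assume "p \<in> {(x, y, z). {x, y, z} = {a, b, c} \<and> x \<noteq> y \<and> y \<noteq> z \<and> x \<noteq> z}"
    then obtain x y z where p: "p = (x, y, z)" and s: "{x, y, z} = {a, b, c}" "x \<noteq> y" "y \<noteq> z" "x \<noteq> z"
      by auto
    have "x \<in> {a, b, c}" "y \<in> {a, b, c}" "z \<in> {a, b, c}" using s(1) by blast+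
    then show "p \<in> {(a, b, c), (a, c, b), (b, a, c), (b, c, a), (c, a, b), (c, b, a)}"
      using s(2-4) unfolding p by auto
  qed (use e in auto)
  then show ?thesis using e(2-4) by simp
qed

lemma card_pair_orderings:
  assumes "card e = 2"
  shows "card {(x, y). {x, y} = e \<and> x \<noteq> y} = 2"
proof -
  obtain a b where e: "e = {a, b}" "a \<noteq> b" using assms by (auto simp: card_2_iff)
  have "{(x, y). {x, y} = e \<and> x \<noteq> y} = {(a, b), (b, a)}"
    unfolding e(1) using e(2) by (auto simp: doubleton_eq_iff)
  then show ?thesis using e(2) by simp
qed

lemma finite_edges: "three_graph H \<Longrightarrow> finite (edges H)"
  unfolding three_graph_def by (rule finite_subset[of _ "Pow (verts H)"]) auto

lemma shadow_sub: "three_graph H \<Longrightarrow> A \<in> shadow H \<Longrightarrow> A \<subseteq> verts H"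
  unfolding three_graph_def shadow_def by blast

lemma finite_shadow: "three_graph H \<Longrightarrow> finite (shadow H)"
proof (rule finite_subset[of _ "Pow (verts H)"])
  assume H: "three_graph H"
  show "shadow H \<subseteq> Pow (verts H)" using shadow_sub[OF H] by (rule subsetI[OF PowI])
  show "finite (Pow (verts H))" using H by (simp add: three_graph_def)
qed

lemma total_hrel:
  assumes H: "three_graph H" and c: "cancellative_relation (verts H) (hrel H)"
  shows "cancellative_relation.total (verts H) (hrel H) = 6 * real (card (edges H))"
proof -
  interpret cancellative_relation "verts H" "hrel H" by (fact c)
  let ?O = "\<lambda>e. {(x, y, z). {x, y, z} = e \<and> x \<noteq> y \<and> y \<noteq> z \<and> x \<noteq> z}"
  have c6: "card (?O e) = 6" if "e \<in> edges H" for e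
  proof (rule card_orderings)
    show "card e = 3" using H that by (simp add: three_graph_def)
  qed
  have "(SIGMA x:verts H. SIGMA y:verts H. nb x y) = (\<Union>e\<in>edges H. ?O e)"
  proof (intro set_eqI iffI)
    fix p assume "p \<in> (SIGMA x:verts H. SIGMA y:verts H. nb x y)"
    then show "p \<in> (\<Union>e\<in>edges H. ?O e)" by (auto simp: nb_def hrel_def)
  next
    fix p assume "p \<in> (\<Union>e\<in>edges H. ?O e)"
    then obtain x y z where p: "p = (x, y, z)" "hrel H x y z" by (auto simp: hrel_def)
    then show "p \<in> (SIGMA x:verts H. SIGMA y:verts H. nb x y)"
      using R_V[OF p(2)] by (simp add: nb_def)
  qed
  moreover have "card (\<Union>e\<in>edges H. ?O e) = (\<Sum>e\<in>edges H. card (?O e))"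
  proof (rule card_UN_disjoint)
    show "finite (edges H)" by (rule finite_edges[OF H])
    show "\<forall>e\<in>edges H. finite (?O e)" using c6 by (auto intro: card_ge_0_finite)
  qed auto
  moreover have "card (SIGMA x:verts H. SIGMA y:verts H. nb x y) = (\<Sum>x\<in>verts H. \<Sum>y\<in>verts H. card (nb x y))"
    using finite_V by (simp add: card_SigmaI finite_SigmaI)
  ultimately have "(\<Sum>x\<in>verts H. \<Sum>y\<in>verts H. card (nb x y)) = 6 * card (edges H)"
    using c6 by simp
  then have "real (\<Sum>x\<in>verts H. \<Sum>y\<in>verts H. card (nb x y)) = real (6 * card (edges H))" by (rule arg_cong)
  then show ?thesis by (simp add: total_def deg_def codeg_def)
qed

lemma nondeg_hrel:
  assumes H: "three_graph H" and c: "cancellative_relation (verts H) (hrel H)"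
  shows "(\<Sum>z\<in>verts H. cancellative_relation.nondeg (verts H) (hrel H) z)
    = (real (card (verts H)))\<^sup>2 - 2 * real (card (shadow H))"
proof -
  interpret cancellative_relation "verts H" "hrel H" by (fact c)
  let ?O = "\<lambda>e. {(x, y). {x, y} = e \<and> x \<noteq> y}"
  have adj: "adj x y \<longleftrightarrow> {x, y} \<in> shadow H \<and> x \<noteq> y" for x y
  proof
    assume "adj x y"
    then show "{x, y} \<in> shadow H \<and> x \<noteq> y"
      unfolding adj_def hrel_def shadow_def by auto
  next
    assume xy: "{x, y} \<in> shadow H \<and> x \<noteq> y"
    then obtain e where e: "e \<in> edges H" "{x, y} \<subseteq> e" by (auto simp: shadow_def)
    have "card e = 3" using H e by (simp add: three_graph_def)
    then have "card (e - {x, y}) = 1" using card_Diff_subset[of "{x, y}" e] e xy by simp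
    then obtain z where "e - {x, y} = {z}" by (auto simp: card_1_singleton_iff)
    then have "e = {x, y, z}" "z \<noteq> x" "z \<noteq> y" using e by blast+
    then show "adj x y" using e xy unfolding adj_def hrel_def by blast
  qed
  have c2: "card (?O e) = 2" if "e \<in> shadow H" for e
  proof (rule card_pair_orderings)
    show "card e = 2" using that by (simp add: shadow_def)
  qed
  have "(SIGMA x:verts H. {y \<in> verts H. adj x y}) = (\<Union>e\<in>shadow H. ?O e)"
    using shadow_sub[OF H] unfolding adj by fastforce
  moreover have "card (\<Union>e\<in>shadow H. ?O e) = (\<Sum>e\<in>shadow H. card (?O e))"
  proof (rule card_UN_disjoint)
    show "finite (shadow H)" by (rule finite_shadow[OF H])
    show "\<forall>e\<in>shadow H. finite (?O e)" using c2 by (auto intro: card_ge_0_finite)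
  qed auto
  moreover have "card (SIGMA x:verts H. {y \<in> verts H. adj x y}) = (\<Sum>x\<in>verts H. card {y \<in> verts H. adj x y})"
    using finite_V by (simp add: card_SigmaI)
  ultimately have "(\<Sum>x\<in>verts H. card {y \<in> verts H. adj x y}) = 2 * card (shadow H)"
    using c2 by simp
  then have "real (\<Sum>x\<in>verts H. card {y \<in> verts H. adj x y}) = real (2 * card (shadow H))" by (rule arg_cong)
  then have "(\<Sum>x\<in>verts H. order - nondeg x) = 2 * real (card (shadow H))"
    by (simp add: card_adj)
  then show ?thesis by (simp add: sum_subtractf power2_eq_square)
qed

section \<open>Blow-ups\<close>

lemma card_residue_class:
  fixes k m j :: nat
  assumes "j < k"
  shows "card {x \<in> {..<k * m}. x mod k = j} = m"
proof -
  have "{x \<in> {..<k * m}. x mod k = j} = (\<lambda>i. i * k + j) ` {..<m}"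
  proof (intro set_eqI iffI)
    fix x assume "x \<in> {x \<in> {..<k * m}. x mod k = j}"
    then have "x = x div k * k + j" "x div k < m"
      by (auto simp: less_mult_imp_div_less mult.commute)
    then show "x \<in> (\<lambda>i. i * k + j) ` {..<m}" by blast
  next
    fix x assume "x \<in> (\<lambda>i. i * k + j) ` {..<m}"
    then obtain i where i: "i < m" "x = i * k + j" by auto
    have "i * k + j < (i + 1) * k" using assms by simp
    also have "\<dots> \<le> m * k" using i by (intro mult_right_mono) auto
    finally show "x \<in> {x \<in> {..<k * m}. x mod k = j}" using i assms by (simp add: mult.commute)
  qed
  moreover have "inj_on (\<lambda>i. i * k + j) {..<m}" using assms by (intro inj_onI) simp
  ultimately show ?thesis by (simp add: card_image)
qed

text \<open>The parts are the residue classes modulo \<open>k\<close>, each with \<open>m\<close>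
  vertices. The formula singles out \<open>z\<close>; its symmetry comes from the Steiner
  identities.\<close>

definition blowup_rel :: "nat \<Rightarrow> nat \<Rightarrow> (nat \<Rightarrow> nat \<Rightarrow> nat) \<Rightarrow> nat \<Rightarrow> nat \<Rightarrow> nat \<Rightarrow> bool" where
  "blowup_rel k m t x y z \<longleftrightarrow> x < k * m \<and> y < k * m \<and> z < k * m
    \<and> x mod k \<noteq> y mod k \<and> z mod k = t (x mod k) (y mod k)"

definition blowup :: "nat \<Rightarrow> nat \<Rightarrow> (nat \<Rightarrow> nat \<Rightarrow> nat) \<Rightarrow> nat hgraph" where
  "blowup k m t = ({..<k * m}, {{x, y, z} | x y z. blowup_rel k m t x y z})"

lemma verts_blowup: "verts (blowup k m t) = {..<k * m}"
  by (simp add: blowup_def)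

context
  fixes k m :: nat and t :: "nat \<Rightarrow> nat \<Rightarrow> nat"
  assumes k: "k > 0" and m: "m > 0" and st: "steiner {..<k} t"
begin

lemma steiner_third_props:
  assumes "a < k" "b < k" "a \<noteq> b"
  shows "t a b < k" "t a b \<noteq> a" "t a b \<noteq> b" "t b a = t a b" "t a (t a b) = b" "t b (t a b) = a"
proof -
  have ab: "a \<in> {..<k}" "b \<in> {..<k}" "b \<noteq> a" using assms by auto
  note s = st[unfolded steiner_def, THEN bspec, THEN bspec, THEN mp]
  note 1 = s[OF ab(1,2) assms(3)] and 2 = s[OF ab(2,1,3)]
  have comm: "t b a = t a b" using 1 by (elim conjE)
  then show "t b a = t a b" .
  show "t a b < k" "t a b \<noteq> a" "t a (t a b) = b" using 1 by (elim conjE, simp)+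
  show "t a b \<noteq> b" "t b (t a b) = a" using 2 unfolding comm by (elim conjE, simp)+
qed

lemma blowup_cancellative_relation: "cancellative_relation {..<k * m} (blowup_rel k m t)"
proof
  have rot: "blowup_rel k m t y z x" if "blowup_rel k m t x y z" for x y z
    using that steiner_third_props(3,6)[of "x mod k" "y mod k"] k unfolding blowup_rel_def
    by (simp add: not_sym[of "t (x mod k) (y mod k)" "y mod k"])
  then show "blowup_rel k m t y z x" if "blowup_rel k m t x y z" for x y z using that .
  show "blowup_rel k m t y x z" if "blowup_rel k m t x y z" for x y z
    using that steiner_third_props(4)[of "x mod k" "y mod k"] k unfolding blowup_rel_def by simp
  \<comment> \<open>Vertices completing the same pair have the same residue, and no triple contains
    two vertices of one class.\<close>
  show "\<not> blowup_rel k m t u v w" if "blowup_rel k m t u p q" "blowup_rel k m t v p q" for u v w p q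
    using rot[OF that(1)] rot[OF that(2)] unfolding blowup_rel_def by simp
  show "finite {..<k * m}" by simp
  show "x \<in> {..<k * m}" "x \<noteq> y" if "blowup_rel k m t x y z" for x y z
    using that unfolding blowup_rel_def by auto
qed

interpretation B: cancellative_relation "{..<k * m}" "blowup_rel k m t"
  by (rule blowup_cancellative_relation)

lemma blowup_distinct: "blowup_rel k m t x y z \<Longrightarrow> x \<noteq> y \<and> y \<noteq> z \<and> x \<noteq> z"
  using B.R_neq[of x y z] B.R_neq[of y z x] B.R_neq[of x z y] B.R_perms(1,3)[of x y z] by simp

lemma three_graph_blowup: "three_graph (blowup k m t)"
proof -
  have "e \<subseteq> {..<k * m} \<and> card e = 3" if e: "e \<in> edges (blowup k m t)" for e
  proof -
    obtain x y z where xyz: "e = {x, y, z}" "blowup_rel k m t x y z"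
      using e by (auto simp: blowup_def)
    then show ?thesis using B.R_V[OF xyz(2)] blowup_distinct[OF xyz(2)] by simp
  qed
  then show ?thesis unfolding three_graph_def verts_blowup by simp
qed

lemma hrel_blowup: "hrel (blowup k m t) = blowup_rel k m t"
proof (intro ext iffI)
  fix x y z
  assume "hrel (blowup k m t) x y z"
  then obtain a b c where abc: "{x, y, z} = {a, b, c}" "blowup_rel k m t a b c"
    and ne: "x \<noteq> y" "y \<noteq> z" "x \<noteq> z"
    unfolding hrel_def blowup_def by auto
  have "x \<in> {a, b, c}" "y \<in> {a, b, c}" "z \<in> {a, b, c}" using abc(1) by blast+
  then have "(x, y, z) \<in> {(a, b, c), (a, c, b), (b, a, c), (b, c, a), (c, a, b), (c, b, a)}"
    using ne by auto
  then show "blowup_rel k m t x y z"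
    using abc(2) B.R_perms[OF abc(2)] by (elim insertE) simp_all
next
  fix x y z
  assume "blowup_rel k m t x y z"
  then show "hrel (blowup k m t) x y z"
    unfolding hrel_def blowup_def using blowup_distinct[of x y z] by auto
qed

lemma blowup_free: "free_of T3 (blowup k m t)"
  using T3_free_iff_cancellative[OF three_graph_blowup] cancellative_if_relation[OF three_graph_blowup]
    blowup_cancellative_relation unfolding hrel_blowup verts_blowup by blast

lemma blowup_adj: "B.adj x y \<longleftrightarrow> x < k * m \<and> y < k * m \<and> x mod k \<noteq> y mod k"
proof
  assume xy: "x < k * m \<and> y < k * m \<and> x mod k \<noteq> y mod k"
  \<comment> \<open>The residue \<open>t (x mod k) (y mod k)\<close> is itself a vertex of the class
    it names, as \<open>m > 0\<close>.\<close>
  have t: "t (x mod k) (y mod k) < k" using steiner_third_props(1) k xy by simp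
  moreover have "k \<le> k * m" using m by simp
  ultimately have "t (x mod k) (y mod k) < k * m" by (rule less_le_trans)
  then have "blowup_rel k m t x y (t (x mod k) (y mod k))"
    using xy t by (simp add: blowup_rel_def)
  then show "B.adj x y" unfolding B.adj_def by blast
qed (auto simp: B.adj_def blowup_rel_def)

lemma blowup_codeg: "B.adj x y \<Longrightarrow> B.codeg x y = real m"
proof -
  assume a: "B.adj x y"
  then have "B.nb x y = {z \<in> {..<k * m}. z mod k = t (x mod k) (y mod k)}"
    unfolding blowup_adj B.nb_def blowup_rel_def by auto
  then show ?thesis using a steiner_third_props(1) k card_residue_class unfolding blowup_adj B.codeg_def by simp
qed

lemma blowup_nondeg: "x < k * m \<Longrightarrow> B.nondeg x = real m"
proof -
  assume x: "x < k * m"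
  then have "B.nonadj x = {y \<in> {..<k * m}. y mod k = x mod k}"
    unfolding B.nonadj_def blowup_adj by auto
  then show ?thesis using k card_residue_class unfolding B.nondeg_def by simp
qed

lemma blowup_card_shadow: "2 * real (card (shadow (blowup k m t))) = real (k * m) * (real (k * m) - real m)"
proof -
  have "(\<Sum>z\<in>{..<k * m}. B.nondeg z) = real (k * m) * real m"
    by (simp add: blowup_nondeg)
  moreover have "(\<Sum>z\<in>{..<k * m}. B.nondeg z)
      = (real (k * m))\<^sup>2 - 2 * real (card (shadow (blowup k m t)))"
    using nondeg_hrel[OF three_graph_blowup, unfolded hrel_blowup verts_blowup]
      blowup_cancellative_relation by simp
  ultimately show ?thesis by (simp add: algebra_simps power2_eq_square)
qed

lemma blowup_card_edges: "6 * real (card (edges (blowup k m t))) = real (k * m) * (real (k * m) - real m) * real m"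
proof -
  have "B.deg x = real m * (real (k * m) - real m)" if "x < k * m" for x
  proof -
    have "B.deg x = (\<Sum>y\<in>{y \<in> {..<k * m}. B.adj x y}. B.codeg x y)"
      unfolding B.deg_def using B.codeg_not_adj by (intro sum.mono_neutral_right) auto
    also have "\<dots> = (\<Sum>y\<in>{y \<in> {..<k * m}. B.adj x y}. real m)"
      by (intro sum.cong refl) (simp add: blowup_codeg)
    also have "\<dots> = (real (k * m) - real m) * real m"
      using B.card_adj[of x] blowup_nondeg[OF that] by simp
    finally show ?thesis by simp
  qed
  then have "B.total = real (k * m) * (real (k * m) - real m) * real m"
    unfolding B.total_def by simp
  then show ?thesis
    using total_hrel[OF three_graph_blowup, unfolded hrel_blowup verts_blowup]
      blowup_cancellative_relation by simp
qed

end

section \<open>The feasible region\<close>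

text \<open>Replacing sequences by approximation to any accuracy and order makes closedness of the
  region visible.\<close>

lemma feasible_iff:
  "(x, y) \<in> feasible_region \<F> \<longleftrightarrow> x \<in> {0..1} \<and> y \<in> {0..1} \<and>
    (\<forall>e>0. \<forall>M. \<exists>H :: nat hgraph. three_graph H \<and> free_of \<F> H \<and> M \<le> card (verts H) \<and>
      \<bar>shadow_density H - x\<bar> < e \<and> \<bar>edge_density H - y\<bar> < e)"
proof safe
  assume xy: "(x, y) \<in> feasible_region \<F>"
  show "x \<in> {0..1}" "y \<in> {0..1}" using xy by (auto simp: feasible_region_def)
  obtain H :: "nat \<Rightarrow> nat hgraph" where H: "\<And>m. three_graph (H m) \<and> free_of \<F> (H m)"
    "filterlim (\<lambda>m. card (verts (H m))) at_top sequentially"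
    "(\<lambda>m. shadow_density (H m)) \<longlonglongrightarrow> x" "(\<lambda>m. edge_density (H m)) \<longlonglongrightarrow> y"
    using xy unfolding feasible_region_def by auto
  fix e :: real and M :: nat assume e: "e > 0"
  have "\<forall>\<^sub>F m in sequentially. M \<le> card (verts (H m)) \<and> dist (shadow_density (H m)) x < e \<and>
      dist (edge_density (H m)) y < e"
    using H(2) tendstoD[OF H(3) e] tendstoD[OF H(4) e]
    by (intro eventually_conj) (auto simp: filterlim_at_top)
  then obtain m where "M \<le> card (verts (H m))" "dist (shadow_density (H m)) x < e"
      "dist (edge_density (H m)) y < e"
    using eventually_happens trivial_limit_sequentially by blast
  then show "\<exists>H :: nat hgraph. three_graph H \<and> free_of \<F> H \<and> M \<le> card (verts H) \<and>
      \<bar>shadow_density H - x\<bar> < e \<and> \<bar>edge_density H - y\<bar> < e"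
    using H(1)[of m] by (intro exI[of _ "H m"]) (simp add: dist_real_def)
next
  assume x: "x \<in> {0..1}" and y: "y \<in> {0..1}"
    and ap: "\<forall>e>0. \<forall>M. \<exists>H :: nat hgraph. three_graph H \<and> free_of \<F> H \<and> M \<le> card (verts H) \<and>
      \<bar>shadow_density H - x\<bar> < e \<and> \<bar>edge_density H - y\<bar> < e"
  have "\<forall>m. \<exists>H :: nat hgraph. three_graph H \<and> free_of \<F> H \<and> m \<le> card (verts H) \<and>
      \<bar>shadow_density H - x\<bar> < inverse (real (Suc m)) \<and> \<bar>edge_density H - y\<bar> < inverse (real (Suc m))"
    using ap by simp
  then obtain H :: "nat \<Rightarrow> nat hgraph" where H: "\<And>m. three_graph (H m) \<and> free_of \<F> (H m) \<and>
      m \<le> card (verts (H m)) \<and> \<bar>shadow_density (H m) - x\<bar> < inverse (real (Suc m)) \<and>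
      \<bar>edge_density (H m) - y\<bar> < inverse (real (Suc m))"
    by metis
  have lim: "f \<longlonglongrightarrow> l" if "\<And>m. \<bar>f m - l\<bar> < inverse (real (Suc m))" for f :: "nat \<Rightarrow> real" and l
  proof -
    have "(\<lambda>m. \<bar>f m - l\<bar>) \<longlonglongrightarrow> 0"
    proof (rule tendsto_sandwich[OF _ _ tendsto_const LIMSEQ_inverse_real_of_nat])
      show "\<forall>\<^sub>F m in sequentially. 0 \<le> \<bar>f m - l\<bar>" by simp
      show "\<forall>\<^sub>F m in sequentially. \<bar>f m - l\<bar> \<le> inverse (real (Suc m))"
        using that by (intro always_eventually allI less_imp_le)
    qed
    then have "(\<lambda>m. f m - l) \<longlonglongrightarrow> 0" by (simp only: tendsto_rabs_zero_iff)
    then show ?thesis by (simp add: LIM_zero_iff)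
  qed
  have "filterlim (\<lambda>m. card (verts (H m))) at_top sequentially"
    by (rule filterlim_at_top_mono[OF filterlim_ident]) (use H in \<open>auto intro!: always_eventually\<close>)
  then show "(x, y) \<in> feasible_region \<F>"
    unfolding feasible_region_def using x y H lim[of "\<lambda>m. shadow_density (H m)" x]
      lim[of "\<lambda>m. edge_density (H m)" y] by blast
qed

text \<open>The fibre over \<open>x\<close> lies in the unit interval and is closed, because
  hypergraphs approximating a point close to the supremum also approximate the supremum. Hence
  \<open>GREATEST\<close> denotes a genuine maximum.\<close>

lemma feasible_fun_max:
  assumes "x \<in> proj_region \<F>"
  shows "(x, feasible_fun \<F> x) \<in> feasible_region \<F>"
    and "(x, y) \<in> feasible_region \<F> \<Longrightarrow> y \<le> feasible_fun \<F> x"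
proof -
  define S where "S = {y. (x, y) \<in> feasible_region \<F>}"
  obtain y0 where y0: "y0 \<in> S" using assms by (auto simp: S_def proj_region_def)
  have S01: "S \<subseteq> {0..1}" by (auto simp: S_def feasible_iff)
  then have bdd: "bdd_above S" by (meson atLeastAtMost_iff bdd_above.I subset_iff)
  have up: "y \<le> Sup S" if "y \<in> S" for y using cSup_upper[OF that bdd] .
  have "Sup S \<le> 1" using S01 y0 by (intro cSup_least) auto
  moreover have "0 \<le> Sup S" using S01 y0 up[OF y0] by force
  moreover have "\<exists>H :: nat hgraph. three_graph H \<and> free_of \<F> H \<and> M \<le> card (verts H) \<and>
      \<bar>shadow_density H - x\<bar> < e \<and> \<bar>edge_density H - Sup S\<bar> < e" if e: "e > 0" for e M
  proof -
    obtain y where y: "y \<in> S" "Sup S - e/2 < y"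
      using less_cSup_iff[of S "Sup S - e/2"] bdd y0 e by auto
    then obtain H :: "nat hgraph" where "three_graph H" "free_of \<F> H" "M \<le> card (verts H)"
      "\<bar>shadow_density H - x\<bar> < e/2" "\<bar>edge_density H - y\<bar> < e/2"
      using e unfolding S_def mem_Collect_eq feasible_iff by (meson half_gt_zero)
    moreover from this have "\<bar>shadow_density H - x\<bar> < e" using e by linarith
    moreover have "\<bar>edge_density H - Sup S\<bar> < e"
      using \<open>\<bar>edge_density H - y\<bar> < e/2\<close> y(2) up[OF y(1)] by linarith
    ultimately show ?thesis by blast
  qed
  ultimately have SupS: "Sup S \<in> S"
    using y0 unfolding S_def mem_Collect_eq feasible_iff by auto
  have "feasible_fun \<F> x = Sup S"
    unfolding feasible_fun_def using SupS up by (intro Greatest_equality) (auto simp: S_def)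
  then show "(x, feasible_fun \<F> x) \<in> feasible_region \<F>"
    "(x, y) \<in> feasible_region \<F> \<Longrightarrow> y \<le> feasible_fun \<F> x"
    using SupS up by (auto simp: S_def)
qed

section \<open>Densities normalised by powers of the order\<close>

lemma choose_2_real: "2 * real (n choose 2) = real n * (real n - 1)"
  by (cases n) (auto simp: choose_two algebra_simps real_of_nat_div)

lemma choose_3_real: "6 * real (n choose 3) = real n * (real n - 1) * (real n - 2)"
proof (induction n)
  case (Suc n)
  have "Suc n choose 3 = (n choose 2) + (n choose 3)"
    by (simp add: numeral_2_eq_2 numeral_3_eq_3)
  then show ?case using Suc choose_2_real[of n] by (simp add: algebra_simps)
qed simp

text \<open>Ordered counts over powers of the order, matching the sums of the ternary relation; they
  have the same limits as the binomial densities.\<close>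

definition shadow_ratio :: "'a hgraph \<Rightarrow> real" where
  "shadow_ratio H = 2 * real (card (shadow H)) / (real (card (verts H)))\<^sup>2"

definition edge_ratio :: "'a hgraph \<Rightarrow> real" where
  "edge_ratio H = 6 * real (card (edges H)) / real (card (verts H)) ^ 3"

lemma density_ratio:
  assumes "card (verts H) \<ge> 3"
  shows "shadow_ratio H = shadow_density H * (1 - 1 / real (card (verts H)))"
    and "edge_ratio H = edge_density H * ((1 - 1 / real (card (verts H))) * (1 - 2 / real (card (verts H))))"
proof -
  define n where "n = real (card (verts H))"
  have n: "n \<ge> 3" using assms by (simp add: n_def)
  have c2: "real (card (verts H) choose 2) = n * (n - 1) / 2"
    using choose_2_real[of "card (verts H)"] by (simp add: n_def)
  have c3: "real (card (verts H) choose 3) = n * (n - 1) * (n - 2) / 6"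
    using choose_3_real[of "card (verts H)"] by (simp add: n_def)
  show "shadow_ratio H = shadow_density H * (1 - 1 / real (card (verts H)))"
    unfolding shadow_ratio_def shadow_density_def c2 n_def[symmetric]
    using n by (simp add: divide_simps power2_eq_square)
  show "edge_ratio H = edge_density H * ((1 - 1 / real (card (verts H))) * (1 - 2 / real (card (verts H))))"
    unfolding edge_ratio_def edge_density_def c3 n_def[symmetric]
    using n by (simp add: divide_simps power3_eq_cube)
qed

lemma density_limits:
  fixes H :: "nat \<Rightarrow> 'a hgraph"
  assumes n: "filterlim (\<lambda>m. card (verts (H m))) at_top sequentially"
  shows "(\<lambda>m. shadow_density (H m)) \<longlonglongrightarrow> x \<longleftrightarrow> (\<lambda>m. shadow_ratio (H m)) \<longlonglongrightarrow> x"
    and "(\<lambda>m. edge_density (H m)) \<longlonglongrightarrow> y \<longleftrightarrow> (\<lambda>m. edge_ratio (H m)) \<longlonglongrightarrow> y"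
proof -
  have "filterlim (\<lambda>m. real (card (verts (H m)))) at_top sequentially"
    by (rule filterlim_compose[OF filterlim_real_sequentially n])
  then have inv: "(\<lambda>m. c / real (card (verts (H m)))) \<longlonglongrightarrow> 0" for c :: real
    by (rule real_tendsto_divide_at_top[OF tendsto_const])
  define f where "f m = 1 - 1 / real (card (verts (H m)))" for m
  define g where "g m = f m * (1 - 2 / real (card (verts (H m))))" for m
  have f: "f \<longlonglongrightarrow> 1" unfolding f_def using tendsto_diff[OF tendsto_const inv, of 1 1] by simp
  have g: "g \<longlonglongrightarrow> 1" unfolding g_def
    using tendsto_mult[OF f tendsto_diff[OF tendsto_const inv, of 1 2]] by simp
  have ev: "\<forall>\<^sub>F m in sequentially. card (verts (H m)) \<ge> 3"
    using n by (auto simp: filterlim_at_top)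
  have pos: "f m > 0 \<and> g m > 0" if "card (verts (H m)) \<ge> 3" for m
    using that by (simp add: f_def g_def)
  have eqv: "a \<longlonglongrightarrow> l \<longleftrightarrow> b \<longlonglongrightarrow> l"
    if h: "h \<longlonglongrightarrow> (1::real)" and e: "\<forall>\<^sub>F m in sequentially. h m > 0 \<and> b m = a m * h m" for a b h l
  proof
    assume "a \<longlonglongrightarrow> l"
    then have "(\<lambda>m. a m * h m) \<longlonglongrightarrow> l * 1" using h by (rule tendsto_mult)
    moreover have "\<forall>\<^sub>F m in sequentially. a m * h m = b m" using e by eventually_elim simp
    ultimately show "b \<longlonglongrightarrow> l" using Lim_transform_eventually by fastforce
  next
    assume "b \<longlonglongrightarrow> l"
    then have "(\<lambda>m. b m / h m) \<longlonglongrightarrow> l / 1" using h by (rule tendsto_divide) simp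
    moreover have "\<forall>\<^sub>F m in sequentially. b m / h m = a m" using e by eventually_elim simp
    ultimately show "a \<longlonglongrightarrow> l" using Lim_transform_eventually by fastforce
  qed
  have "\<forall>\<^sub>F m in sequentially. f m > 0 \<and> shadow_ratio (H m) = shadow_density (H m) * f m"
    using ev by eventually_elim (metis pos density_ratio(1) f_def)
  then show "(\<lambda>m. shadow_density (H m)) \<longlonglongrightarrow> x \<longleftrightarrow> (\<lambda>m. shadow_ratio (H m)) \<longlonglongrightarrow> x"
    by (rule eqv[OF f])
  have "\<forall>\<^sub>F m in sequentially. g m > 0 \<and> edge_ratio (H m) = edge_density (H m) * g m"
    using ev by eventually_elim (metis pos density_ratio(2) f_def g_def)
  then show "(\<lambda>m. edge_density (H m)) \<longlonglongrightarrow> y \<longleftrightarrow> (\<lambda>m. edge_ratio (H m)) \<longlonglongrightarrow> y"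
    by (rule eqv[OF g])
qed

lemma cancellative_relation_of_T3_free:
  assumes "three_graph H" "free_of T3 H"
  shows "cancellative_relation (verts H) (hrel H)"
  using assms cancellative_relation_hrel T3_free_iff_cancellative by blast

lemma nondeg_ratio:
  assumes "three_graph H" "free_of T3 H" "verts H \<noteq> {}"
  shows "(\<Sum>z\<in>verts H. cancellative_relation.nondeg (verts H) (hrel H) z) / (real (card (verts H)))\<^sup>2
    = 1 - shadow_ratio H"
proof -
  have "real (card (verts H)) \<noteq> 0" using assms by (simp add: three_graph_def)
  then show ?thesis
    unfolding nondeg_hrel[OF assms(1) cancellative_relation_of_T3_free[OF assms(1,2)]]
    by (simp add: shadow_ratio_def diff_divide_distrib)
qed

lemma edge_ratio_total:
  assumes "three_graph H" "free_of T3 H"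
  shows "edge_ratio H = cancellative_relation.total (verts H) (hrel H) / real (card (verts H)) ^ 3"
  unfolding edge_ratio_def total_hrel[OF assms(1) cancellative_relation_of_T3_free[OF assms]] ..

lemma edge_ratio_le:
  assumes "three_graph H" "free_of T3 H" "verts H \<noteq> {}"
  shows "edge_ratio H \<le> shadow_ratio H * (1 - shadow_ratio H)"
proof -
  interpret cancellative_relation "verts H" "hrel H"
    by (rule cancellative_relation_of_T3_free[OF assms(1,2)])
  define S where "S = (\<Sum>z\<in>verts H. nondeg z)"
  have n: "order > 0" using assms(3) finite_V by (simp add: card_gt_0_iff)
  have "order * total / order ^ 4 \<le> S * (order\<^sup>2 - S) / order ^ 4"
    using total_le_product n unfolding S_def by (intro divide_right_mono) auto
  moreover have "order * total / order ^ 4 = edge_ratio H"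
    using n unfolding edge_ratio_total[OF assms(1,2)] by (simp add: power_numeral_reduce)
  moreover have "S * (order\<^sup>2 - S) / order ^ 4 = (S / order\<^sup>2) * (1 - S / order\<^sup>2)"
    using n by (simp add: field_simps power2_eq_square power4_eq_xxxx)
  moreover have "S / order\<^sup>2 = 1 - shadow_ratio H"
    unfolding S_def by (rule nondeg_ratio[OF assms])
  ultimately show ?thesis by (simp add: mult.commute)
qed

section \<open>Upper bounds on the region\<close>

lemma feasible_sequence:
  assumes "(x, y) \<in> feasible_region T3"
  shows "\<exists>H :: nat \<Rightarrow> nat hgraph. (\<forall>m. three_graph (H m) \<and> free_of T3 (H m)) \<and>
    filterlim (\<lambda>m. card (verts (H m))) at_top sequentially \<and>
    (\<lambda>m. shadow_ratio (H m)) \<longlonglongrightarrow> x \<and> (\<lambda>m. edge_ratio (H m)) \<longlonglongrightarrow> y \<and>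
    (\<forall>\<^sub>F m in sequentially. verts (H m) \<noteq> {})"
proof -
  obtain H :: "nat \<Rightarrow> nat hgraph" where H: "\<And>m. three_graph (H m) \<and> free_of T3 (H m)"
    "filterlim (\<lambda>m. card (verts (H m))) at_top sequentially"
    "(\<lambda>m. shadow_density (H m)) \<longlonglongrightarrow> x" "(\<lambda>m. edge_density (H m)) \<longlonglongrightarrow> y"
    using assms unfolding feasible_region_def by auto
  have "\<forall>\<^sub>F m in sequentially. 1 \<le> card (verts (H m))"
    using H(2) unfolding filterlim_at_top by blast
  then have "\<forall>\<^sub>F m in sequentially. verts (H m) \<noteq> {}" by eventually_elim auto
  then show ?thesis using H density_limits[OF H(2)] by (intro exI[of _ H]) simp
qed

lemma feasible_le:
  assumes "(x, y) \<in> feasible_region T3"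
  shows "y \<le> x * (1 - x)"
proof -
  obtain H :: "nat \<Rightarrow> nat hgraph" where HT: "\<forall>m. three_graph (H m) \<and> free_of T3 (H m)"
    and "filterlim (\<lambda>m. card (verts (H m))) at_top sequentially"
    and lim: "(\<lambda>m. shadow_ratio (H m)) \<longlonglongrightarrow> x" "(\<lambda>m. edge_ratio (H m)) \<longlonglongrightarrow> y"
    and ne: "\<forall>\<^sub>F m in sequentially. verts (H m) \<noteq> {}"
    using feasible_sequence[OF assms] by (elim exE conjE) (rule that)
  have H: "three_graph (H m)" "free_of T3 (H m)" for m using HT by simp_all
  have "(\<lambda>m. shadow_ratio (H m) * (1 - shadow_ratio (H m))) \<longlonglongrightarrow> x * (1 - x)"
    by (intro tendsto_intros lim)
  moreover have "\<forall>\<^sub>F m in sequentially. edge_ratio (H m) \<le> shadow_ratio (H m) * (1 - shadow_ratio (H m))"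
    using ne by eventually_elim (rule edge_ratio_le[OF H(1,2)])
  ultimately show ?thesis
    by (rule tendsto_le[OF sequentially_bot _ lim(2)])
qed

lemma feasible_below:
  fixes k :: nat
  assumes "k \<ge> 3"
  obtains c \<gamma> :: real where "c > 0" "\<gamma> > 0"
    and "\<And>x y. (x, y) \<in> feasible_region T3 \<Longrightarrow> 1 - 1/k - c < x \<Longrightarrow> x < 1 - 1/k \<Longrightarrow>
      y \<le> (1/k - 1 / (real k)\<^sup>2) - \<gamma> * (1 - 1/k - x)"
proof (rule near_extremal_total_bound[OF assms, where ?'a = nat])
  fix c \<gamma> :: real
  assume c: "c > 0" "\<gamma> > 0"
    and bound: "\<And>V (R :: nat \<Rightarrow> nat \<Rightarrow> nat \<Rightarrow> bool). cancellative_relation V R \<Longrightarrow> V \<noteq> {} \<Longrightarrow>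
      1 / real k \<le> (\<Sum>z\<in>V. cancellative_relation.nondeg V R z) / (real (card V))\<^sup>2 \<Longrightarrow>
      (\<Sum>z\<in>V. cancellative_relation.nondeg V R z) / (real (card V))\<^sup>2 \<le> 1 / real k + c \<Longrightarrow>
      cancellative_relation.total V R / real (card V) ^ 3 \<le> (1 / real k - 1 / (real k)\<^sup>2)
        - \<gamma> * ((\<Sum>z\<in>V. cancellative_relation.nondeg V R z) / (real (card V))\<^sup>2 - 1 / real k)"
  show ?thesis
  proof (rule that[OF c])
    fix x y assume xy: "(x, y) \<in> feasible_region T3" and x: "1 - 1/k - c < x" "x < 1 - 1/k"
    obtain H :: "nat \<Rightarrow> nat hgraph" where HT: "\<forall>m. three_graph (H m) \<and> free_of T3 (H m)"
      and "filterlim (\<lambda>m. card (verts (H m))) at_top sequentially"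
      and lim: "(\<lambda>m. shadow_ratio (H m)) \<longlonglongrightarrow> x" "(\<lambda>m. edge_ratio (H m)) \<longlonglongrightarrow> y"
      and ne: "\<forall>\<^sub>F m in sequentially. verts (H m) \<noteq> {}"
      using feasible_sequence[OF xy] by (elim exE conjE) (rule that)
    have H: "three_graph (H m)" "free_of T3 (H m)" for m using HT by simp_all
    have "(\<lambda>m. (1/k - 1 / (real k)\<^sup>2) - \<gamma> * (1 - shadow_ratio (H m) - 1/k))
        \<longlonglongrightarrow> (1/k - 1 / (real k)\<^sup>2) - \<gamma> * (1 - x - 1/k)"
      by (intro tendsto_intros lim)
    \<comment> \<open>The strict inequalities on \<open>x\<close> put the shadow ratios inside the
      window of the finite bound from some index on.\<close>
    moreover have "\<forall>\<^sub>F m in sequentially. edge_ratio (H m) \<le> (1/k - 1 / (real k)\<^sup>2) - \<gamma> * (1 - shadow_ratio (H m) - 1/k)"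
      using order_tendstoD(1)[OF lim(1) x(1)] order_tendstoD(2)[OF lim(1) x(2)] ne
    proof eventually_elim
      case (elim m)
      show ?case
        using bound[OF cancellative_relation_of_T3_free[OF H(1,2)] elim(3)] elim
        unfolding nondeg_ratio[OF H(1,2) elim(3)] edge_ratio_total[OF H(1,2)] by simp
    qed
    ultimately have "y \<le> (1/k - 1 / (real k)\<^sup>2) - \<gamma> * (1 - x - 1/k)"
      by (rule tendsto_le[OF sequentially_bot _ lim(2)])
    then show "y \<le> (1/k - 1 / (real k)\<^sup>2) - \<gamma> * (1 - 1/k - x)" by (simp add: algebra_simps)
  qed
qed

section \<open>Points of the region and its projection\<close>

lemma steiner_feasible:
  fixes k :: nat
  assumes k: "k \<ge> 3" and k6: "k mod 6 = 1 \<or> k mod 6 = 3"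
  shows "(1 - 1/k, 1/k - 1 / (real k)\<^sup>2) \<in> feasible_region T3"
proof -
  obtain t where t: "steiner {..<k} t" using steiner_exists[OF k k6] by blast
  define H where "H m = blowup k (Suc m) t" for m
  have k0: "k > 0" using k by simp
  note bl = k0 zero_less_Suc t
  have n: "card (verts (H m)) = k * Suc m" for m by (simp add: H_def verts_blowup)
  have "filterlim (\<lambda>m. card (verts (H m))) at_top sequentially"
  proof (rule filterlim_at_top_mono[OF filterlim_ident], intro always_eventually allI)
    fix m
    have "m \<le> 1 * Suc m" by simp
    also have "\<dots> \<le> k * Suc m" using k by (intro mult_right_mono) auto
    finally show "m \<le> card (verts (H m))" by (simp only: n)
  qed
  moreover have "shadow_ratio (H m) = 1 - 1/k" for m
  proof -
    define M where "M = real (Suc m)"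
    have "M > 0" by (simp add: M_def)
    then show ?thesis
      unfolding shadow_ratio_def n unfolding H_def blowup_card_shadow[OF bl] of_nat_mult M_def[symmetric]
      using k0 by (simp add: field_simps power2_eq_square)
  qed
  moreover have "edge_ratio (H m) = 1/k - 1 / (real k)\<^sup>2" for m
  proof -
    define M where "M = real (Suc m)"
    have "M > 0" by (simp add: M_def)
    then show ?thesis
      unfolding edge_ratio_def n unfolding H_def blowup_card_edges[OF bl] of_nat_mult M_def[symmetric]
      using k0 by (simp add: field_simps power2_eq_square power3_eq_cube)
  qed
  moreover have "three_graph (H m) \<and> free_of T3 (H m)" for m
    unfolding H_def using three_graph_blowup[OF bl] blowup_free[OF bl] by blast
  moreover have "1/k - 1 / (real k)\<^sup>2 \<in> {0..1}" "1 - 1/k \<in> {0..1}"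
  proof -
    define r where "r = 1 / real k"
    have r: "0 \<le> r" "r \<le> 1" using k by (simp_all add: r_def)
    then have "r * r \<le> r" by (simp add: mult_left_le_one_le)
    moreover have "1 / (real k)\<^sup>2 = r * r" by (simp add: r_def power2_eq_square)
    moreover have "r - r * r \<le> 1" using r(2) zero_le_square[of r] by linarith
    ultimately show "1/k - 1 / (real k)\<^sup>2 \<in> {0..1}" "1 - 1/k \<in> {0..1}"
      using r unfolding r_def[symmetric] by auto
  qed
  ultimately show ?thesis
    unfolding feasible_region_def using density_limits(1)[of H "1 - 1/k"] density_limits(2)[of H "1/k - 1 / (real k)\<^sup>2"]
    by (auto intro!: exI[of _ H])
qed

text \<open>Take a smallest edge set whose shadow still has \<open>\<tau>\<close> pairs. Removing
  any edge leaves at most \<open>\<tau> - 1\<close> pairs, and that edge accounts for at most three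
  more.\<close>

lemma subgraph_with_shadow_size:
  assumes H: "three_graph H" and \<tau>: "\<tau> \<le> card (shadow H)"
  shows "\<exists>E\<subseteq>edges H. \<tau> \<le> card (shadow (verts H, E)) \<and> card (shadow (verts H, E)) \<le> \<tau> + 2"
proof -
  define P where "P E \<longleftrightarrow> E \<subseteq> edges H \<and> \<tau> \<le> card (shadow (verts H, E))" for E
  have "P (edges H)" using \<tau> by (simp add: P_def)
  then obtain E where E: "P E" and least: "\<And>E'. P E' \<Longrightarrow> card E \<le> card E'"
    using ex_has_least_nat[of P "edges H" card] by blast
  have sub: "three_graph (verts H, F)" if "F \<subseteq> edges H" for F
    using H that unfolding three_graph_def by auto
  have "card (shadow (verts H, E)) \<le> \<tau> + 2"
  proof (cases "E = {}")
    case True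
    then have "shadow (verts H, E) = {}" by (simp add: shadow_def)
    then show ?thesis by simp
  next
    case False
    then obtain e where e: "e \<in> E" by blast
    have EH: "E \<subseteq> edges H" using E by (simp add: P_def)
    have fE: "finite E" using finite_subset[OF EH finite_edges[OF H]] .
    have "card (E - {e}) < card E" using fE e by (rule card_Diff1_less)
    then have "\<not> P (E - {e})" using least[of "E - {e}"] by linarith
    then have less: "card (shadow (verts H, E - {e})) < \<tau>" using EH by (auto simp: P_def)
    have "card e = 3" using H EH e unfolding three_graph_def by auto
    then have fe: "finite e" by (intro card_ge_0_finite) simp
    have pairs: "card {A. A \<subseteq> e \<and> card A = 2} = 3"
      using n_subsets[OF fe, of 2] \<open>card e = 3\<close> by (simp add: choose_two)
    have "shadow (verts H, E) \<subseteq> shadow (verts H, E - {e}) \<union> {A. A \<subseteq> e \<and> card A = 2}"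
      by (auto simp: shadow_def)
    then have "card (shadow (verts H, E)) \<le> card (shadow (verts H, E - {e}) \<union> {A. A \<subseteq> e \<and> card A = 2})"
      using finite_shadow[OF sub[of "E - {e}"]] EH fe by (intro card_mono) auto
    also have "\<dots> \<le> card (shadow (verts H, E - {e})) + 3"
      using card_Un_le[of "shadow (verts H, E - {e})" "{A. A \<subseteq> e \<and> card A = 2}"] pairs by simp
    finally show ?thesis using less by linarith
  qed
  then show ?thesis using E by (auto simp: P_def)
qed

lemma T3_free_subgraph:
  assumes "three_graph H" "free_of T3 H" "E \<subseteq> edges H"
  shows "three_graph (verts H, E)" "free_of T3 (verts H, E)"
proof -
  show t: "three_graph (verts H, E)" using assms unfolding three_graph_def by auto
  have "cancellative H" using assms T3_free_iff_cancellative by blast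
  then have "cancellative (verts H, E)" using assms(3) unfolding cancellative_def by auto
  then show "free_of T3 (verts H, E)" using T3_free_iff_cancellative[OF t] by blast
qed

lemma edge_density_bounds:
  assumes "three_graph H"
  shows "0 \<le> edge_density H" "edge_density H \<le> 1"
proof -
  have fin: "finite (verts H)" and sub: "edges H \<subseteq> {e. e \<subseteq> verts H \<and> card e = 3}"
    using assms unfolding three_graph_def by blast+
  have "card (edges H) \<le> card {e. e \<subseteq> verts H \<and> card e = 3}"
    using fin by (intro card_mono sub) simp
  also have "\<dots> = card (verts H) choose 3" by (rule n_subsets[OF fin])
  finally have le: "real (card (edges H)) \<le> real (card (verts H) choose 3)" by (rule of_nat_mono)
  show "0 \<le> edge_density H" by (simp add: edge_density_def)
  show "edge_density H \<le> 1"
  proof (cases "card (verts H) choose 3 = 0")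
    case True
    show ?thesis unfolding edge_density_def True by simp
  next
    case False
    then show ?thesis unfolding edge_density_def using le by (subst pos_divide_le_eq) auto
  qed
qed

text \<open>Thinning out edges keeps the hypergraphs free and tunes the shadow density up to a
  vanishing error. The edge density is not controlled, so its limit comes from compactness along a
  subsequence.\<close>

lemma proj_region_downward:
  assumes x1: "(x1, y1) \<in> feasible_region T3" and x: "0 \<le> x" "x \<le> x1"
  shows "x \<in> proj_region T3"
proof -
  obtain H :: "nat \<Rightarrow> nat hgraph" where HT: "\<forall>m. three_graph (H m) \<and> free_of T3 (H m)"
    and n: "filterlim (\<lambda>m. card (verts (H m))) at_top sequentially"
    and sd: "(\<lambda>m. shadow_density (H m)) \<longlonglongrightarrow> x1"
    and "(\<lambda>m. edge_density (H m)) \<longlonglongrightarrow> y1"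
    using x1 unfolding feasible_region_def mem_Collect_eq case_prod_conv by (elim conjE exE) (rule that)
  have H: "three_graph (H m) \<and> free_of T3 (H m)" for m using HT by blast
  \<comment> \<open>The minimum keeps the target within the available shadow; it tends to
    \<open>x\<close> since \<open>x \<le> x1\<close>.\<close>
  define \<mu> where "\<mu> m = min x (shadow_density (H m))" for m
  define N where "N m = card (verts (H m)) choose 2" for m
  have \<mu>_nonneg: "0 \<le> \<mu> m" for m using x by (simp add: \<mu>_def shadow_density_def)
  have "\<exists>E\<subseteq>edges (H m). nat \<lfloor>\<mu> m * N m\<rfloor> \<le> card (shadow (verts (H m), E)) \<and>
      card (shadow (verts (H m), E)) \<le> nat \<lfloor>\<mu> m * N m\<rfloor> + 2" for m
  proof (rule subgraph_with_shadow_size)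
    have "\<mu> m * N m \<le> shadow_density (H m) * N m"
      by (intro mult_right_mono) (auto simp: \<mu>_def)
    also have "\<dots> \<le> card (shadow (H m))" by (simp add: shadow_density_def N_def)
    finally show "nat \<lfloor>\<mu> m * N m\<rfloor> \<le> card (shadow (H m))" by linarith
  qed (use H in blast)
  then obtain E where E: "\<And>m. E m \<subseteq> edges (H m)"
    "\<And>m. nat \<lfloor>\<mu> m * N m\<rfloor> \<le> card (shadow (verts (H m), E m))"
    "\<And>m. card (shadow (verts (H m), E m)) \<le> nat \<lfloor>\<mu> m * N m\<rfloor> + 2"
    by metis
  define H' where "H' m = (verts (H m), E m)" for m
  have H': "three_graph (H' m)" "free_of T3 (H' m)" for m
    unfolding H'_def by (rule T3_free_subgraph[OF conjunct1[OF H] conjunct2[OF H] E(1)])+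
  have V': "verts (H' m) = verts (H m)" for m by (simp add: H'_def)
  have "(\<lambda>m. \<bar>shadow_density (H' m) - \<mu> m\<bar>) \<longlonglongrightarrow> 0"
  proof (rule tendsto_sandwich[OF _ _ tendsto_const])
    show "\<forall>\<^sub>F m in sequentially. 0 \<le> \<bar>shadow_density (H' m) - \<mu> m\<bar>" by simp
    have "\<forall>\<^sub>F m in sequentially. 3 \<le> card (verts (H m))"
      using n unfolding filterlim_at_top by blast
    then show "\<forall>\<^sub>F m in sequentially. \<bar>shadow_density (H' m) - \<mu> m\<bar> \<le> 2 / card (verts (H m))"
    proof eventually_elim
      case (elim m)
      define v where "v = real (card (verts (H m)))"
      have v: "v \<ge> 3" using elim by (simp add: v_def)
      have "2 * real (N m) = v * (v - 1)" unfolding N_def v_def by (rule choose_2_real)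
      moreover have "v * 2 \<le> v * (v - 1)" using v by (intro mult_left_mono) auto
      ultimately have Nv: "v \<le> real (N m)" by linarith
      have N0: "real (N m) > 0" using Nv v by linarith
      have "0 \<le> \<mu> m * N m" using \<mu>_nonneg by simp
      then have "real (nat \<lfloor>\<mu> m * N m\<rfloor>) \<le> \<mu> m * N m" "\<mu> m * N m < real (nat \<lfloor>\<mu> m * N m\<rfloor>) + 1"
        by linarith+
      moreover have "real (nat \<lfloor>\<mu> m * N m\<rfloor>) \<le> real (card (shadow (H' m)))"
        "real (card (shadow (H' m))) \<le> real (nat \<lfloor>\<mu> m * N m\<rfloor>) + 2"
        using E(2)[of m] E(3)[of m] by (simp_all add: H'_def)
      ultimately have "\<bar>real (card (shadow (H' m))) - \<mu> m * N m\<bar> \<le> 2" by linarith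
      then have "\<bar>real (card (shadow (H' m))) - \<mu> m * N m\<bar> / N m \<le> 2 / N m"
        using N0 by (intro divide_right_mono) auto
      moreover have "shadow_density (H' m) - \<mu> m = (real (card (shadow (H' m))) - \<mu> m * N m) / N m"
        using N0 by (simp add: shadow_density_def V' N_def[symmetric] diff_divide_distrib)
      moreover have "2 / real (N m) \<le> 2 / v" using Nv v by (intro divide_left_mono) auto
      ultimately show ?case using N0 unfolding v_def by (simp add: abs_divide)
    qed
    have "filterlim (\<lambda>m. real (card (verts (H m)))) at_top sequentially"
      by (rule filterlim_compose[OF filterlim_real_sequentially n])
    then show "(\<lambda>m. 2 / card (verts (H m))) \<longlonglongrightarrow> 0"
      by (rule real_tendsto_divide_at_top[OF tendsto_const])
  qed
  then have "(\<lambda>m. shadow_density (H' m) - \<mu> m) \<longlonglongrightarrow> 0" by (simp only: tendsto_rabs_zero_iff)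
  moreover have "\<mu> \<longlonglongrightarrow> min x x1" unfolding \<mu>_def by (intro tendsto_min tendsto_const sd)
  ultimately have "(\<lambda>m. (shadow_density (H' m) - \<mu> m) + \<mu> m) \<longlonglongrightarrow> 0 + min x x1" by (rule tendsto_add)
  then have sd': "(\<lambda>m. shadow_density (H' m)) \<longlonglongrightarrow> x" using x by (simp add: min_def)
  obtain f :: "nat \<Rightarrow> nat" where f: "strict_mono f" "monoseq (\<lambda>m. edge_density (H' (f m)))"
    using seq_monosub[of "\<lambda>m. edge_density (H' m)"] by auto
  have "Bseq (\<lambda>m. edge_density (H' (f m)))"
  proof (rule BseqI')
    show "norm (edge_density (H' (f m))) \<le> 1" for m
      using edge_density_bounds[OF H'(1)[of "f m"]] by simp
  qed
  then obtain y where y: "(\<lambda>m. edge_density (H' (f m))) \<longlonglongrightarrow> y"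
    using f(2) Bseq_monoseq_convergent convergent_def by blast
  have "0 \<le> y" by (rule LIMSEQ_le_const[OF y]) (use edge_density_bounds(1)[OF H'(1)] in blast)
  moreover have "y \<le> 1" by (rule LIMSEQ_le_const2[OF y]) (use edge_density_bounds(2)[OF H'(1)] in blast)
  moreover have "(\<lambda>m. shadow_density (H' (f m))) \<longlonglongrightarrow> x"
    using LIMSEQ_subseq_LIMSEQ[OF sd' f(1)] by (simp add: o_def)
  moreover have "filterlim (\<lambda>m. card (verts (H' (f m)))) at_top sequentially"
    unfolding V' by (rule filterlim_compose[OF n filterlim_subseq[OF f(1)]])
  moreover have "x \<le> 1" using x x1 by (simp add: feasible_region_def)
  ultimately have "(x, y) \<in> feasible_region T3"
    unfolding feasible_region_def mem_Collect_eq case_prod_conv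
    using x(1) y H' by (intro conjI exI[of _ "\<lambda>m. H' (f m)"] allI) simp_all
  then show ?thesis by (auto simp: proj_region_def)
qed

theorem theorem1p9:
  fixes k :: nat
  assumes "k \<ge> 3" and "k mod 6 = 1 \<or> k mod 6 = 3"
  shows
    "(\<exists>c::real. c > 0 \<and> (\<forall>\<epsilon>::real. 0 < \<epsilon> \<and> \<epsilon> \<le> c \<longrightarrow>
        (\<exists>\<delta>::real. \<delta> > 0 \<and>
           (real k - 1) / real k - \<epsilon> \<in> proj_region T3 \<and>
           feasible_fun T3 ((real k - 1) / real k - \<epsilon>) \<le> (real k - 1) / (real k)^2 - \<delta> \<and>
           (real k - 1) / real k + \<epsilon> \<in> proj_region T3 \<and>
           feasible_fun T3 ((real k - 1) / real k + \<epsilon>) \<le> (real k - 1) / (real k)^2 - \<delta>)))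
     \<and> local_maximum_on (proj_region T3) (feasible_fun T3)
         ((real k - 1) / real k, (real k - 1) / (real k)^2)"
proof -
  define x0 y0 where "x0 = (real k - 1) / real k" and "y0 = (real k - 1) / (real k)^2"
  have k0: "real k \<noteq> 0" using assms(1) by simp
  have x0: "x0 = 1 - 1/k" and y0: "y0 = 1/k - 1 / (real k)\<^sup>2"
    using k0 by (simp_all add: x0_def y0_def diff_divide_distrib power2_eq_square)
  have y0_eq: "y0 = x0 * (1 - x0)" unfolding x0 y0 by (simp add: algebra_simps power2_eq_square)
  have "1 / real k \<le> 1 / 3" using assms(1) by (intro divide_left_mono) auto
  then have x0_half: "x0 \<ge> 2/3" unfolding x0 by linarith
  obtain c \<gamma> :: real where c: "c > 0" "\<gamma> > 0"
    and below: "\<And>x y. (x, y) \<in> feasible_region T3 \<Longrightarrow> x0 - c < x \<Longrightarrow> x < x0 \<Longrightarrow> y \<le> y0 - \<gamma> * (x0 - x)"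
    using feasible_below[OF assms(1)] unfolding x0 y0 by metis
  have feas0: "(x0, y0) \<in> feasible_region T3" unfolding x0 y0 by (rule steiner_feasible[OF assms])
  \<comment> \<open>A system of order \<open>k + 6\<close>, in the same residue class, provides a
    feasible point to the right of \<open>x0\<close>, so that \<open>x0 + \<epsilon>\<close> lies in
    the projection.\<close>
  define x1 where "x1 = 1 - 1 / real (k + 6)"
  have "(k + 6) mod 6 = 1 \<or> (k + 6) mod 6 = 3" "k + 6 \<ge> 3" using assms by simp_all
  from steiner_feasible[OF this(2,1)] obtain y1 where feas1: "(x1, y1) \<in> feasible_region T3"
    unfolding x1_def by blast
  have x01: "x0 < x1" unfolding x0 x1_def using assms(1) by (simp add: frac_less2)
  \<comment> \<open>The parabola \<open>x (1 - x)\<close> lies below its tangent at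
    \<open>x0\<close>, whose slope \<open>1 - 2 x0\<close> is negative.\<close>
  have above: "y \<le> y0 - (x - x0) * (2 * x0 - 1)" if "(x, y) \<in> feasible_region T3" "x0 \<le> x" for x y
  proof -
    have "x * (1 - x) = y0 - (x - x0) * (2 * x0 - 1) - (x - x0)\<^sup>2"
      unfolding y0_eq by (simp add: algebra_simps power2_eq_square)
    then show ?thesis using feasible_le[OF that(1)] zero_le_power2[of "x - x0"] by linarith
  qed
  \<comment> \<open>\<open>c / 2\<close> meets the strict bound in \<open>below\<close>,
    \<open>1/2\<close> keeps \<open>x0 - \<epsilon>\<close> nonnegative, and \<open>x1 - x0\<close>
    keeps \<open>x0 + \<epsilon>\<close> at most \<open>x1\<close>.\<close>
  define c' where "c' = min (c / 2) (min (1 / 2) (x1 - x0))"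
  have c': "c' > 0" "c' < c" "c' \<le> 1/2" "c' \<le> x1 - x0" 
  proof -
    show "c' > 0" "c' < c" using c x01 by (auto simp: c'_def)
    show "c' \<le> 1/2" "c' \<le> x1 - x0"
      unfolding c'_def by (rule min.coboundedI2, simp only: min.cobounded1 min.cobounded2)+
  qed
  have 1: "\<exists>\<delta>>0. x0 - \<epsilon> \<in> proj_region T3 \<and> feasible_fun T3 (x0 - \<epsilon>) \<le> y0 - \<delta> \<and>
      x0 + \<epsilon> \<in> proj_region T3 \<and> feasible_fun T3 (x0 + \<epsilon>) \<le> y0 - \<delta>" if \<epsilon>: "0 < \<epsilon>" "\<epsilon> \<le> c'" for \<epsilon>
  proof -
    have p1: "x0 - \<epsilon> \<in> proj_region T3"
      by (rule proj_region_downward[OF feas0]) (use \<epsilon> c' x0_half in linarith)+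
    have p2: "x0 + \<epsilon> \<in> proj_region T3"
      by (rule proj_region_downward[OF feas1]) (use \<epsilon> c' x0_half in linarith)+
    define \<delta> where "\<delta> = min (\<gamma> * \<epsilon>) (\<epsilon> * (2 * x0 - 1))"
    have "\<delta> > 0" using \<epsilon> c x0_half by (simp add: \<delta>_def)
    moreover have "feasible_fun T3 (x0 - \<epsilon>) \<le> y0 - \<gamma> * (x0 - (x0 - \<epsilon>))"
      by (rule below[OF feasible_fun_max(1)[OF p1]]) (use \<epsilon> c' in linarith)+
    moreover have "feasible_fun T3 (x0 + \<epsilon>) \<le> y0 - (x0 + \<epsilon> - x0) * (2 * x0 - 1)"
      by (rule above[OF feasible_fun_max(1)[OF p2]]) (use \<epsilon> in linarith)
    moreover have "\<delta> \<le> \<gamma> * \<epsilon>" "\<delta> \<le> \<epsilon> * (2 * x0 - 1)" by (simp_all add: \<delta>_def)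
    ultimately show ?thesis using p1 p2 by (intro exI[of _ \<delta>]) auto
  qed
  have p0: "x0 \<in> proj_region T3" using feas0 by (auto simp: proj_region_def)
  have f0: "feasible_fun T3 x0 = y0"
    using feasible_fun_max(2)[OF p0 feas0] above[OF feasible_fun_max(1)[OF p0]] by simp
  have "feasible_fun T3 x \<le> y0" if x: "x \<in> proj_region T3" "\<bar>x - x0\<bar> < c" for x
  proof (cases "x < x0")
    case True
    have "feasible_fun T3 x \<le> y0 - \<gamma> * (x0 - x)"
      by (rule below[OF feasible_fun_max(1)[OF x(1)]]) (use x True in linarith)+
    moreover have "0 \<le> \<gamma> * (x0 - x)" using c True by simp
    ultimately show ?thesis by linarith
  next
    case False
    then have "feasible_fun T3 x \<le> y0 - (x - x0) * (2 * x0 - 1)"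
      using above[OF feasible_fun_max(1)[OF x(1)]] by simp
    moreover have "0 \<le> (x - x0) * (2 * x0 - 1)" using False x0_half by simp
    ultimately show ?thesis by linarith
  qed
  then have "local_maximum_on (proj_region T3) (feasible_fun T3) (x0, y0)"
    unfolding local_maximum_on_def using p0 f0 c(1) by auto
  moreover have "\<exists>c>0. \<forall>\<epsilon>. 0 < \<epsilon> \<and> \<epsilon> \<le> c \<longrightarrow> (\<exists>\<delta>>0. x0 - \<epsilon> \<in> proj_region T3 \<and>
      feasible_fun T3 (x0 - \<epsilon>) \<le> y0 - \<delta> \<and> x0 + \<epsilon> \<in> proj_region T3 \<and> feasible_fun T3 (x0 + \<epsilon>) \<le> y0 - \<delta>)"
    using 1 c'(1) by blast
  ultimately show ?thesis unfolding x0_def y0_def by blast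
qed

end
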